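(* The functor $C^{++}:\mathbf{alg.Sob}\to\mathbf{alg.ISch}$, $X\mapsto(X,\tau'_X,\mathrm{Id})$, is the right adjoint of the underlying functor $U:\mathbf{alg.ISch}\to\mathbf{alg.Sob}$, $(X,\mathscr{O}_X,\beta_X)\mapsto X$.
   Context: **Semirings.** $\mathbf{PIRng}$ is the category of commutative semirings $(R,+,\cdot,0,1)$ with $+$ idempotent and $1+a=1$ for all $a$ (pre-complete idealic semirings; existence of infima is not assumed), ordered by $a\le b\Leftrightarrow a+b=b$. $\mathbf{PIIRng}$ is the full subcategory where $a\cdot a=a$ for all $a$. $\alpha_1:\mathbf{PIRng}\to\mathbf{PIIRng}$ is the left adjoint of the inclusion, and $\alpha_2:R\to\alpha_1(R)$ is the unit of this adjunction. For $a\in R$, $R_a$ is the localization along $\{a^n\}_{n\ge 0}$, i.e. the quotient of $R$ by the congruence generated by $(1,a)$. **Spaces.** A sober space $X$ (every nonempty irreducible closed set has a unique generic point) is algebraic if it is quasi-compact, the intersection of two quasi-compact open sets is quasi-compact, and every open set is a union of quasi-compact open sets. $\mathbf{alg.Sob}$ is the category of algebraic sober spaces and quasi-compact continuous maps (inverse images of quasi-compact open sets are quasi-compact). $C(X)_{\mathrm{cpt}}$ is the set of closed subsets with quasi-compact complement, an object of $\mathbf{PIIRng}$ with $+$ = intersection and $\cdot$ = union (so $Z\le W$ iff $Z\supset W$, and $1=\emptyset$). A quasi-compact continuous $f:X\to Y$ induces $C(f)_{\mathrm{cpt}}:Z\mapsto f^{-1}(Z)$. **Sheaves.** A presheaf on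 $X^{\mathrm{cpt}}$ with values in a category $\mathscr{C}$ is a functor $\mathscr{F}:C(X)_{\mathrm{cpt}}^{\mathrm{op}}\to\mathscr{C}$; it is a sheaf if it is finite continuous, i.e. preserves fiber products: $\mathscr{F}(Z_1+Z_2)\to\mathscr{F}(Z_1)\times_{\mathscr{F}(Z_1Z_2)}\mathscr{F}(Z_2)$ is an isomorphism for all $Z_1,Z_2$. $(f_*\mathscr{F})(Z)=\mathscr{F}(f^{-1}Z)$. $\tau'_X$ is the $\mathbf{PIIRng}$-valued sheaf $Z\mapsto(C(X)_{\mathrm{cpt}})_Z\simeq C(X\setminus Z)_{\mathrm{cpt}}$. **Algebraic idealic schemes.** An object of $\mathbf{alg.ISch}$ is a triple $(X,\mathscr{O}_X,\beta_X)$ with $X$ an algebraic sober space, $\mathscr{O}_X$ a $\mathbf{PIRng}$-valued sheaf on $X^{\mathrm{cpt}}$, and $\beta_X:\alpha_1\mathscr{O}_X\to\tau'_X$ a morphism of $\mathbf{PIIRng}$-valued sheaves ($\alpha_1\mathscr{O}_X$ is the sheafification of $Z\mapsto\alpha_1(\mathscr{O}_X(Z))$), such that whenever $W\le Z$ in $C(X)_{\mathrm{cpt}}$ and $a\in\mathscr{O}_X(Z)$ satisfies $\beta_X(\alpha_2(a))\ge W$ in $\tau'_X(Z)$ ($W$ denoting its image there), the restriction $\mathscr{O}_X(Z)\to\mathscr{O}_X(W)$ factors through $\mathscr{O}_X(Z)_a$. A morphism $(X,\mathscr{O}_X,\beta_X)\to(Y,\mathscr{O}_Y,\beta_Y)$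 is a pair $(f,f^\#)$ with $f:X\to Y$ quasi-compact continuous and $f^\#:\mathscr{O}_Y\to f_*\mathscr{O}_X$ a morphism of $\mathbf{PIRng}$-valued sheaves such that $f_*\beta_X\circ\alpha_1f^\#=C(f)_{\mathrm{cpt}}\circ\beta_Y$ as maps $\alpha_1\mathscr{O}_Y\to f_*\tau'_X$. **The functor $C^{++}$.** It sends $X$ to $(X,\tau'_X,\mathrm{Id})$ and a morphism $f:X\to Y$ to $(f,f^\#)$ with $f^\#:\tau'_Y\to f_*\tau'_X$ the morphism induced by $Z\mapsto f^{-1}(Z)$.
   Formalization: "Right adjoint" is false with these definitions (on the Sierpinski space, a subsheaf of τ' with sections {0,1} has no morphism to C^{++}X over the identity); what is proved is that C^{++} is the left adjoint of U, Hom(C^{++}Y, A) ≅ Hom(Y, U A). *)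

theory Defs
  imports "HOL-Analysis.Abstract_Topology" "HOL-Algebra.Ring"
begin

section \<open>Categories, functors and adjunctions\<close>

text \<open>
  Arrows are not required to determine their domain and codomain, so hom-sets of different pairs
  of objects may overlap and composition takes the three objects involved as arguments:
  \<open>Comp C a b c g f\<close> is the composite of \<open>f : a \<rightarrow> b\<close> and \<open>g : b \<rightarrow> c\<close>.
\<close>

record ('o, 'm) category =
  Obj :: "'o set"
  Hom :: "'o \<Rightarrow> 'o \<Rightarrow> 'm set"
  Ident :: "'o \<Rightarrow> 'm"
  Comp :: "'o \<Rightarrow> 'o \<Rightarrow> 'o \<Rightarrow> 'm \<Rightarrow> 'm \<Rightarrow> 'm"

definition is_category :: "('o, 'm) category \<Rightarrow> bool" where
  "is_category C \<longleftrightarrow>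
     (\<forall>a\<in>Obj C. Ident C a \<in> Hom C a a) \<and>
     (\<forall>a\<in>Obj C. \<forall>b\<in>Obj C. \<forall>c\<in>Obj C. \<forall>f\<in>Hom C a b. \<forall>g\<in>Hom C b c.
        Comp C a b c g f \<in> Hom C a c) \<and>
     (\<forall>a\<in>Obj C. \<forall>b\<in>Obj C. \<forall>f\<in>Hom C a b.
        Comp C a a b f (Ident C a) = f \<and> Comp C a b b (Ident C b) f = f) \<and>
     (\<forall>a\<in>Obj C. \<forall>b\<in>Obj C. \<forall>c\<in>Obj C. \<forall>d\<in>Obj C.
        \<forall>f\<in>Hom C a b. \<forall>g\<in>Hom C b c. \<forall>h\<in>Hom C c d.
        Comp C a b d (Comp C b c d h g) f = Comp C a c d h (Comp C a b c g f))"

record ('o1, 'm1, 'o2, 'm2) cat_functor =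
  onObj :: "'o1 \<Rightarrow> 'o2"
  onHom :: "'o1 \<Rightarrow> 'o1 \<Rightarrow> 'm1 \<Rightarrow> 'm2"

definition is_functor ::
  "('o1, 'm1) category \<Rightarrow> ('o2, 'm2) category \<Rightarrow> ('o1, 'm1, 'o2, 'm2) cat_functor \<Rightarrow> bool" where
  "is_functor C D F \<longleftrightarrow>
     is_category C \<and> is_category D \<and>
     (\<forall>a\<in>Obj C. onObj F a \<in> Obj D) \<and>
     (\<forall>a\<in>Obj C. \<forall>b\<in>Obj C. \<forall>f\<in>Hom C a b. onHom F a b f \<in> Hom D (onObj F a) (onObj F b)) \<and>
     (\<forall>a\<in>Obj C. onHom F a a (Ident C a) = Ident D (onObj F a)) \<and>
     (\<forall>a\<in>Obj C. \<forall>b\<in>Obj C. \<forall>c\<in>Obj C. \<forall>f\<in>Hom C a b. \<forall>g\<in>Hom C b c.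
        onHom F a c (Comp C a b c g f) =
        Comp D (onObj F a) (onObj F b) (onObj F c) (onHom F b c g) (onHom F a b f))"

text \<open>
  \<open>adjunction C D F G\<close>: the functor \<open>F : C \<rightarrow> D\<close> is the left adjoint of \<open>G : D \<rightarrow> C\<close> (equivalently,
  \<open>G\<close> is the right adjoint of \<open>F\<close>), i.e. there are bijections \<open>Hom\<^sub>D(F a, b) \<rightarrow> Hom\<^sub>C(a, G b)\<close>
  natural in \<open>a\<close> and \<open>b\<close>.
\<close>

definition adjunction ::
  "('o1, 'm1) category \<Rightarrow> ('o2, 'm2) category \<Rightarrow> ('o1, 'm1, 'o2, 'm2) cat_functor \<Rightarrow>
   ('o2, 'm2, 'o1, 'm1) cat_functor \<Rightarrow> bool" where
  "adjunction C D F G \<longleftrightarrow>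
     is_functor C D F \<and> is_functor D C G \<and>
     (\<exists>\<Phi>. (\<forall>a\<in>Obj C. \<forall>b\<in>Obj D.
              bij_betw (\<Phi> a b) (Hom D (onObj F a) b) (Hom C a (onObj G b))) \<and>
          (\<forall>a\<in>Obj C. \<forall>a'\<in>Obj C. \<forall>b\<in>Obj D. \<forall>b'\<in>Obj D.
             \<forall>f\<in>Hom C a' a. \<forall>g\<in>Hom D b b'. \<forall>h\<in>Hom D (onObj F a) b.
             \<Phi> a' b' (Comp D (onObj F a') b b' g (Comp D (onObj F a') (onObj F a) b h (onHom F a' a f))) =
             Comp C a' (onObj G b) (onObj G b') (onHom G b b' g)
               (Comp C a' a (onObj G b) (\<Phi> a b h) f)))"


section \<open>Idealic semirings\<close>

text \<open>
  Homomorphisms are taken extensional (\<open>undefined\<close> outside the carrier), so that equality of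
  HOL functions is equality of morphisms.  The library's \<open>ring_hom\<close> does not mention \<open>\<zero>\<close>,
  whose preservation is not automatic for semirings.
\<close>

definition pirng :: "'a ring \<Rightarrow> bool" where
  "pirng R \<longleftrightarrow> semiring R \<and> comm_monoid R \<and>
     (\<forall>a\<in>carrier R. a \<oplus>\<^bsub>R\<^esub> a = a) \<and> (\<forall>a\<in>carrier R. \<one>\<^bsub>R\<^esub> \<oplus>\<^bsub>R\<^esub> a = \<one>\<^bsub>R\<^esub>)"

definition piirng :: "'a ring \<Rightarrow> bool" where
  "piirng R \<longleftrightarrow> pirng R \<and> (\<forall>a\<in>carrier R. a \<otimes>\<^bsub>R\<^esub> a = a)"

definition semiring_hom :: "'a ring \<Rightarrow> 'b ring \<Rightarrow> ('a \<Rightarrow> 'b) set" where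
  "semiring_hom R S = {h \<in> ring_hom R S. h \<in> extensional (carrier R) \<and> h \<zero>\<^bsub>R\<^esub> = \<zero>\<^bsub>S\<^esub>}"

definition ile :: "'a ring \<Rightarrow> 'a \<Rightarrow> 'a \<Rightarrow> bool" where
  "ile R a b \<longleftrightarrow> a \<oplus>\<^bsub>R\<^esub> b = b"

definition congruence :: "'a ring \<Rightarrow> ('a \<times> 'a) set \<Rightarrow> bool" where
  "congruence R E \<longleftrightarrow> equiv (carrier R) E \<and>
     (\<forall>a b c d. (a, b) \<in> E \<and> (c, d) \<in> E \<longrightarrow>
        (a \<oplus>\<^bsub>R\<^esub> c, b \<oplus>\<^bsub>R\<^esub> d) \<in> E \<and> (a \<otimes>\<^bsub>R\<^esub> c, b \<otimes>\<^bsub>R\<^esub> d) \<in> E)"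

definition gen_congruence :: "'a ring \<Rightarrow> ('a \<times> 'a) set \<Rightarrow> ('a \<times> 'a) set" where
  "gen_congruence R P = \<Inter>{E. congruence R E \<and> P \<subseteq> E}"

definition quot_semiring :: "'a ring \<Rightarrow> ('a \<times> 'a) set \<Rightarrow> 'a set ring" where
  "quot_semiring R E =
     \<lparr>carrier = carrier R // E,
      mult = \<lambda>A B. E `` {a \<otimes>\<^bsub>R\<^esub> b | a b. a \<in> A \<and> b \<in> B},
      one = E `` {\<one>\<^bsub>R\<^esub>},
      zero = E `` {\<zero>\<^bsub>R\<^esub>},
      add = \<lambda>A B. E `` {a \<oplus>\<^bsub>R\<^esub> b | a b. a \<in> A \<and> b \<in> B}\<rparr>"

definition quot_map :: "'a ring \<Rightarrow> ('a \<times> 'a) set \<Rightarrow> 'a \<Rightarrow> 'a set" where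
  "quot_map R E = (\<lambda>a\<in>carrier R. E `` {a})"

definition loc_cong :: "'a ring \<Rightarrow> 'a \<Rightarrow> ('a \<times> 'a) set" where
  "loc_cong R a = gen_congruence R {(\<one>\<^bsub>R\<^esub>, a)}"

definition localization :: "'a ring \<Rightarrow> 'a \<Rightarrow> 'a set ring" where
  "localization R a = quot_semiring R (loc_cong R a)"

definition loc_map :: "'a ring \<Rightarrow> 'a \<Rightarrow> 'a \<Rightarrow> 'a set" where
  "loc_map R a = quot_map R (loc_cong R a)"

text \<open>
  The left adjoint \<open>\<alpha>\<^sub>1\<close> of the inclusion of multiplicatively idempotent semirings, realised as the
  universal idempotent quotient, with the quotient map \<open>\<alpha>\<^sub>2\<close> as unit; the universal property is
  \<open>alpha1_universal\<close> below.
\<close>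

definition idem_cong :: "'a ring \<Rightarrow> ('a \<times> 'a) set" where
  "idem_cong R = gen_congruence R {(a \<otimes>\<^bsub>R\<^esub> a, a) | a. a \<in> carrier R}"

definition alpha1 :: "'a ring \<Rightarrow> 'a set ring" where
  "alpha1 R = quot_semiring R (idem_cong R)"

definition alpha2 :: "'a ring \<Rightarrow> 'a \<Rightarrow> 'a set" where
  "alpha2 R = quot_map R (idem_cong R)"

definition alpha1_map :: "'a ring \<Rightarrow> 'b ring \<Rightarrow> ('a \<Rightarrow> 'b) \<Rightarrow> 'a set \<Rightarrow> 'b set" where
  "alpha1_map R S h = (\<lambda>A\<in>carrier (alpha1 R). idem_cong S `` (h ` A))"

lemma congruence_gen:
  assumes "Ring.semiring R" and "P \<subseteq> carrier R \<times> carrier R"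
  shows "congruence R (gen_congruence R P)"
proof -
  interpret Ring.semiring R by fact
  let ?F = "{E. congruence R E \<and> P \<subseteq> E}"
  have full: "carrier R \<times> carrier R \<in> ?F"
    using assms(2) by (simp add: congruence_def equiv_def refl_on_def sym_def trans_def)
  have "equiv (carrier R) (\<Inter>?F)"
  proof (rule equivI)
    show "\<Inter>?F \<subseteq> carrier R \<times> carrier R"
      using full by blast
    show "refl_on (carrier R) (\<Inter>?F)"
      by (simp add: refl_on_def congruence_def equiv_def)
    show "sym (\<Inter>?F)"
      by (simp add: congruence_def equiv_def sym_def)
    show "trans (\<Inter>?F)"
    proof (rule transI)
      fix x y z assume "(x, y) \<in> \<Inter>?F" "(y, z) \<in> \<Inter>?F"
      then have "(x, z) \<in> E" if "E \<in> ?F" for E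
        using that by (auto simp only: Inter_iff mem_Collect_eq congruence_def equiv_def intro: transD[of E x y z])
      then show "(x, z) \<in> \<Inter>?F" by blast
    qed
  qed
  moreover have "(a \<oplus>\<^bsub>R\<^esub> c, b \<oplus>\<^bsub>R\<^esub> d) \<in> \<Inter>?F \<and> (a \<otimes>\<^bsub>R\<^esub> c, b \<otimes>\<^bsub>R\<^esub> d) \<in> \<Inter>?F"
    if "(a, b) \<in> \<Inter>?F" "(c, d) \<in> \<Inter>?F" for a b c d
    using that by (simp add: congruence_def)
  ultimately show ?thesis
    unfolding gen_congruence_def congruence_def[of R "\<Inter>?F"] by blast
qed

lemma gen_congruence_incl: "P \<subseteq> gen_congruence R P"
  by (auto simp: gen_congruence_def)

lemma gen_congruence_least: "congruence R E \<Longrightarrow> P \<subseteq> E \<Longrightarrow> gen_congruence R P \<subseteq> E"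
  by (auto simp: gen_congruence_def)

lemma quot_class_eq:
  assumes "congruence R E" "a \<in> carrier R" "b \<in> carrier R"
  shows "E `` {a} = E `` {b} \<longleftrightarrow> (a, b) \<in> E"
  using assms eq_equiv_class_iff[of "carrier R" E a b] by (simp add: congruence_def)

lemma quot_ops:
  assumes E: "congruence R E" and ab: "a \<in> carrier R" "b \<in> carrier R"
  shows "E `` {a} \<oplus>\<^bsub>quot_semiring R E\<^esub> E `` {b} = E `` {a \<oplus>\<^bsub>R\<^esub> b}"
    and "E `` {a} \<otimes>\<^bsub>quot_semiring R E\<^esub> E `` {b} = E `` {a \<otimes>\<^bsub>R\<^esub> b}"
proof -
  have refl: "(a, a) \<in> E" "(b, b) \<in> E"
    using E ab by (simp_all add: congruence_def equiv_def refl_on_def)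
  have tr: "(x, z) \<in> E" if "(x, y) \<in> E" "(y, z) \<in> E" for x y z
    using E that unfolding congruence_def equiv_def trans_def by blast
  have add: "(a \<oplus>\<^bsub>R\<^esub> b, c \<oplus>\<^bsub>R\<^esub> d) \<in> E" if "(a, c) \<in> E" "(b, d) \<in> E" for c d
    using E that by (auto simp: congruence_def)
  have mult: "(a \<otimes>\<^bsub>R\<^esub> b, c \<otimes>\<^bsub>R\<^esub> d) \<in> E" if "(a, c) \<in> E" "(b, d) \<in> E" for c d
    using E that by (auto simp: congruence_def)
  have "E `` {c \<oplus>\<^bsub>R\<^esub> d | c d. c \<in> E `` {a} \<and> d \<in> E `` {b}} = E `` {a \<oplus>\<^bsub>R\<^esub> b}"
    using refl add tr by (intro equalityI subsetI) (blast, blast)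
  then show "E `` {a} \<oplus>\<^bsub>quot_semiring R E\<^esub> E `` {b} = E `` {a \<oplus>\<^bsub>R\<^esub> b}"
    by (simp add: quot_semiring_def)
  have "E `` {c \<otimes>\<^bsub>R\<^esub> d | c d. c \<in> E `` {a} \<and> d \<in> E `` {b}} = E `` {a \<otimes>\<^bsub>R\<^esub> b}"
    using refl mult tr by (intro equalityI subsetI) (blast, blast)
  then show "E `` {a} \<otimes>\<^bsub>quot_semiring R E\<^esub> E `` {b} = E `` {a \<otimes>\<^bsub>R\<^esub> b}"
    by (simp add: quot_semiring_def)
qed

lemma quot_carrier: "x \<in> carrier (quot_semiring R E) \<longleftrightarrow> (\<exists>a\<in>carrier R. x = E `` {a})"
  by (auto simp: quot_semiring_def quotient_def)

lemma pirng_quot: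
  assumes R: "pirng R" and E: "congruence R E"
  shows "pirng (quot_semiring R E)"
proof -
  interpret Ring.semiring R using R by (simp add: pirng_def)
  interpret comm_monoid R using R by (simp add: pirng_def)
  let ?Q = "quot_semiring R E"
  note ops = quot_ops[OF E]
  have one: "\<one>\<^bsub>?Q\<^esub> = E `` {\<one>\<^bsub>R\<^esub>}" and zero: "\<zero>\<^bsub>?Q\<^esub> = E `` {\<zero>\<^bsub>R\<^esub>}"
    by (simp_all add: quot_semiring_def)
  have el: "E `` {a} \<in> carrier ?Q" if "a \<in> carrier R" for a
    using that by (auto simp: quot_carrier)
  have ex: "\<exists>a\<in>carrier R. x = E `` {a}" if "x \<in> carrier ?Q" for x
    using that by (simp add: quot_carrier)
  have mon: "monoid ?Q"
    by (rule monoidI) (auto dest!: ex simp: ops one el m_assoc)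
  have comm: "x \<oplus>\<^bsub>?Q\<^esub> y = y \<oplus>\<^bsub>?Q\<^esub> x" if xy: "x \<in> carrier ?Q" "y \<in> carrier ?Q" for x y
  proof -
    obtain a where a: "a \<in> carrier R" "x = E `` {a}" by (rule bexE[OF ex[OF xy(1)]])
    obtain b where b: "b \<in> carrier R" "y = E `` {b}" by (rule bexE[OF ex[OF xy(2)]])
    have "a \<oplus>\<^bsub>R\<^esub> b = b \<oplus>\<^bsub>R\<^esub> a" using a b by (simp add: a_comm)
    then show ?thesis by (simp only: a b ops(1))
  qed
  have mcomm: "x \<otimes>\<^bsub>?Q\<^esub> y = y \<otimes>\<^bsub>?Q\<^esub> x" if xy: "x \<in> carrier ?Q" "y \<in> carrier ?Q" for x y
  proof -
    obtain a where a: "a \<in> carrier R" "x = E `` {a}" by (rule bexE[OF ex[OF xy(1)]])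
    obtain b where b: "b \<in> carrier R" "y = E `` {b}" by (rule bexE[OF ex[OF xy(2)]])
    have "a \<otimes>\<^bsub>R\<^esub> b = b \<otimes>\<^bsub>R\<^esub> a" using a b by (simp add: m_comm)
    then show ?thesis by (simp only: a b ops(2))
  qed
  have amon: "abelian_monoid ?Q"
  proof (rule abelian_monoidI)
    show "x \<oplus>\<^bsub>?Q\<^esub> y \<in> carrier ?Q" if "x \<in> carrier ?Q" "y \<in> carrier ?Q" for x y
      using that by (auto dest!: ex simp: ops el)
    show "\<zero>\<^bsub>?Q\<^esub> \<in> carrier ?Q" by (simp add: zero el)
    show "(x \<oplus>\<^bsub>?Q\<^esub> y) \<oplus>\<^bsub>?Q\<^esub> z = x \<oplus>\<^bsub>?Q\<^esub> (y \<oplus>\<^bsub>?Q\<^esub> z)"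
      if "x \<in> carrier ?Q" "y \<in> carrier ?Q" "z \<in> carrier ?Q" for x y z
      using that by (auto dest!: ex simp: ops a_assoc)
    show "\<zero>\<^bsub>?Q\<^esub> \<oplus>\<^bsub>?Q\<^esub> x = x" if "x \<in> carrier ?Q" for x
      using that by (auto dest!: ex simp: ops zero)
  qed (rule comm)
  have "Ring.semiring ?Q"
    by (intro semiring.intro amon mon semiring_axioms.intro)
       (auto dest!: ex simp: ops zero l_distr r_distr)
  moreover have "comm_monoid ?Q"
    by (intro comm_monoid.intro mon comm_monoid_axioms.intro mcomm)
  moreover have "\<forall>x\<in>carrier ?Q. x \<oplus>\<^bsub>?Q\<^esub> x = x \<and> \<one>\<^bsub>?Q\<^esub> \<oplus>\<^bsub>?Q\<^esub> x = \<one>\<^bsub>?Q\<^esub>"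
    using R by (auto dest!: ex simp: ops one pirng_def)
  ultimately show ?thesis by (auto simp: pirng_def)
qed

lemma quot_map_hom:
  assumes R: "pirng R" and E: "congruence R E"
  shows "quot_map R E \<in> semiring_hom R (quot_semiring R E)"
proof -
  interpret Ring.semiring R using R by (simp add: pirng_def)
  show ?thesis
    by (auto simp: semiring_hom_def ring_hom_def quot_map_def quot_carrier quot_ops[OF E])
       (auto simp: quot_semiring_def)
qed

lemma congruence_ker:
  assumes "pirng R" "pirng S" and h: "h \<in> semiring_hom R S"
  shows "congruence R {(a, b). a \<in> carrier R \<and> b \<in> carrier R \<and> h a = h b}"
proof -
  interpret Ring.semiring R using assms by (simp add: pirng_def)
  show ?thesis using h
    by (auto simp: congruence_def semiring_hom_def ring_hom_def intro!: equivI refl_onI symI transI)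
qed

lemma quot_universal:
  assumes R: "pirng R" and S: "pirng S" and h: "h \<in> semiring_hom R S" and E: "congruence R E"
    and ker: "\<And>a b. (a, b) \<in> E \<Longrightarrow> h a = h b"
  shows "\<exists>!k. k \<in> semiring_hom (quot_semiring R E) S \<and> (\<forall>a\<in>carrier R. k (quot_map R E a) = h a)"
proof -
  interpret Ring.semiring R using R by (simp add: pirng_def)
  let ?Q = "quot_semiring R E"
  define k where "k = (\<lambda>A\<in>carrier ?Q. h (SOME a. a \<in> A \<and> a \<in> carrier R))"
  have k: "k (E `` {a}) = h a" if "a \<in> carrier R" for a
  proof -
    have "(a, a) \<in> E" using that E by (simp add: congruence_def equiv_def refl_on_def)
    then have "(a, SOME b. b \<in> E `` {a} \<and> b \<in> carrier R) \<in> E"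
      using that someI[of "\<lambda>b. b \<in> E `` {a} \<and> b \<in> carrier R" a] by (simp only: Image_singleton_iff)
    then have "h a = h (SOME b. b \<in> E `` {a} \<and> b \<in> carrier R)" by (rule ker)
    moreover have "E `` {a} \<in> carrier ?Q" using that by (auto simp: quot_carrier)
    ultimately show ?thesis by (simp add: k_def)
  qed
  have hom: "k \<in> semiring_hom ?Q S"
  proof -
    have "k \<in> extensional (carrier ?Q)" by (simp add: k_def)
    moreover have "k \<one>\<^bsub>?Q\<^esub> = \<one>\<^bsub>S\<^esub>" "k \<zero>\<^bsub>?Q\<^esub> = \<zero>\<^bsub>S\<^esub>"
      using h by (simp_all add: quot_semiring_def k semiring_hom_def ring_hom_def)
    moreover have "h (a \<oplus>\<^bsub>R\<^esub> b) = h a \<oplus>\<^bsub>S\<^esub> h b" "h (a \<otimes>\<^bsub>R\<^esub> b) = h a \<otimes>\<^bsub>S\<^esub> h b" "h a \<in> carrier S"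
      if "a \<in> carrier R" "b \<in> carrier R" for a b
      using h that by (auto simp: semiring_hom_def ring_hom_def)
    ultimately show ?thesis
      by (auto simp: semiring_hom_def ring_hom_def quot_carrier quot_ops[OF E] k)
  qed
  show ?thesis
  proof (rule ex1I[of _ k])
    show "k \<in> semiring_hom ?Q S \<and> (\<forall>a\<in>carrier R. k (quot_map R E a) = h a)"
      using hom by (simp add: quot_map_def k)
  next
    fix k' assume k': "k' \<in> semiring_hom ?Q S \<and> (\<forall>a\<in>carrier R. k' (quot_map R E a) = h a)"
    show "k' = k"
    proof (rule extensionalityI[of _ "carrier ?Q"])
      show "k' \<in> extensional (carrier ?Q)" using k' by (simp add: semiring_hom_def)
      show "k \<in> extensional (carrier ?Q)" by (simp add: k_def)
      show "k' A = k A" if "A \<in> carrier ?Q" for A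
        using that k' by (auto simp: quot_carrier quot_map_def k)
    qed
  qed
qed

lemma congruence_idem: "pirng R \<Longrightarrow> congruence R (idem_cong R)"
  unfolding idem_cong_def
  by (rule congruence_gen) (auto simp: pirng_def Ring.semiring_def intro: monoid.m_closed)

lemma piirng_alpha1:
  assumes R: "pirng R" shows "piirng (alpha1 R)"
proof -
  interpret Ring.semiring R using R by (simp add: pirng_def)
  have sq: "(a \<otimes>\<^bsub>R\<^esub> a, a) \<in> idem_cong R" if "a \<in> carrier R" for a
    unfolding idem_cong_def by (rule subsetD[OF gen_congruence_incl]) (use that in blast)
  have "A \<otimes>\<^bsub>alpha1 R\<^esub> A = A" if A: "A \<in> carrier (alpha1 R)" for A
  proof -
    obtain a where a: "a \<in> carrier R" "A = idem_cong R `` {a}"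
      by (rule bexE[OF A[unfolded alpha1_def quot_carrier]])
    have "idem_cong R `` {a \<otimes>\<^bsub>R\<^esub> a} = idem_cong R `` {a}"
      using quot_class_eq[OF congruence_idem[OF R]] sq a(1) m_closed by simp
    then show ?thesis
      using a by (simp add: alpha1_def quot_ops[OF congruence_idem[OF R]])
  qed
  then show ?thesis
    using pirng_quot[OF R congruence_idem[OF R]] by (simp add: piirng_def alpha1_def)
qed

lemma alpha2_hom: "pirng R \<Longrightarrow> alpha2 R \<in> semiring_hom R (alpha1 R)"
  unfolding alpha1_def alpha2_def by (rule quot_map_hom) (auto intro: congruence_idem)

theorem alpha1_universal:
  assumes R: "pirng R" and S: "piirng S" and h: "h \<in> semiring_hom R S"
  shows "\<exists>!k. k \<in> semiring_hom (alpha1 R) S \<and> (\<forall>a\<in>carrier R. k (alpha2 R a) = h a)"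
proof -
  have S': "pirng S" using S by (simp add: piirng_def)
  interpret Ring.semiring R using R by (simp add: pirng_def)
  have "idem_cong R \<subseteq> {(a, b). a \<in> carrier R \<and> b \<in> carrier R \<and> h a = h b}"
    unfolding idem_cong_def
    using S h by (intro gen_congruence_least congruence_ker[OF R S' h])
                 (auto simp: piirng_def semiring_hom_def ring_hom_def)
  then show ?thesis
    unfolding alpha1_def alpha2_def
    by (intro quot_universal[OF R S' h congruence_idem[OF R]]) auto
qed


section \<open>Algebraic sober spaces\<close>

definition irreducible_in :: "'p topology \<Rightarrow> 'p set \<Rightarrow> bool" where
  "irreducible_in X S \<longleftrightarrow> S \<noteq> {} \<and>
     (\<forall>A B. closedin X A \<and> closedin X B \<and> S \<subseteq> A \<union> B \<longrightarrow> S \<subseteq> A \<or> S \<subseteq> B)"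

definition sober_space :: "'p topology \<Rightarrow> bool" where
  "sober_space X \<longleftrightarrow>
     (\<forall>S. closedin X S \<and> irreducible_in X S \<longrightarrow> (\<exists>!x. x \<in> topspace X \<and> X closure_of {x} = S))"

definition qcopen :: "'p topology \<Rightarrow> 'p set \<Rightarrow> bool" where
  "qcopen X U \<longleftrightarrow> openin X U \<and> compactin X U"

definition algebraic_sober :: "'p topology \<Rightarrow> bool" where
  "algebraic_sober X \<longleftrightarrow> sober_space X \<and> compact_space X \<and>
     (\<forall>U V. qcopen X U \<and> qcopen X V \<longrightarrow> qcopen X (U \<inter> V)) \<and>
     (\<forall>U. openin X U \<longrightarrow> (\<exists>\<U>. (\<forall>V\<in>\<U>. qcopen X V) \<and> U = \<Union>\<U>))"

definition preim :: "'p topology \<Rightarrow> ('p \<Rightarrow> 'q) \<Rightarrow> 'q set \<Rightarrow> 'p set" where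
  "preim X f Z = {x \<in> topspace X. f x \<in> Z}"

definition qc_maps :: "'p topology \<Rightarrow> 'q topology \<Rightarrow> ('p \<Rightarrow> 'q) set" where
  "qc_maps X Y = {f. f \<in> extensional (topspace X) \<and> continuous_map X Y f \<and>
     (\<forall>V. qcopen Y V \<longrightarrow> qcopen X (preim X f V))}"

definition alg_Sob :: "('p topology, 'p \<Rightarrow> 'p) category" where
  "alg_Sob =
     \<lparr>Obj = {X. algebraic_sober X},
      Hom = qc_maps,
      Ident = \<lambda>X. \<lambda>x\<in>topspace X. x,
      Comp = \<lambda>X Y Z g f. compose (topspace X) g f\<rparr>"

text \<open>The semiring \<open>C(X)\<^sub>c\<^sub>p\<^sub>t\<close>; its order is reverse inclusion.\<close>

definition Ccpt :: "'p topology \<Rightarrow> 'p set ring" where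
  "Ccpt X =
     \<lparr>carrier = {Z. closedin X Z \<and> compactin X (topspace X - Z)},
      mult = (\<union>), one = {}, zero = topspace X, add = (\<inter>)\<rparr>"


section \<open>Sheaves of idealic semirings\<close>

text \<open>
  For \<open>W \<le> Z\<close> in \<open>C(X)\<^sub>c\<^sub>p\<^sub>t\<close>, \<open>res F Z W : F(Z) \<rightarrow> F(W)\<close> is the restriction.
\<close>

record ('p, 'r) presheaf =
  sec :: "'p set \<Rightarrow> 'r ring"
  res :: "'p set \<Rightarrow> 'p set \<Rightarrow> 'r \<Rightarrow> 'r"

definition is_presheaf :: "'p topology \<Rightarrow> ('p, 'r) presheaf \<Rightarrow> bool" where
  "is_presheaf X F \<longleftrightarrow>
     (\<forall>Z\<in>carrier (Ccpt X). pirng (sec F Z)) \<and>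
     (\<forall>Z\<in>carrier (Ccpt X). \<forall>W\<in>carrier (Ccpt X). ile (Ccpt X) W Z \<longrightarrow>
        res F Z W \<in> semiring_hom (sec F Z) (sec F W)) \<and>
     (\<forall>Z\<in>carrier (Ccpt X). \<forall>s\<in>carrier (sec F Z). res F Z Z s = s) \<and>
     (\<forall>Z\<in>carrier (Ccpt X). \<forall>W\<in>carrier (Ccpt X). \<forall>V\<in>carrier (Ccpt X).
        ile (Ccpt X) W Z \<and> ile (Ccpt X) V W \<longrightarrow>
        (\<forall>s\<in>carrier (sec F Z). res F W V (res F Z W s) = res F Z V s))"

text \<open>
  The canonical map to the fibre product is a homomorphism for any presheaf, so it is an
  isomorphism of semirings iff it is bijective.  There is no condition for the empty cover.
\<close>

definition is_sheaf :: "'p topology \<Rightarrow> ('p, 'r) presheaf \<Rightarrow> bool" where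
  "is_sheaf X F \<longleftrightarrow> is_presheaf X F \<and>
     (\<forall>Z1\<in>carrier (Ccpt X). \<forall>Z2\<in>carrier (Ccpt X).
        bij_betw (\<lambda>s. (res F (Z1 \<oplus>\<^bsub>Ccpt X\<^esub> Z2) Z1 s, res F (Z1 \<oplus>\<^bsub>Ccpt X\<^esub> Z2) Z2 s))
          (carrier (sec F (Z1 \<oplus>\<^bsub>Ccpt X\<^esub> Z2)))
          {(s1, s2). s1 \<in> carrier (sec F Z1) \<and> s2 \<in> carrier (sec F Z2) \<and>
             res F Z1 (Z1 \<otimes>\<^bsub>Ccpt X\<^esub> Z2) s1 = res F Z2 (Z1 \<otimes>\<^bsub>Ccpt X\<^esub> Z2) s2})"

definition presheaf_mor ::
  "'p topology \<Rightarrow> ('p, 'r) presheaf \<Rightarrow> ('p, 's) presheaf \<Rightarrow> ('p set \<Rightarrow> 'r \<Rightarrow> 's) set" where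
  "presheaf_mor X F G = {\<phi>. \<phi> \<in> extensional (carrier (Ccpt X)) \<and>
     (\<forall>Z\<in>carrier (Ccpt X). \<phi> Z \<in> semiring_hom (sec F Z) (sec G Z)) \<and>
     (\<forall>Z\<in>carrier (Ccpt X). \<forall>W\<in>carrier (Ccpt X). ile (Ccpt X) W Z \<longrightarrow>
        (\<forall>s\<in>carrier (sec F Z). \<phi> W (res F Z W s) = res G Z W (\<phi> Z s)))}"

definition pushforward ::
  "'p topology \<Rightarrow> ('p \<Rightarrow> 'q) \<Rightarrow> ('p, 'r) presheaf \<Rightarrow> ('q, 'r) presheaf" where
  "pushforward X f F =
     \<lparr>sec = \<lambda>Z. sec F (preim X f Z), res = \<lambda>Z W. res F (preim X f Z) (preim X f W)\<rparr>"

text \<open>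
  Sheafification.  By the form of the sheaf condition, the covers of \<open>Z\<close> are the finite nonempty
  families with sum \<open>Z\<close>.  Two sections, given as pairs \<open>(W, s)\<close> with \<open>s \<in> F(W)\<close>, agree locally if
  their restrictions to some cover of the overlap coincide.  A section of the sheafification over
  \<open>Z\<close> is a finite locally matching family \<open>P\<close> on a cover of \<open>Z\<close>, up to local agreement; it is
  represented by the set \<open>saturate X F Z P\<close> of all sections over elements below \<open>Z\<close> which agree
  locally with all members of \<open>P\<close>.
\<close>

definition covers :: "'p topology \<Rightarrow> 'p set \<Rightarrow> 'p set set \<Rightarrow> bool" where
  "covers X Z D \<longleftrightarrow> finite D \<and> D \<noteq> {} \<and> D \<subseteq> carrier (Ccpt X) \<and> \<Inter>D = Z"

definition agree ::
  "'p topology \<Rightarrow> ('p, 'r) presheaf \<Rightarrow> 'p set \<times> 'r \<Rightarrow> 'p set \<times> 'r \<Rightarrow> bool" where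
  "agree X F = (\<lambda>(V, s) (W, t).
     \<exists>D. covers X (V \<otimes>\<^bsub>Ccpt X\<^esub> W) D \<and> (\<forall>T\<in>D. res F V T s = res F W T t))"

definition local_family ::
  "'p topology \<Rightarrow> ('p, 'r) presheaf \<Rightarrow> 'p set \<Rightarrow> ('p set \<times> 'r) set \<Rightarrow> bool" where
  "local_family X F Z P \<longleftrightarrow> finite P \<and> covers X Z (fst ` P) \<and>
     (\<forall>(W, s)\<in>P. s \<in> carrier (sec F W)) \<and> (\<forall>p\<in>P. \<forall>q\<in>P. agree X F p q)"

definition saturate ::
  "'p topology \<Rightarrow> ('p, 'r) presheaf \<Rightarrow> 'p set \<Rightarrow> ('p set \<times> 'r) set \<Rightarrow> ('p set \<times> 'r) set" where
  "saturate X F Z P = {(W, s). W \<in> carrier (Ccpt X) \<and> ile (Ccpt X) W Z \<and> s \<in> carrier (sec F W) \<and>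
     (\<forall>p\<in>P. agree X F p (W, s))}"

definition sheafify_sec :: "'p topology \<Rightarrow> ('p, 'r) presheaf \<Rightarrow> 'p set \<Rightarrow> ('p set \<times> 'r) set ring" where
  "sheafify_sec X F Z =
     \<lparr>carrier = saturate X F Z ` {P. local_family X F Z P},
      mult = \<lambda>S T. saturate X F Z
        {(V \<otimes>\<^bsub>Ccpt X\<^esub> W, res F V (V \<otimes>\<^bsub>Ccpt X\<^esub> W) s \<otimes>\<^bsub>sec F (V \<otimes>\<^bsub>Ccpt X\<^esub> W)\<^esub> res F W (V \<otimes>\<^bsub>Ccpt X\<^esub> W) t)
          | V W s t. (V, s) \<in> S \<and> (W, t) \<in> T},
      one = saturate X F Z {(Z, \<one>\<^bsub>sec F Z\<^esub>)},
      zero = saturate X F Z {(Z, \<zero>\<^bsub>sec F Z\<^esub>)},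
      add = \<lambda>S T. saturate X F Z
        {(V \<otimes>\<^bsub>Ccpt X\<^esub> W, res F V (V \<otimes>\<^bsub>Ccpt X\<^esub> W) s \<oplus>\<^bsub>sec F (V \<otimes>\<^bsub>Ccpt X\<^esub> W)\<^esub> res F W (V \<otimes>\<^bsub>Ccpt X\<^esub> W) t)
          | V W s t. (V, s) \<in> S \<and> (W, t) \<in> T}\<rparr>"

definition sheafify :: "'p topology \<Rightarrow> ('p, 'r) presheaf \<Rightarrow> ('p, ('p set \<times> 'r) set) presheaf" where
  "sheafify X F =
     \<lparr>sec = sheafify_sec X F,
      res = \<lambda>Z W. \<lambda>S\<in>carrier (sheafify_sec X F Z). {(V, s) \<in> S. ile (Ccpt X) V W}\<rparr>"

definition sheafify_unit ::
  "'p topology \<Rightarrow> ('p, 'r) presheaf \<Rightarrow> 'p set \<Rightarrow> 'r \<Rightarrow> ('p set \<times> 'r) set" where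
  "sheafify_unit X F = (\<lambda>Z\<in>carrier (Ccpt X). \<lambda>s\<in>carrier (sec F Z). saturate X F Z {(Z, s)})"

text \<open>
  \<open>sheafify_map X Y f F G \<phi>\<close> is the morphism from the sheafification of \<open>F\<close> (on \<open>Y\<close>) to the direct
  image of the sheafification of \<open>G\<close> (on \<open>X\<close>) induced by \<open>\<phi> : F \<rightarrow> f\<^sub>*G\<close>.
\<close>

definition sheafify_map ::
  "'p topology \<Rightarrow> 'q topology \<Rightarrow> ('p \<Rightarrow> 'q) \<Rightarrow> ('q, 's) presheaf \<Rightarrow> ('p, 'r) presheaf \<Rightarrow>
   ('q set \<Rightarrow> 's \<Rightarrow> 'r) \<Rightarrow> 'q set \<Rightarrow> ('q set \<times> 's) set \<Rightarrow> ('p set \<times> 'r) set" where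
  "sheafify_map X Y f F G \<phi> =
     (\<lambda>Z\<in>carrier (Ccpt Y). \<lambda>S\<in>carrier (sheafify_sec Y F Z).
        saturate X G (preim X f Z) {(preim X f W, \<phi> W s) | W s. (W, s) \<in> S})"

text \<open>
  \<open>sheafify_ext X F G \<phi>\<close> is the extension of a presheaf morphism \<open>\<phi>\<close> from \<open>F\<close> to a sheaf \<open>G\<close> to the
  sheafification of \<open>F\<close>: the unique section of \<open>G\<close> restricting to the given local data.
\<close>

definition sheafify_ext ::
  "'p topology \<Rightarrow> ('p, 'r) presheaf \<Rightarrow> ('p, 's) presheaf \<Rightarrow>
   ('p set \<Rightarrow> 'r \<Rightarrow> 's) \<Rightarrow> 'p set \<Rightarrow> ('p set \<times> 'r) set \<Rightarrow> 's" where
  "sheafify_ext X F G \<phi> =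
     (\<lambda>Z\<in>carrier (Ccpt X). \<lambda>S\<in>carrier (sheafify_sec X F Z).
        THE t. t \<in> carrier (sec G Z) \<and> (\<forall>(W, s)\<in>S. res G Z W t = \<phi> W s))"

definition alpha1_presheaf :: "('p, 'r) presheaf \<Rightarrow> ('p, 'r set) presheaf" where
  "alpha1_presheaf F =
     \<lparr>sec = \<lambda>Z. alpha1 (sec F Z), res = \<lambda>Z W. alpha1_map (sec F Z) (sec F W) (res F Z W)\<rparr>"

definition alpha1_sheaf :: "'p topology \<Rightarrow> ('p, 'r) presheaf \<Rightarrow> ('p, ('p set \<times> 'r set) set) presheaf" where
  "alpha1_sheaf X F = sheafify X (alpha1_presheaf F)"

definition alpha2_sheaf ::
  "'p topology \<Rightarrow> ('p, 'r) presheaf \<Rightarrow> 'p set \<Rightarrow> 'r \<Rightarrow> ('p set \<times> 'r set) set" where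
  "alpha2_sheaf X F Z a = sheafify_unit X (alpha1_presheaf F) Z (alpha2 (sec F Z) a)"

definition alpha1_mor ::
  "'p topology \<Rightarrow> 'q topology \<Rightarrow> ('p \<Rightarrow> 'q) \<Rightarrow> ('q, 's) presheaf \<Rightarrow> ('p, 'r) presheaf \<Rightarrow>
   ('q set \<Rightarrow> 's \<Rightarrow> 'r) \<Rightarrow> 'q set \<Rightarrow> ('q set \<times> 's set) set \<Rightarrow> ('p set \<times> 'r set) set" where
  "alpha1_mor X Y f F G \<phi> =
     sheafify_map X Y f (alpha1_presheaf F) (alpha1_presheaf G)
       (\<lambda>Z. alpha1_map (sec F Z) (sec G (preim X f Z)) (\<phi> Z))"

text \<open>The sheaf \<open>\<tau>'\<^sub>X\<close>, and the morphism \<open>\<tau>'\<^sub>Y \<rightarrow> f\<^sub>*\<tau>'\<^sub>X\<close> induced by \<open>f : X \<rightarrow> Y\<close>.\<close>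

definition tau :: "'p topology \<Rightarrow> ('p, 'p set set) presheaf" where
  "tau X =
     \<lparr>sec = \<lambda>Z. localization (Ccpt X) Z,
      res = \<lambda>Z W. \<lambda>A\<in>carrier (localization (Ccpt X) Z). loc_cong (Ccpt X) W `` A\<rparr>"

definition tau_map ::
  "'p topology \<Rightarrow> 'q topology \<Rightarrow> ('p \<Rightarrow> 'q) \<Rightarrow> 'q set \<Rightarrow> 'q set set \<Rightarrow> 'p set set" where
  "tau_map X Y f =
     (\<lambda>Z\<in>carrier (Ccpt Y). \<lambda>A\<in>carrier (localization (Ccpt Y) Z).
        loc_cong (Ccpt X) (preim X f Z) `` (preim X f ` A))"


section \<open>Algebraic idealic schemes\<close>

record ('p, 'r) isch =
  space :: "'p topology"
  struct :: "('p, 'r) presheaf"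
  beta :: "'p set \<Rightarrow> ('p set \<times> 'r set) set \<Rightarrow> 'p set set"

definition factors_through_loc :: "'a ring \<Rightarrow> 'b ring \<Rightarrow> 'a \<Rightarrow> ('a \<Rightarrow> 'b) \<Rightarrow> bool" where
  "factors_through_loc R S a h \<longleftrightarrow>
     (\<exists>k\<in>semiring_hom (localization R a) S. \<forall>s\<in>carrier R. h s = k (loc_map R a s))"

definition is_isch :: "('p, 'r) isch \<Rightarrow> bool" where
  "is_isch A \<longleftrightarrow>
     algebraic_sober (space A) \<and> is_sheaf (space A) (struct A) \<and>
     beta A \<in> presheaf_mor (space A) (alpha1_sheaf (space A) (struct A)) (tau (space A)) \<and>
     (\<forall>Z\<in>carrier (Ccpt (space A)). \<forall>W\<in>carrier (Ccpt (space A)). ile (Ccpt (space A)) W Z \<longrightarrow>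
        (\<forall>a\<in>carrier (sec (struct A) Z).
           ile (sec (tau (space A)) Z)
             (loc_map (Ccpt (space A)) Z W) (beta A Z (alpha2_sheaf (space A) (struct A) Z a)) \<longrightarrow>
           factors_through_loc (sec (struct A) Z) (sec (struct A) W) a (res (struct A) Z W)))"

type_synonym ('p, 'r) isch_mor = "('p \<Rightarrow> 'p) \<times> ('p set \<Rightarrow> 'r \<Rightarrow> 'r)"

definition isch_hom :: "('p, 'r) isch \<Rightarrow> ('p, 'r) isch \<Rightarrow> ('p, 'r) isch_mor set" where
  "isch_hom A B = {(f, \<phi>).
     f \<in> qc_maps (space A) (space B) \<and>
     \<phi> \<in> presheaf_mor (space B) (struct B) (pushforward (space A) f (struct A)) \<and>
     (\<forall>Z\<in>carrier (Ccpt (space B)). \<forall>S\<in>carrier (sec (alpha1_sheaf (space B) (struct B)) Z).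
        beta A (preim (space A) f Z)
          (alpha1_mor (space A) (space B) f (struct B) (struct A) \<phi> Z S) =
        tau_map (space A) (space B) f Z (beta B Z S))}"

definition isch_id :: "('p, 'r) isch \<Rightarrow> ('p, 'r) isch_mor" where
  "isch_id A =
     (\<lambda>x\<in>topspace (space A). x,
      \<lambda>Z\<in>carrier (Ccpt (space A)). \<lambda>s\<in>carrier (sec (struct A) Z). s)"

definition isch_comp ::
  "('p, 'r) isch \<Rightarrow> ('p, 'r) isch \<Rightarrow> ('p, 'r) isch \<Rightarrow>
   ('p, 'r) isch_mor \<Rightarrow> ('p, 'r) isch_mor \<Rightarrow> ('p, 'r) isch_mor" where
  "isch_comp A B C = (\<lambda>(g, \<psi>) (f, \<phi>).
     (compose (topspace (space A)) g f,
      \<lambda>Z\<in>carrier (Ccpt (space C)).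
        compose (carrier (sec (struct C) Z)) (\<phi> (preim (space B) g Z)) (\<psi> Z)))"

definition alg_ISch :: "(('p, 'r) isch, ('p, 'r) isch_mor) category" where
  "alg_ISch = \<lparr>Obj = {A. is_isch A}, Hom = isch_hom, Ident = isch_id, Comp = isch_comp\<rparr>"

definition underlying ::
  "(('p, 'r) isch, ('p, 'r) isch_mor, 'p topology, 'p \<Rightarrow> 'p) cat_functor" where
  "underlying = \<lparr>onObj = space, onHom = \<lambda>A B \<phi>. fst \<phi>\<rparr>"


section \<open>The functor from spaces to schemes\<close>

text \<open>
  All objects of \<open>alg_ISch\<close> have sections in one type \<open>'r\<close>, whereas sections of \<open>\<tau>'\<^sub>X\<close> have type
  \<open>'p set set\<close>.  Hence \<open>\<tau>'\<^sub>X\<close> is copied into \<open>'r\<close> along an injection \<open>e\<close>.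
\<close>

definition copy_ring :: "('a \<Rightarrow> 'b) \<Rightarrow> 'a ring \<Rightarrow> 'b ring" where
  "copy_ring e R =
     \<lparr>carrier = e ` carrier R,
      mult = \<lambda>x y. e (inv_into UNIV e x \<otimes>\<^bsub>R\<^esub> inv_into UNIV e y), one = e \<one>\<^bsub>R\<^esub>,
      zero = e \<zero>\<^bsub>R\<^esub>, add = \<lambda>x y. e (inv_into UNIV e x \<oplus>\<^bsub>R\<^esub> inv_into UNIV e y)\<rparr>"

definition copy_map :: "('a \<Rightarrow> 'b) \<Rightarrow> 'a ring \<Rightarrow> ('a \<Rightarrow> 'a) \<Rightarrow> 'b \<Rightarrow> 'b" where
  "copy_map e R h = (\<lambda>x\<in>e ` carrier R. e (h (inv_into UNIV e x)))"

definition tau_copy :: "('p set set \<Rightarrow> 'r) \<Rightarrow> 'p topology \<Rightarrow> ('p, 'r) presheaf" where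
  "tau_copy e X =
     \<lparr>sec = \<lambda>Z. copy_ring e (sec (tau X) Z),
      res = \<lambda>Z W. copy_map e (sec (tau X) Z) (res (tau X) Z W)\<rparr>"

text \<open>
  The identity of \<open>\<tau>'\<^sub>X\<close>, read as a morphism \<open>\<alpha>\<^sub>1\<tau>'\<^sub>X \<rightarrow> \<tau>'\<^sub>X\<close>: it extends the identification of
  \<open>\<alpha>\<^sub>1(\<tau>'\<^sub>X(Z))\<close> (whose elements are singletons, as \<open>\<tau>'\<^sub>X(Z)\<close> is already idempotent) with \<open>\<tau>'\<^sub>X(Z)\<close>.
\<close>

definition tau_ident ::
  "('p set set \<Rightarrow> 'r) \<Rightarrow> 'p topology \<Rightarrow> 'p set \<Rightarrow> ('p set \<times> 'r set) set \<Rightarrow> 'p set set" where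
  "tau_ident e X =
     sheafify_ext X (alpha1_presheaf (tau_copy e X)) (tau X) (\<lambda>Z A. inv_into UNIV e (the_elem A))"

definition Cpp_obj :: "('p set set \<Rightarrow> 'r) \<Rightarrow> 'p topology \<Rightarrow> ('p, 'r) isch" where
  "Cpp_obj e X = \<lparr>space = X, struct = tau_copy e X, beta = tau_ident e X\<rparr>"

definition Cpp_hom ::
  "('p set set \<Rightarrow> 'r) \<Rightarrow> 'p topology \<Rightarrow> 'p topology \<Rightarrow> ('p \<Rightarrow> 'p) \<Rightarrow> ('p, 'r) isch_mor" where
  "Cpp_hom e X Y f =
     (f, \<lambda>Z\<in>carrier (Ccpt Y). \<lambda>x\<in>carrier (sec (tau_copy e Y) Z). e (tau_map X Y f Z (inv_into UNIV e x)))"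

definition Cpp ::
  "('p set set \<Rightarrow> 'r) \<Rightarrow> ('p topology, 'p \<Rightarrow> 'p, ('p, 'r) isch, ('p, 'r) isch_mor) cat_functor" where
  "Cpp e = \<lparr>onObj = Cpp_obj e, onHom = Cpp_hom e\<rparr>"

text \<open>
  On which side the adjunction lies: a morphism from \<open>Cpp e\<close> of \<open>Y\<close> to \<open>(X, O\<^sub>X, \<beta>\<^sub>X)\<close> over
  \<open>f : Y \<rightarrow> X\<close> must have \<open>f\<^sup># = C(f) \<circ> \<beta>\<^sub>X \<circ> \<alpha>\<^sub>2\<close>, so it exists and is unique, which makes \<open>Cpp e\<close> the
  left adjoint of \<open>underlying\<close>.  In the other direction there need not be any morphism over a given
  continuous map: if \<open>X\<close> is the Sierpinski space and \<open>O\<^sub>X\<close> the subsheaf of \<open>\<tau>'\<^sub>X\<close> of sections in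
  \<open>{0, 1}\<close>, with \<open>\<beta>\<^sub>X\<close> the inclusion, then no morphism from \<open>(X, O\<^sub>X, \<beta>\<^sub>X)\<close> to \<open>Cpp e\<close> of \<open>X\<close> lies
  over the identity.
\<close>

end

theory Submission
  imports Defs
begin

text \<open>
  Localizing the distributive lattice \<open>C(X)\<^sub>c\<^sub>p\<^sub>t\<close> at \<open>Z\<close> identifies \<open>A\<close> and \<open>B\<close> iff \<open>A \<union> Z = B \<union> Z\<close>, so
  sections of \<open>\<tau>'\<^sub>X\<close> over \<open>Z\<close> are the members of \<open>C(X)\<^sub>c\<^sub>p\<^sub>t\<close> containing \<open>Z\<close>, and they glue by intersection.
  As the structure morphism \<open>\<beta>\<close> of \<open>C\<^sup>+\<^sup>+ X\<close> is the identity, evaluating the compatibility condition at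
  the sections \<open>\<alpha>\<^sub>2 a\<close> shows that a morphism from \<open>C\<^sup>+\<^sup>+ X\<close> to a scheme \<open>A\<close> over a continuous map \<open>f\<close> must
  have \<open>f\<^sup># = C(f) \<circ> \<beta>\<^sub>A \<circ> \<alpha>\<^sub>2\<close>. Conversely this formula always defines a morphism, because every section
  of \<open>\<alpha>\<^sub>1 O\<^sub>A\<close> is locally of the form \<open>\<alpha>\<^sub>2 a\<close> and \<open>\<tau>'\<close> is separated. Hence forgetting \<open>f\<^sup>#\<close> is a bijection on
  morphisms out of \<open>C\<^sup>+\<^sup>+ X\<close>, which gives the adjunction as well as the functoriality of \<open>C\<^sup>+\<^sup>+\<close>.
\<close>

section \<open>Semirings and their quotients\<close>

text \<open>The hom-set bijection obtained here has \<open>Cpp e\<close> in the source of the scheme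
  morphisms, so \<open>Cpp e\<close> is proved to be the left adjoint of \<open>underlying\<close>;
  the informal headline says "right adjoint". The main labour is the sheafification inside
  \<open>alpha1_sheaf\<close>. Its sections are saturated families, possibly infinite and without an
  explicit list of members, and \<open>agree\<close> need not be transitive, because every pair is
  compared on its own overlap. Two devices deal with this. Comparison on a prescribed region
  (\<open>eq_on\<close>) restores transitivity. Moreover a saturated family is determined by any
  matching subfamily over the same base (\<open>saturate_subset\<close>), so induced maps and
  extensions can be computed on explicit generators (\<open>sheafify_map_eq\<close>,
  \<open>ext_eqI\<close>). On the side of \<open>tau\<close>, a class is handled through its largest
  member, the union of all its members; this turns equations between classes into equations between
  closed sets.\<close>

lemma semiring_homI:
  assumes "h \<in> extensional (carrier R)"
    and "\<And>x. x \<in> carrier R \<Longrightarrow> h x \<in> carrier S"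
    and "\<And>x y. x \<in> carrier R \<Longrightarrow> y \<in> carrier R \<Longrightarrow> h (x \<otimes>\<^bsub>R\<^esub> y) = h x \<otimes>\<^bsub>S\<^esub> h y"
    and "\<And>x y. x \<in> carrier R \<Longrightarrow> y \<in> carrier R \<Longrightarrow> h (x \<oplus>\<^bsub>R\<^esub> y) = h x \<oplus>\<^bsub>S\<^esub> h y"
    and "h \<one>\<^bsub>R\<^esub> = \<one>\<^bsub>S\<^esub>" and "h \<zero>\<^bsub>R\<^esub> = \<zero>\<^bsub>S\<^esub>"
  shows "h \<in> semiring_hom R S"
  using assms by (auto simp: semiring_hom_def ring_hom_def)

lemma semiring_homD:
  assumes "h \<in> semiring_hom R S"
  shows "h \<in> extensional (carrier R)"
    and "x \<in> carrier R \<Longrightarrow> h x \<in> carrier S"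
    and "x \<in> carrier R \<Longrightarrow> y \<in> carrier R \<Longrightarrow> h (x \<otimes>\<^bsub>R\<^esub> y) = h x \<otimes>\<^bsub>S\<^esub> h y"
    and "x \<in> carrier R \<Longrightarrow> y \<in> carrier R \<Longrightarrow> h (x \<oplus>\<^bsub>R\<^esub> y) = h x \<oplus>\<^bsub>S\<^esub> h y"
    and "h \<one>\<^bsub>R\<^esub> = \<one>\<^bsub>S\<^esub>" and "h \<zero>\<^bsub>R\<^esub> = \<zero>\<^bsub>S\<^esub>"
  using assms by (auto simp: semiring_hom_def ring_hom_def)

lemma pirng_closed:
  assumes "pirng R"
  shows "\<one>\<^bsub>R\<^esub> \<in> carrier R" and "\<zero>\<^bsub>R\<^esub> \<in> carrier R"
    and "x \<in> carrier R \<Longrightarrow> y \<in> carrier R \<Longrightarrow> x \<otimes>\<^bsub>R\<^esub> y \<in> carrier R"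
    and "x \<in> carrier R \<Longrightarrow> y \<in> carrier R \<Longrightarrow> x \<oplus>\<^bsub>R\<^esub> y \<in> carrier R"
proof -
  interpret Ring.semiring R using assms by (simp add: pirng_def)
  show "\<one>\<^bsub>R\<^esub> \<in> carrier R" "\<zero>\<^bsub>R\<^esub> \<in> carrier R" by auto
  show "x \<in> carrier R \<Longrightarrow> y \<in> carrier R \<Longrightarrow> x \<otimes>\<^bsub>R\<^esub> y \<in> carrier R"
    "x \<in> carrier R \<Longrightarrow> y \<in> carrier R \<Longrightarrow> x \<oplus>\<^bsub>R\<^esub> y \<in> carrier R" by auto
qed

lemma compose_semiring_hom:
  assumes "pirng R" and h: "h \<in> semiring_hom R S" and k: "k \<in> semiring_hom S T"
  shows "compose (carrier R) k h \<in> semiring_hom R T"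
  using pirng_closed[OF assms(1)] semiring_homD[OF h] semiring_homD[OF k]
  by (intro semiring_homI) (auto simp: compose_def)

lemma alpha1_carrier: "A \<in> carrier (alpha1 R) \<longleftrightarrow> (\<exists>a\<in>carrier R. A = alpha2 R a)"
  by (auto simp: alpha1_def alpha2_def quot_carrier quot_map_def)

text \<open>The pullback of \<open>idem_cong S\<close> along \<open>h\<close> is a congruence on
  \<open>R\<close>, and it contains the generators of \<open>idem_cong R\<close> because
  \<open>h\<close> sends squares to squares. Minimality does the rest.\<close>

lemma idem_cong_hom:
  assumes R: "pirng R" and S: "pirng S" and h: "h \<in> semiring_hom R S"
    and "(a, b) \<in> idem_cong R"
  shows "(h a, h b) \<in> idem_cong S"
proof -
  note hD = semiring_homD[OF h]
  note E = congruence_idem[OF S]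
  have eqv: "equiv (carrier S) (idem_cong S)" using E by (simp add: congruence_def)
  interpret R: Ring.semiring R using R by (simp add: pirng_def)
  let ?E = "{(a, b). a \<in> carrier R \<and> b \<in> carrier R \<and> (h a, h b) \<in> idem_cong S}"
  have "equiv (carrier R) ?E"
  proof (rule equivI)
    show "refl_on (carrier R) ?E"
      using hD(2) eqv by (auto simp: refl_on_def equiv_def)
    show "sym ?E" using eqv by (auto simp: equiv_def intro!: symI dest: symD)
    show "trans ?E" using eqv by (auto simp: equiv_def intro!: transI dest: transD)
  qed auto
  then have "congruence R ?E"
    using E hD by (auto simp: congruence_def)
  moreover have "{(a \<otimes>\<^bsub>R\<^esub> a, a) | a. a \<in> carrier R} \<subseteq> ?E"
    using hD gen_congruence_incl[of "{(a \<otimes>\<^bsub>S\<^esub> a, a) | a. a \<in> carrier S}" S]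
    by (auto simp: idem_cong_def)
  ultimately have "idem_cong R \<subseteq> ?E"
    unfolding idem_cong_def[of R] by (rule gen_congruence_least)
  then show ?thesis using assms(4) by auto
qed

lemma congruence_class_subset:
  assumes "congruence R E" "a \<in> carrier R"
  shows "a \<in> E `` {a}" "E `` {a} \<subseteq> carrier R"
  using assms by (auto simp: congruence_def equiv_def refl_on_def)

text \<open>\<open>alpha1_map\<close> saturates the image of a class; since \<open>h\<close>
  respects the congruences, that saturation is a single class. As \<open>alpha2 R\<close> is onto,
  this equation determines \<open>alpha1_map\<close>, and later computations in
  \<open>alpha1\<close> go through it.\<close>

lemma alpha1_map_alpha2:
  assumes R: "pirng R" and S: "pirng S" and h: "h \<in> semiring_hom R S" and a: "a \<in> carrier R"
  shows "alpha1_map R S h (alpha2 R a) = alpha2 S (h a)"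
proof -
  note E = congruence_idem[OF S]
  have ha: "h a \<in> carrier S" by (rule semiring_homD(2)[OF h a])
  have "idem_cong S `` (h ` (idem_cong R `` {a})) = idem_cong S `` {h a}" (is "?L = ?M")
  proof
    show "?L \<subseteq> ?M"
      using idem_cong_hom[OF R S h] E by (auto simp: congruence_def equiv_def dest: transD)
    show "?M \<subseteq> ?L"
      using congruence_class_subset(1)[OF congruence_idem[OF R] a] by auto
  qed
  moreover have "alpha2 R a \<in> carrier (alpha1 R)" using a by (auto simp: alpha1_carrier)
  ultimately show ?thesis
    using a ha by (simp add: alpha1_map_def) (simp add: alpha2_def quot_map_def)
qed

lemma pirng_alpha1: "pirng R \<Longrightarrow> pirng (alpha1 R)"
  using piirng_alpha1[of R] by (simp add: piirng_def)

lemma alpha1_map_hom: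
  assumes R: "pirng R" and S: "pirng S" and h: "h \<in> semiring_hom R S"
  shows "alpha1_map R S h \<in> semiring_hom (alpha1 R) (alpha1 S)"
proof -
  note hD = semiring_homD[OF h]
  \<comment> \<open>Reversed, the homomorphism laws of \<open>alpha2\<close> rewrite an operation on
    classes as the class of a result, where \<open>alpha1_map_alpha2\<close> applies.\<close>
  note aR = semiring_homD(3-6)[OF alpha2_hom[OF R], symmetric]
  note aS = semiring_homD(3-6)[OF alpha2_hom[OF S], symmetric]
  note m = alpha1_map_alpha2[OF R S h]
  note cl = pirng_closed[OF R]
  show ?thesis
  proof (rule semiring_homI)
    show "alpha1_map R S h \<in> extensional (carrier (alpha1 R))" by (simp add: alpha1_map_def)
    show "alpha1_map R S h \<one>\<^bsub>alpha1 R\<^esub> = \<one>\<^bsub>alpha1 S\<^esub>"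
      by (simp only: aR(3) aS(3) m cl hD)
    show "alpha1_map R S h \<zero>\<^bsub>alpha1 R\<^esub> = \<zero>\<^bsub>alpha1 S\<^esub>"
      by (simp only: aR(4) aS(4) m cl hD)
  next
    fix x assume "x \<in> carrier (alpha1 R)"
    then show "alpha1_map R S h x \<in> carrier (alpha1 S)"
      using hD(2) by (auto simp: alpha1_carrier m)
  next
    fix x y assume "x \<in> carrier (alpha1 R)" "y \<in> carrier (alpha1 R)"
    then obtain a b where ab: "a \<in> carrier R" "b \<in> carrier R" "x = alpha2 R a" "y = alpha2 R b"
      by (auto simp: alpha1_carrier)
    show "alpha1_map R S h (x \<otimes>\<^bsub>alpha1 R\<^esub> y) = alpha1_map R S h x \<otimes>\<^bsub>alpha1 S\<^esub> alpha1_map R S h y"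
      using ab hD cl by (simp add: aR(1) aS(1) m)
    show "alpha1_map R S h (x \<oplus>\<^bsub>alpha1 R\<^esub> y) = alpha1_map R S h x \<oplus>\<^bsub>alpha1 S\<^esub> alpha1_map R S h y"
      using ab hD cl by (simp add: aR(2) aS(2) m)
  qed
qed

text \<open>In an idempotent semiring the diagonal already is a congruence containing the pairs
  \<open>(a a, a)\<close>, so nothing gets identified. This is what makes \<open>the_elem\<close>
  meaningful in \<open>tau_ident\<close>.\<close>

lemma piirng_alpha2:
  assumes "piirng R" and a: "a \<in> carrier R"
  shows "alpha2 R a = {a}"
proof -
  interpret Ring.semiring R using assms by (simp add: piirng_def pirng_def)
  have "congruence R (Id_on (carrier R))"
    by (auto simp: congruence_def intro!: equivI refl_onI symI transI)
  then have "idem_cong R \<subseteq> Id_on (carrier R)"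
    unfolding idem_cong_def using assms by (intro gen_congruence_least) (auto simp: piirng_def)
  moreover have "(a, a) \<in> idem_cong R"
    using congruence_class_subset(1)[OF congruence_idem a] assms by (auto simp: piirng_def)
  ultimately show ?thesis using a by (auto simp: alpha2_def quot_map_def)
qed

text \<open>The generating pair \<open>(1, a)\<close> lies in the kernel congruence of
  \<open>h\<close>, hence so does all of \<open>loc_cong R a\<close>, and the universal property of
  the quotient applies. The localization axiom for \<open>Cpp_obj\<close> is verified in this
  way.\<close>

lemma loc_factor:
  assumes R: "pirng R" and S: "pirng S" and h: "h \<in> semiring_hom R S"
    and a: "a \<in> carrier R" "h a = \<one>\<^bsub>S\<^esub>"
  shows "factors_through_loc R S a h"
proof -
  interpret Ring.semiring R using R by (simp add: pirng_def)
  have ker: "loc_cong R a \<subseteq> {(x, y). x \<in> carrier R \<and> y \<in> carrier R \<and> h x = h y}"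
    unfolding loc_cong_def using a semiring_homD(5)[OF h]
    by (intro gen_congruence_least congruence_ker[OF R S h]) auto
  have "congruence R (loc_cong R a)"
    unfolding loc_cong_def by (rule congruence_gen) (use a R in \<open>auto simp: pirng_def\<close>)
  from quot_universal[OF R S h this] ker
  obtain k where "k \<in> semiring_hom (quot_semiring R (loc_cong R a)) S"
    "\<forall>s\<in>carrier R. k (quot_map R (loc_cong R a) s) = h s"
    by blast
  then show ?thesis
    unfolding factors_through_loc_def localization_def loc_map_def by (metis (no_types, lifting))
qed

lemma copy_ring_hom:
  assumes "inj e" "pirng R"
  shows "restrict e (carrier R) \<in> semiring_hom R (copy_ring e R)"
    and "restrict (inv_into UNIV e) (e ` carrier R) \<in> semiring_hom (copy_ring e R) R"
  using assms pirng_closed[OF assms(2)]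
  by (auto intro!: semiring_homI simp: copy_ring_def)

lemma copy_map_hom:
  assumes "inj e" and h: "h \<in> semiring_hom R S" and R: "pirng R"
  shows "copy_map e R h \<in> semiring_hom (copy_ring e R) (copy_ring e S)"
  using assms(1) pirng_closed[OF R] semiring_homD[OF h]
  by (intro semiring_homI) (auto simp: copy_ring_def copy_map_def)

lemma piirng_copy:
  assumes e: "inj e" and R: "piirng R"
  shows "piirng (copy_ring e R)"
proof -
  interpret Ring.semiring R using R by (simp add: piirng_def pirng_def)
  interpret comm_monoid R using R by (simp add: piirng_def pirng_def)
  note [simp] = inv_f_f[OF e]
  have mon: "Group.monoid (copy_ring e R)"
    by (rule monoidI) (auto simp: copy_ring_def m_assoc)
  have "abelian_monoid (copy_ring e R)"
    by (rule abelian_monoidI) (auto simp: copy_ring_def a_ac)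
  then have "Ring.semiring (copy_ring e R)"
    by (intro semiring.intro mon semiring_axioms.intro) (auto simp: copy_ring_def l_distr r_distr)
  moreover have "comm_monoid (copy_ring e R)"
    by (intro comm_monoid.intro mon comm_monoid_axioms.intro) (auto simp: copy_ring_def m_comm)
  ultimately show ?thesis
    using R by (auto simp: piirng_def pirng_def) (auto simp: copy_ring_def)
qed

section \<open>Closed sets with quasi-compact complement\<close>

lemma Ccpt_simps [simp]:
  "ile (Ccpt X) W Z \<longleftrightarrow> Z \<subseteq> W"
  "V \<otimes>\<^bsub>Ccpt X\<^esub> W = V \<union> W" "V \<oplus>\<^bsub>Ccpt X\<^esub> W = V \<inter> W" "\<one>\<^bsub>Ccpt X\<^esub> = {}" "\<zero>\<^bsub>Ccpt X\<^esub> = topspace X"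
  by (auto simp: Ccpt_def ile_def)

lemma Ccpt_qcopen: "Z \<in> carrier (Ccpt X) \<longleftrightarrow> Z \<subseteq> topspace X \<and> qcopen X (topspace X - Z)"
  by (auto simp: Ccpt_def qcopen_def closedin_def)

lemma Ccpt_topspace: "Z \<in> carrier (Ccpt X) \<Longrightarrow> Z \<subseteq> topspace X"
  by (simp add: Ccpt_qcopen)

lemma presheafD:
  assumes "is_presheaf X F" and Z: "Z \<in> carrier (Ccpt X)"
  shows "pirng (sec F Z)"
    and "W \<in> carrier (Ccpt X) \<Longrightarrow> Z \<subseteq> W \<Longrightarrow> res F Z W \<in> semiring_hom (sec F Z) (sec F W)"
    and "s \<in> carrier (sec F Z) \<Longrightarrow> res F Z Z s = s"
    and "W \<in> carrier (Ccpt X) \<Longrightarrow> V \<in> carrier (Ccpt X) \<Longrightarrow> Z \<subseteq> W \<Longrightarrow> W \<subseteq> V \<Longrightarrow>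
      s \<in> carrier (sec F Z) \<Longrightarrow> res F W V (res F Z W s) = res F Z V s"
  using assms by (simp_all add: is_presheaf_def)

locale alg_space =
  fixes X :: "'p topology"
  assumes alg: "algebraic_sober X"
begin

abbreviation C where "C \<equiv> carrier (Ccpt X)"

text \<open>On complements this is the axiom that two quasi-compact open sets of an algebraic space
  have quasi-compact intersection.\<close>

lemma C_Un [intro, simp]: "V \<in> C \<Longrightarrow> W \<in> C \<Longrightarrow> V \<union> W \<in> C"
  using alg by (auto simp: Ccpt_qcopen algebraic_sober_def Diff_Un)

lemma C_Int [intro, simp]: "V \<in> C \<Longrightarrow> W \<in> C \<Longrightarrow> V \<inter> W \<in> C"
  by (auto simp: Ccpt_def Diff_Int intro: compactin_Un)

lemma C_Inter: "finite D \<Longrightarrow> D \<noteq> {} \<Longrightarrow> D \<subseteq> C \<Longrightarrow> \<Inter>D \<in> C"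
  by (induction D rule: finite_ne_induct) auto

lemma C_empty [simp]: "{} \<in> C"
  using alg by (auto simp: Ccpt_def algebraic_sober_def compact_space_def)

lemma C_top [simp]: "topspace X \<in> C"
  by (auto simp: Ccpt_def)

lemma piirng_Ccpt: "piirng (Ccpt X)"
proof -
  have "Group.monoid (Ccpt X)" by (rule monoidI) auto
  moreover have "abelian_monoid (Ccpt X)"
    by (rule abelian_monoidI) (auto dest: Ccpt_topspace)
  moreover have "comm_monoid (Ccpt X)" by (rule comm_monoidI) auto
  ultimately have "Ring.semiring (Ccpt X)"
    by (intro semiring.intro semiring_axioms.intro) (auto dest: Ccpt_topspace)
  then show ?thesis
    using \<open>comm_monoid (Ccpt X)\<close> by (auto simp: piirng_def pirng_def)
qed

lemma pirng_Ccpt: "pirng (Ccpt X)"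
  using piirng_Ccpt by (simp add: piirng_def)

lemma congruence_Un: "Z \<in> C \<Longrightarrow> congruence (Ccpt X) {(A, B). A \<in> C \<and> B \<in> C \<and> A \<union> Z = B \<union> Z}"
  unfolding congruence_def by (intro conjI equivI refl_onI symI transI) (auto 0 0, blast+)

text \<open>Modulo the congruence, \<open>A = A \<cdot> 1 \<sim> A \<cdot> Z = B \<cdot> Z \<sim> B\<close>.\<close>

lemma loc_cong_Ccpt:
  assumes Z: "Z \<in> C"
  shows "loc_cong (Ccpt X) Z = {(A, B). A \<in> C \<and> B \<in> C \<and> A \<union> Z = B \<union> Z}" (is "?L = ?E")
proof
  show "?L \<subseteq> ?E"
    unfolding loc_cong_def using Z by (intro gen_congruence_least congruence_Un) auto
  have cong: "congruence (Ccpt X) ?L"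
    unfolding loc_cong_def
    using pirng_Ccpt Z by (intro congruence_gen) (auto simp: pirng_def)
  have "({}, Z) \<in> ?L"
    unfolding loc_cong_def by (rule subsetD[OF gen_congruence_incl]) simp
  then have *: "(A, A \<union> Z) \<in> ?L" if "A \<in> C" for A
    using cong that congruence_class_subset(1)[OF cong that]
    by (force simp: congruence_def)
  show "?E \<subseteq> ?L"
  proof clarify
    fix A B assume AB: "A \<in> C" "B \<in> C" "A \<union> Z = B \<union> Z"
    then show "(A, B) \<in> ?L"
      using *[OF AB(1)] *[OF AB(2)] cong
      unfolding congruence_def equiv_def by (metis symD transD)
  qed
qed

lemma congruence_loc: "Z \<in> C \<Longrightarrow> congruence (Ccpt X) (loc_cong (Ccpt X) Z)"
  using congruence_Un loc_cong_Ccpt by simp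

section \<open>Sections of \<open>tau\<close> as classes of closed sets, separation and
  gluing\<close>

abbreviation cl where "cl \<equiv> loc_map (Ccpt X)"

lemma cl_def: "Z \<in> C \<Longrightarrow> A \<in> C \<Longrightarrow> cl Z A = {B \<in> C. A \<union> Z = B \<union> Z}"
  by (auto simp: loc_map_def quot_map_def loc_cong_Ccpt)

text \<open>\<open>A \<union> Z\<close> is itself a member of the class and contains all the others.
  The union of a class thus serves as a normal form, which is what makes \<open>tau_eqI\<close> and
  the sheaf property elementary.\<close>

lemma Union_cl:
  assumes "Z \<in> C" "A \<in> C"
  shows "\<Union>(cl Z A) = A \<union> Z"
proof
  show "\<Union>(cl Z A) \<subseteq> A \<union> Z" unfolding cl_def[OF assms] by blast
  have "A \<union> Z \<in> cl Z A" using assms by (simp add: cl_def Un_assoc)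
  then show "A \<union> Z \<subseteq> \<Union>(cl Z A)" by (rule Union_upper)
qed

lemma cl_eq: "Z \<in> C \<Longrightarrow> A \<in> C \<Longrightarrow> B \<in> C \<Longrightarrow> cl Z A = cl Z B \<longleftrightarrow> A \<union> Z = B \<union> Z"
  by (rule iffI, drule arg_cong[of _ _ Union]) (simp_all add: Union_cl, simp add: cl_def)

lemma tau_carrier: "x \<in> carrier (sec (tau X) Z) \<longleftrightarrow> (\<exists>A\<in>C. x = cl Z A)"
  by (auto simp: tau_def localization_def loc_map_def quot_carrier quot_map_def)

lemma cl_closed [simp]: "A \<in> C \<Longrightarrow> cl Z A \<in> carrier (sec (tau X) Z)"
  by (auto simp: tau_carrier)

lemma tau_ops:
  assumes "Z \<in> C" "A \<in> C" "B \<in> C"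
  shows "cl Z A \<oplus>\<^bsub>sec (tau X) Z\<^esub> cl Z B = cl Z (A \<inter> B)"
    and "cl Z A \<otimes>\<^bsub>sec (tau X) Z\<^esub> cl Z B = cl Z (A \<union> B)"
  using quot_ops[OF congruence_loc[OF assms(1)], of A B] assms
  by (simp_all add: tau_def localization_def loc_map_def quot_map_def)

lemma tau_consts:
  "\<zero>\<^bsub>sec (tau X) Z\<^esub> = cl Z (topspace X)" "\<one>\<^bsub>sec (tau X) Z\<^esub> = cl Z {}"
  by (simp_all add: tau_def localization_def loc_map_def quot_map_def quot_semiring_def)

lemma tau_res:
  assumes "Z \<in> C" "W \<in> C" "Z \<subseteq> W" "A \<in> C"
  shows "res (tau X) Z W (cl Z A) = cl W A"
proof -
  have "loc_cong (Ccpt X) W `` cl Z A = cl W A"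
    using assms by (auto simp: cl_def loc_cong_Ccpt)
  then show ?thesis
    using cl_closed[OF assms(4), of Z] by (simp add: tau_def)
qed

lemma piirng_tau:
  assumes Z: "Z \<in> C" shows "piirng (sec (tau X) Z)"
proof -
  have "pirng (sec (tau X) Z)"
    using pirng_quot[OF pirng_Ccpt congruence_loc[OF Z]] by (simp add: tau_def localization_def)
  then show ?thesis
    using Z by (auto simp: piirng_def tau_carrier tau_ops)
qed

lemma pirng_tau: "Z \<in> C \<Longrightarrow> pirng (sec (tau X) Z)"
  using piirng_tau by (simp add: piirng_def)

lemma tau_res_hom:
  assumes "Z \<in> C" "W \<in> C" "Z \<subseteq> W"
  shows "res (tau X) Z W \<in> semiring_hom (sec (tau X) Z) (sec (tau X) W)"
proof (rule semiring_homI)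
  show "res (tau X) Z W \<in> extensional (carrier (sec (tau X) Z))" by (simp add: tau_def)
qed (use assms in \<open>auto simp: tau_carrier tau_ops tau_consts tau_res\<close>)

lemma is_presheaf_tau: "is_presheaf X (tau X)"
  unfolding is_presheaf_def
  by (auto simp: pirng_tau tau_res_hom tau_carrier tau_res)

lemma tau_eqI:
  assumes "Z \<in> C" "x \<in> carrier (sec (tau X) Z)" "y \<in> carrier (sec (tau X) Z)" "\<Union>x = \<Union>y"
  shows "x = y"
  using assms(2-4) unfolding tau_carrier by (elim bexE) (simp add: assms(1) Union_cl cl_eq)

lemma tau_Union_C: "Z \<in> C \<Longrightarrow> x \<in> carrier (sec (tau X) Z) \<Longrightarrow> \<Union>x \<in> C"
  by (auto simp: tau_carrier Union_cl)

lemma tau_Union_sup: "Z \<in> C \<Longrightarrow> x \<in> carrier (sec (tau X) Z) \<Longrightarrow> Z \<subseteq> \<Union>x"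
  by (auto simp: tau_carrier Union_cl)

lemma cl_Union: "Z \<in> C \<Longrightarrow> x \<in> carrier (sec (tau X) Z) \<Longrightarrow> cl Z (\<Union>x) = x"
  unfolding tau_carrier by (elim bexE) (simp add: Union_cl cl_eq)

lemma Union_tau_res:
  "Z \<in> C \<Longrightarrow> W \<in> C \<Longrightarrow> Z \<subseteq> W \<Longrightarrow> x \<in> carrier (sec (tau X) Z) \<Longrightarrow> \<Union>(res (tau X) Z W x) = \<Union>x \<union> W"
  unfolding tau_carrier by (elim bexE) (simp add: tau_res Union_cl Un_assoc Un_absorb1)

text \<open>On normal forms restriction to \<open>W\<close> is union with \<open>W\<close>.
  Intersecting the equations \<open>\<Union>x \<union> W = \<Union>y \<union> W\<close> over the
  cover replaces \<open>W\<close> by \<open>\<Inter>D = Z\<close>, which both sides already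
  contain.\<close>

lemma tau_separated:
  assumes D: "covers X Z D" and xy: "x \<in> carrier (sec (tau X) Z)" "y \<in> carrier (sec (tau X) Z)"
    and eq: "\<And>W. W \<in> D \<Longrightarrow> res (tau X) Z W x = res (tau X) Z W y"
  shows "x = y"
proof -
  have Z: "Z \<in> C" using D C_Inter[of D] by (auto simp: covers_def)
  have *: "\<Union>x \<union> W = \<Union>y \<union> W" if "W \<in> D" for W
  proof -
    have "W \<in> C" "Z \<subseteq> W" using that D by (auto simp: covers_def)
    then show ?thesis
      using Union_tau_res[OF Z, of W x] Union_tau_res[OF Z, of W y] xy eq[OF that] by simp
  qed
  have "\<Union>x \<union> Z = \<Union>y \<union> Z"
    using * D unfolding covers_def by blast
  then have "\<Union>x = \<Union>y"
    using tau_Union_sup[OF Z xy(1)] tau_Union_sup[OF Z xy(2)] by blast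
  then show ?thesis by (rule tau_eqI[OF Z xy])
qed

lemma tau_glue:
  assumes P: "finite P" "covers X Z (fst ` P)"
    and sec: "\<And>W x. (W, x) \<in> P \<Longrightarrow> x \<in> carrier (sec (tau X) W)"
    and match: "\<And>V x W y. (V, x) \<in> P \<Longrightarrow> (W, y) \<in> P \<Longrightarrow>
      res (tau X) V (V \<union> W) x = res (tau X) W (V \<union> W) y"
  shows "\<exists>t\<in>carrier (sec (tau X) Z). \<forall>(W, x)\<in>P. res (tau X) Z W t = x"
proof -
  have Z: "Z \<in> C" using P C_Inter[of "fst ` P"] by (auto simp: covers_def)
  have PC: "V \<in> C" "Z \<subseteq> V" if "(V, x) \<in> P" for V x
    using that P by (auto simp: covers_def)
  have ne: "P \<noteq> {}" using P by (auto simp: covers_def)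
  \<comment> \<open>The sum of the normal forms in \<open>Ccpt X\<close>; finiteness of
    \<open>P\<close> keeps it inside \<open>C\<close>.\<close>
  define A where "A = \<Inter>((\<lambda>(W, x). \<Union>x) ` P)"
  have A: "A \<in> C"
    unfolding A_def by (rule C_Inter) (use P ne in auto, metis PC(1) sec tau_Union_C)
  have "res (tau X) Z W (cl Z A) = y" if Wy: "(W, y) \<in> P" for W y
  proof -
    have "A \<union> W = \<Union>y"
    proof -
      \<comment> \<open>Matching gives the equation after adding \<open>V \<union> W\<close> to both
        sides; \<open>\<Union>x\<close> already absorbs \<open>V\<close>, and
        \<open>\<Union>y\<close> absorbs \<open>W\<close>.\<close>
      have "\<Union>x \<union> W = \<Union>y \<union> V" if Vx: "(V, x) \<in> P" for V x
      proof -
        have "\<Union>x \<union> (V \<union> W) = \<Union>y \<union> (V \<union> W)"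
          using match[OF Vx Wy] PC[OF Wy] PC[OF Vx] sec[OF Wy] sec[OF Vx]
            Union_tau_res[of V "V \<union> W" x] Union_tau_res[of W "V \<union> W" y] by simp
        then show ?thesis
          using tau_Union_sup[OF PC(1)[OF Vx] sec[OF Vx]] tau_Union_sup[OF PC(1)[OF Wy] sec[OF Wy]]
          by blast
      qed
      then have "\<Union>y \<subseteq> \<Union>x \<union> W" if "(V, x) \<in> P" for V x
        using that by blast
      then have "\<Union>y \<subseteq> A \<union> W" unfolding A_def by blast
      moreover have "A \<subseteq> \<Union>y" unfolding A_def using Wy by blast
      moreover have "W \<subseteq> \<Union>y" by (rule tau_Union_sup[OF PC(1)[OF Wy] sec[OF Wy]])
      ultimately show ?thesis by blast
    qed
    moreover have "W \<subseteq> \<Union>y" by (rule tau_Union_sup[OF PC(1)[OF Wy] sec[OF Wy]])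
    ultimately have "cl W A = cl W (\<Union>y)"
      using cl_eq[OF PC(1)[OF Wy] A tau_Union_C[OF PC(1)[OF Wy] sec[OF Wy]]] by blast
    then show ?thesis
      using tau_res[OF Z _ _ A] PC[OF Wy] cl_Union[OF _ sec[OF Wy]] by simp
  qed
  then show ?thesis using cl_closed[OF A] by blast
qed

text \<open>The two-element cover \<open>{Z1, Z2}\<close> is the relevant case: injectivity is
  \<open>tau_separated\<close>, and surjectivity is \<open>tau_glue\<close>.\<close>

lemma is_sheaf_tau: "is_sheaf X (tau X)"
  unfolding is_sheaf_def
proof (intro conjI ballI is_presheaf_tau)
  fix Z1 Z2 assume Z: "Z1 \<in> C" "Z2 \<in> C"
  have cov: "covers X (Z1 \<inter> Z2) {Z1, Z2}" using Z by (auto simp: covers_def)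
  have comp: "res (tau X) W V (res (tau X) (Z1 \<inter> Z2) W x) = res (tau X) (Z1 \<inter> Z2) V x"
    if "x \<in> carrier (sec (tau X) (Z1 \<inter> Z2))" "W \<in> C" "V \<in> C" "Z1 \<inter> Z2 \<subseteq> W" "W \<subseteq> V" for x V W
    by (rule presheafD(4)[OF is_presheaf_tau]) (use Z that in auto)
  have idr: "res (tau X) W W x = x" if "x \<in> carrier (sec (tau X) W)" "W \<in> C" for x W
    by (rule presheafD(3)[OF is_presheaf_tau that(2,1)])
  let ?r = "\<lambda>s. (res (tau X) (Z1 \<inter> Z2) Z1 s, res (tau X) (Z1 \<inter> Z2) Z2 s)"
  let ?B = "{(s1, s2). s1 \<in> carrier (sec (tau X) Z1) \<and> s2 \<in> carrier (sec (tau X) Z2) \<and>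
    res (tau X) Z1 (Z1 \<union> Z2) s1 = res (tau X) Z2 (Z1 \<union> Z2) s2}"
  have "bij_betw ?r (carrier (sec (tau X) (Z1 \<inter> Z2))) ?B"
  proof (rule bij_betw_imageI)
    show "inj_on ?r (carrier (sec (tau X) (Z1 \<inter> Z2)))"
      using tau_separated[OF cov] by (auto intro!: inj_onI)
    show "?r ` carrier (sec (tau X) (Z1 \<inter> Z2)) = ?B"
    proof
      show "?r ` carrier (sec (tau X) (Z1 \<inter> Z2)) \<subseteq> ?B"
      proof clarify
        fix x assume x: "x \<in> carrier (sec (tau X) (Z1 \<inter> Z2))"
        have "res (tau X) (Z1 \<inter> Z2) W x \<in> carrier (sec (tau X) W)" if "W \<in> C" "Z1 \<inter> Z2 \<subseteq> W" for W
          using x Z that by (intro semiring_homD(2)[OF tau_res_hom]) auto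
        then show "res (tau X) (Z1 \<inter> Z2) Z1 x \<in> carrier (sec (tau X) Z1) \<and>
          res (tau X) (Z1 \<inter> Z2) Z2 x \<in> carrier (sec (tau X) Z2) \<and>
          res (tau X) Z1 (Z1 \<union> Z2) (res (tau X) (Z1 \<inter> Z2) Z1 x) =
          res (tau X) Z2 (Z1 \<union> Z2) (res (tau X) (Z1 \<inter> Z2) Z2 x)"
          using Z by (simp add: comp[OF x])
      qed
      show "?B \<subseteq> ?r ` carrier (sec (tau X) (Z1 \<inter> Z2))"
      proof clarify
        fix x y assume xy: "x \<in> carrier (sec (tau X) Z1)" "y \<in> carrier (sec (tau X) Z2)"
          "res (tau X) Z1 (Z1 \<union> Z2) x = res (tau X) Z2 (Z1 \<union> Z2) y"
        have "\<exists>t\<in>carrier (sec (tau X) (Z1 \<inter> Z2)). \<forall>(W, x)\<in>{(Z1, x), (Z2, y)}. res (tau X) (Z1 \<inter> Z2) W t = x"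
          using cov xy Z by (intro tau_glue) (auto simp: Un_commute idr)
        then show "(x, y) \<in> ?r ` carrier (sec (tau X) (Z1 \<inter> Z2))" by force
      qed
    qed
  qed
  then show "bij_betw (\<lambda>s. (res (tau X) (Z1 \<oplus>\<^bsub>Ccpt X\<^esub> Z2) Z1 s, res (tau X) (Z1 \<oplus>\<^bsub>Ccpt X\<^esub> Z2) Z2 s))
    (carrier (sec (tau X) (Z1 \<oplus>\<^bsub>Ccpt X\<^esub> Z2)))
    {(s1, s2). s1 \<in> carrier (sec (tau X) Z1) \<and> s2 \<in> carrier (sec (tau X) Z2) \<and>
      res (tau X) Z1 (Z1 \<otimes>\<^bsub>Ccpt X\<^esub> Z2) s1 = res (tau X) Z2 (Z1 \<otimes>\<^bsub>Ccpt X\<^esub> Z2) s2}"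
    by simp
qed

end

section \<open>Direct images\<close>

lemma presheaf_morD:
  assumes "\<phi> \<in> presheaf_mor X F G"
  shows "\<phi> \<in> extensional (carrier (Ccpt X))"
    and "Z \<in> carrier (Ccpt X) \<Longrightarrow> \<phi> Z \<in> semiring_hom (sec F Z) (sec G Z)"
    and "Z \<in> carrier (Ccpt X) \<Longrightarrow> W \<in> carrier (Ccpt X) \<Longrightarrow> Z \<subseteq> W \<Longrightarrow> s \<in> carrier (sec F Z) \<Longrightarrow>
      \<phi> W (res F Z W s) = res G Z W (\<phi> Z s)"
  using assms by (simp_all add: presheaf_mor_def)

lemma presheaf_morI:
  assumes "\<phi> \<in> extensional (carrier (Ccpt X))"
    and "\<And>Z. Z \<in> carrier (Ccpt X) \<Longrightarrow> \<phi> Z \<in> semiring_hom (sec F Z) (sec G Z)"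
    and "\<And>Z W s. Z \<in> carrier (Ccpt X) \<Longrightarrow> W \<in> carrier (Ccpt X) \<Longrightarrow> Z \<subseteq> W \<Longrightarrow> s \<in> carrier (sec F Z) \<Longrightarrow>
      \<phi> W (res F Z W s) = res G Z W (\<phi> Z s)"
  shows "\<phi> \<in> presheaf_mor X F G"
  using assms by (simp add: presheaf_mor_def)

lemma presheaf_mor_restrict:
  "\<phi> \<in> presheaf_mor X F G \<Longrightarrow> restrict \<phi> (carrier (Ccpt X)) \<in> presheaf_mor X F G"
  by (simp add: presheaf_morD(1) extensional_restrict)

lemma pushforward_simps [simp]:
  "sec (pushforward X f F) Z = sec F (preim X f Z)"
  "res (pushforward X f F) Z W = res F (preim X f Z) (preim X f W)"
  by (simp_all add: pushforward_def)

lemma preim_simps: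
  assumes "f \<in> qc_maps X Y"
  shows "preim X f (A \<union> B) = preim X f A \<union> preim X f B"
    and "preim X f (A \<inter> B) = preim X f A \<inter> preim X f B"
    and "preim X f {} = {}"
    and "preim X f (topspace Y) = topspace X"
    and "A \<subseteq> B \<Longrightarrow> preim X f A \<subseteq> preim X f B"
  using assms continuous_map_image_subset_topspace[of X Y f]
  by (auto simp: preim_def qc_maps_def)

lemma preim_Ccpt:
  assumes f: "f \<in> qc_maps X Y" and Z: "Z \<in> carrier (Ccpt Y)"
  shows "preim X f Z \<in> carrier (Ccpt X)"
proof -
  have "topspace X - preim X f Z = preim X f (topspace Y - Z)"
    using preim_simps(4)[OF f] by (auto simp: preim_def)
  then show ?thesis
    using f Z by (auto simp: Ccpt_qcopen qc_maps_def) (auto simp: preim_def)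
qed

lemma preim_covers:
  assumes "f \<in> qc_maps X Y" "covers Y Z D"
  shows "covers X (preim X f Z) (preim X f ` D)"
  using assms preim_Ccpt[OF assms(1)] by (auto simp: covers_def preim_def)

lemma preim_ident: "Z \<in> carrier (Ccpt X) \<Longrightarrow> preim X (\<lambda>x\<in>topspace X. x) Z = Z"
  using Ccpt_topspace[of Z X] by (auto simp: preim_def)

lemma ident_qc_maps: "(\<lambda>x\<in>topspace X. x) \<in> qc_maps X X"
proof -
  have "preim X (\<lambda>x\<in>topspace X. x) V = V" if "qcopen X V" for V
    using that compactin_subset_topspace[of X V] by (auto simp: preim_def qcopen_def)
  moreover have "continuous_map X X (\<lambda>x\<in>topspace X. x)"
    by (rule continuous_map_eq[of _ _ id]) auto
  ultimately show ?thesis by (simp add: qc_maps_def)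
qed

lemma qc_maps_mem: "f \<in> qc_maps X Y \<Longrightarrow> x \<in> topspace X \<Longrightarrow> f x \<in> topspace Y"
  by (auto simp: qc_maps_def continuous_map_def)

lemma preim_compose:
  assumes "f \<in> qc_maps X Y"
  shows "preim X (compose (topspace X) g f) Z = preim X f (preim Y g Z)"
  using qc_maps_mem[OF assms] by (auto simp: preim_def compose_def)

lemma compose_qc_maps:
  assumes f: "f \<in> qc_maps X Y" and g: "g \<in> qc_maps Y T"
  shows "compose (topspace X) g f \<in> qc_maps X T"
proof -
  have "continuous_map X T (g \<circ> f)"
    using f g by (auto simp: qc_maps_def intro: continuous_map_compose)
  then have "continuous_map X T (compose (topspace X) g f)"
    by (rule continuous_map_eq) (simp add: compose_def)
  then show ?thesis
    using f g by (simp add: qc_maps_def preim_compose[OF f])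
qed

section \<open>The morphism of sheaves \<open>tau\<close> induced by a quasi-compact map\<close>

locale qc_map = alg_space X + Y: alg_space Y for X :: "'p topology" and Y :: "'q topology" +
  fixes f
  assumes f: "f \<in> qc_maps X Y"
begin

abbreviation pre where "pre \<equiv> preim X f"

lemma pre_C: "Z \<in> Y.C \<Longrightarrow> pre Z \<in> C"
  by (rule preim_Ccpt[OF f])

text \<open>Preimage commutes with union, so it carries the relation
  \<open>A \<union> Z = B \<union> Z\<close> to the corresponding one on \<open>X\<close>, and the
  saturated image of a class is one class. All properties of \<open>tau_map\<close> are read off
  from this formula.\<close>

lemma tau_map_cl:
  assumes Z: "Z \<in> Y.C" and A: "A \<in> Y.C"
  shows "tau_map X Y f Z (Y.cl Z A) = cl (pre Z) (pre A)"
proof -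
  have "loc_cong (Ccpt X) (pre Z) `` (pre ` Y.cl Z A) = cl (pre Z) (pre A)" (is "?L = ?R")
  proof
    show "?L \<subseteq> ?R"
    proof
      fix B' assume "B' \<in> ?L"
      then obtain B where B: "B \<in> Y.cl Z A" "(pre B, B') \<in> loc_cong (Ccpt X) (pre Z)" by blast
      have "A \<union> Z = B \<union> Z" using B(1) by (simp add: Y.cl_def[OF Z A])
      then have "pre A \<union> pre Z = pre B \<union> pre Z" by (simp flip: preim_simps(1)[OF f])
      then show "B' \<in> ?R"
        using B(2) by (simp add: loc_cong_Ccpt[OF pre_C[OF Z]] cl_def[OF pre_C[OF Z] pre_C[OF A]])
    qed
    have "A \<in> Y.cl Z A" using A by (simp add: Y.cl_def[OF Z A])
    moreover have "?R = loc_cong (Ccpt X) (pre Z) `` {pre A}"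
      using pre_C[OF A] by (simp add: loc_map_def quot_map_def)
    ultimately show "?R \<subseteq> ?L" by blast
  qed
  then show ?thesis using Z Y.cl_closed[OF A, of Z] by (simp add: tau_map_def tau_def)
qed

lemma tau_map_hom:
  assumes Z: "Z \<in> Y.C"
  shows "tau_map X Y f Z \<in> semiring_hom (sec (tau Y) Z) (sec (tau X) (pre Z))"
proof (rule semiring_homI)
  note [simp] = preim_simps(1-4)[OF f] pre_C Z tau_map_cl tau_ops Y.tau_ops
  show "tau_map X Y f Z \<in> extensional (carrier (sec (tau Y) Z))"
    using Z by (simp add: tau_map_def tau_def)
  show "tau_map X Y f Z \<one>\<^bsub>sec (tau Y) Z\<^esub> = \<one>\<^bsub>sec (tau X) (pre Z)\<^esub>"
    "tau_map X Y f Z \<zero>\<^bsub>sec (tau Y) Z\<^esub> = \<zero>\<^bsub>sec (tau X) (pre Z)\<^esub>"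
    by (simp_all add: tau_consts Y.tau_consts)
  fix x assume "x \<in> carrier (sec (tau Y) Z)"
  then obtain A where A: "A \<in> Y.C" "x = Y.cl Z A" by (auto simp only: Y.tau_carrier)
  then show "tau_map X Y f Z x \<in> carrier (sec (tau X) (pre Z))" by simp
  fix y assume "y \<in> carrier (sec (tau Y) Z)"
  then obtain B where B: "B \<in> Y.C" "y = Y.cl Z B" by (auto simp only: Y.tau_carrier)
  show "tau_map X Y f Z (x \<otimes>\<^bsub>sec (tau Y) Z\<^esub> y) = tau_map X Y f Z x \<otimes>\<^bsub>sec (tau X) (pre Z)\<^esub> tau_map X Y f Z y"
    "tau_map X Y f Z (x \<oplus>\<^bsub>sec (tau Y) Z\<^esub> y) = tau_map X Y f Z x \<oplus>\<^bsub>sec (tau X) (pre Z)\<^esub> tau_map X Y f Z y"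
    using A B by simp_all
qed

lemma tau_map_res:
  assumes Z: "Z \<in> Y.C" "W \<in> Y.C" "Z \<subseteq> W" and x: "x \<in> carrier (sec (tau Y) Z)"
  shows "tau_map X Y f W (res (tau Y) Z W x) = res (tau X) (pre Z) (pre W) (tau_map X Y f Z x)"
proof -
  obtain A where A: "A \<in> Y.C" "x = Y.cl Z A" using x by (auto simp only: Y.tau_carrier)
  then show ?thesis
    using Z pre_C preim_simps(5)[OF f Z(3)] by (simp add: Y.tau_res tau_map_cl tau_res)
qed

end

lemma (in alg_space) tau_map_ident:
  assumes Z: "Z \<in> C" and x: "x \<in> carrier (sec (tau X) Z)"
  shows "tau_map X X (\<lambda>x\<in>topspace X. x) Z x = x"
proof -
  interpret i: qc_map X X "\<lambda>x\<in>topspace X. x" by unfold_locales (rule ident_qc_maps)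
  obtain A where A: "A \<in> C" "x = cl Z A" using x by (auto simp only: tau_carrier)
  then show ?thesis using Z by (simp add: i.tau_map_cl preim_ident)
qed

lemma tau_map_compose:
  assumes "qc_map X Y f" "qc_map Y T g" "Z \<in> carrier (Ccpt T)" "x \<in> carrier (sec (tau T) Z)"
  shows "tau_map X T (compose (topspace X) g f) Z x = tau_map X Y f (preim Y g Z) (tau_map Y T g Z x)"
proof -
  interpret f: qc_map X Y f by fact
  interpret g: qc_map Y T g by fact
  interpret h: qc_map X T "compose (topspace X) g f"
    by unfold_locales (rule compose_qc_maps[OF f.f g.f])
  obtain A where A: "A \<in> carrier (Ccpt T)" "x = g.Y.cl Z A" using assms(4) by (auto simp only: g.Y.tau_carrier)
  show ?thesis
    using A assms(3) g.pre_C by (simp add: h.tau_map_cl g.tau_map_cl f.tau_map_cl preim_compose[OF f.f])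
qed

section \<open>Sheafification\<close>

locale presheaf_space = alg_space X for X :: "'p topology" +
  fixes F :: "('p, 'r) presheaf"
  assumes psh: "is_presheaf X F"
begin

lemma res_closed: "V \<in> C \<Longrightarrow> W \<in> C \<Longrightarrow> V \<subseteq> W \<Longrightarrow> s \<in> carrier (sec F V) \<Longrightarrow> res F V W s \<in> carrier (sec F W)"
  by (rule semiring_homD(2)[OF presheafD(2)[OF psh]])

lemmas res_id = presheafD(3)[OF psh]

lemmas res_comp = presheafD(4)[OF psh]

text \<open>"Below" refers to the order of \<open>Ccpt X\<close>, which is reverse inclusion. As the
  empty set is the top element, \<open>below {}\<close> consists of all local sections.\<close>

definition below :: "'p set \<Rightarrow> ('p set \<times> 'r) set" where
  "below Z = {p. fst p \<in> C \<and> Z \<subseteq> fst p \<and> snd p \<in> carrier (sec F (fst p))}"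

text \<open>\<open>agree\<close> compares on the overlap of its arguments, which changes along a
  chain of sections. With the region \<open>U\<close> as a parameter, the relation is transitive
  among sections restrictable to \<open>U\<close> and persists when the closed set \<open>U\<close>
  grows.\<close>

definition eq_on :: "'p set \<Rightarrow> 'p set \<times> 'r \<Rightarrow> 'p set \<times> 'r \<Rightarrow> bool" where
  "eq_on U p q \<longleftrightarrow> (\<exists>D. covers X U D \<and> (\<forall>T\<in>D. res F (fst p) T (snd p) = res F (fst q) T (snd q)))"

lemma agree_eq_on: "agree X F p q \<longleftrightarrow> eq_on (fst p \<union> fst q) p q"
  by (auto simp: agree_def eq_on_def split: prod.split)

lemma eq_on_sym: "eq_on U p q \<Longrightarrow> eq_on U q p"
  by (auto simp: eq_on_def)

lemma agree_sym: "agree X F p q \<Longrightarrow> agree X F q p"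
  using eq_on_sym by (auto simp: agree_eq_on Un_commute)

lemma eq_onI:
  assumes "U \<in> C" "res F (fst p) U (snd p) = res F (fst q) U (snd q)"
  shows "eq_on U p q"
  unfolding eq_on_def by (rule exI[of _ "{U}"]) (use assms in \<open>simp add: covers_def\<close>)

text \<open>In terms of open complements these are the pairwise intersections of two finite covers,
  that is, their common refinement over the intersection of the covered sets.\<close>

lemma covers_refine:
  assumes "covers X U D" "covers X U' D'"
  shows "covers X (U \<union> U') ((\<lambda>(T, T'). T \<union> T') ` (D \<times> D'))"
proof -
  have "\<Inter>((\<lambda>(T, T'). T \<union> T') ` (D \<times> D')) = U \<union> U'" (is "?L = _")
  proof
    show "?L \<subseteq> U \<union> U'"
    proof
      fix x assume x: "x \<in> ?L"
      show "x \<in> U \<union> U'"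
      proof (rule ccontr)
        assume "x \<notin> U \<union> U'"
        then obtain T T' where "T \<in> D" "x \<notin> T" "T' \<in> D'" "x \<notin> T'"
          using assms by (auto simp: covers_def)
        then show False using x by force
      qed
    qed
    show "U \<union> U' \<subseteq> ?L" using assms by (auto simp: covers_def)
  qed
  then show ?thesis using assms by (auto simp: covers_def)
qed

lemma covers_C: "covers X U D \<Longrightarrow> U \<in> C"
  using C_Inter[of D] by (auto simp: covers_def)

lemma res_eq_mono:
  assumes "p \<in> below {}" "q \<in> below {}" "fst p \<subseteq> T" "fst q \<subseteq> T" "T \<in> C" "T' \<in> C" "T \<subseteq> T'"
    and "res F (fst p) T (snd p) = res F (fst q) T (snd q)"
  shows "res F (fst p) T' (snd p) = res F (fst q) T' (snd q)"
  using assms res_comp[of "fst p" T T' "snd p"] res_comp[of "fst q" T T' "snd q"]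
  by (auto simp: below_def)

text \<open>Both equalities persist on the common refinement of the two witnessing covers.
  Monotonicity, transitivity and the compatibility of \<open>agree\<close> with the semiring
  operations are all drawn from this.\<close>

lemma eq_on2:
  assumes 1: "eq_on U p q" "p \<in> below {}" "q \<in> below {}" "fst p \<subseteq> U" "fst q \<subseteq> U"
    and 2: "eq_on U' p' q'" "p' \<in> below {}" "q' \<in> below {}" "fst p' \<subseteq> U'" "fst q' \<subseteq> U'"
  shows "\<exists>D. covers X (U \<union> U') D \<and> (\<forall>T\<in>D. res F (fst p) T (snd p) = res F (fst q) T (snd q) \<and>
    res F (fst p') T (snd p') = res F (fst q') T (snd q'))"
proof -
  obtain D where D: "covers X U D" "\<forall>T\<in>D. res F (fst p) T (snd p) = res F (fst q) T (snd q)"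
    using 1(1) by (auto simp: eq_on_def)
  obtain D' where D': "covers X U' D'" "\<forall>T\<in>D'. res F (fst p') T (snd p') = res F (fst q') T (snd q')"
    using 2(1) by (auto simp: eq_on_def)
  have "res F (fst p) (T \<union> T') (snd p) = res F (fst q) (T \<union> T') (snd q)"
    "res F (fst p') (T \<union> T') (snd p') = res F (fst q') (T \<union> T') (snd q')"
    if T: "T \<in> D" "T' \<in> D'" for T T'
  proof -
    have "T \<in> C" "U \<subseteq> T" "T' \<in> C" "U' \<subseteq> T'" using T D D' by (auto simp: covers_def)
    then show "res F (fst p) (T \<union> T') (snd p) = res F (fst q) (T \<union> T') (snd q)"
      "res F (fst p') (T \<union> T') (snd p') = res F (fst q') (T \<union> T') (snd q')"
      using T D(2) D'(2) 1 2
        res_eq_mono[of p q T "T \<union> T'"] res_eq_mono[of p' q' T' "T \<union> T'"] by blast+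
  qed
  then show ?thesis
    by (intro exI[of _ "(\<lambda>(T, T'). T \<union> T') ` (D \<times> D')"] conjI covers_refine D D') auto
qed

lemma eq_on_mono:
  assumes "eq_on U p q" "p \<in> below {}" "q \<in> below {}" "fst p \<subseteq> U" "fst q \<subseteq> U" "U \<subseteq> U'" "U' \<in> C"
  shows "eq_on U' p q"
proof -
  \<comment> \<open>A section over \<open>U'\<close> agrees with itself there; pairing this trivial
    agreement with the given one yields a cover of \<open>U \<union> U' = U'\<close>.\<close>
  let ?r = "(U', res F (fst p) U' (snd p))"
  have 1: "eq_on U' ?r ?r"
    using assms(7) by (rule eq_onI) simp
  have 2: "?r \<in> below {}"
    using assms res_closed[of "fst p" U' "snd p"] by (auto simp: below_def)
  obtain D where "covers X (U \<union> U') D" "\<forall>T\<in>D. res F (fst p) T (snd p) = res F (fst q) T (snd q)"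
    using eq_on2[OF assms(1-5) 1 2 2] by auto
  then show ?thesis
    using assms(6) unfolding eq_on_def by (auto simp: Un_absorb1)
qed

lemma eq_on_trans:
  assumes "eq_on U p q" "eq_on U q r" "p \<in> below {}" "q \<in> below {}" "r \<in> below {}"
    "fst p \<subseteq> U" "fst q \<subseteq> U" "fst r \<subseteq> U"
  shows "eq_on U p r"
proof -
  obtain D where "covers X (U \<union> U) D" "\<forall>T\<in>D. res F (fst p) T (snd p) = res F (fst q) T (snd q) \<and>
    res F (fst q) T (snd q) = res F (fst r) T (snd r)"
    using eq_on2[OF assms(1,3,4,6,7) assms(2,4,5,7,8)] by blast
  then show ?thesis unfolding eq_on_def by auto
qed

text \<open>Local character of agreement: the covers of the sets \<open>U \<union> T\<close>, taken
  together, form a finite family with intersection \<open>U \<union> \<Inter>D = U\<close>.\<close>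

lemma eq_on_glue:
  assumes D: "finite D" "D \<noteq> {}" "\<Inter>D \<subseteq> U" and eq: "\<And>T. T \<in> D \<Longrightarrow> eq_on (U \<union> T) p q"
  shows "eq_on U p q"
proof -
  obtain E where E: "\<And>T. T \<in> D \<Longrightarrow> covers X (U \<union> T) (E T)"
    "\<And>T V. T \<in> D \<Longrightarrow> V \<in> E T \<Longrightarrow> res F (fst p) V (snd p) = res F (fst q) V (snd q)"
    using eq unfolding eq_on_def by metis
  have "\<Inter>(\<Union>(E ` D)) = (\<Inter>T\<in>D. \<Inter>(E T))" by blast
  also have "\<dots> = (\<Inter>T\<in>D. U \<union> T)" using E(1) by (simp add: covers_def)
  also have "\<dots> = U" using D by blast
  finally have "covers X U (\<Union>(E ` D))"
    using D E(1) by (auto simp: covers_def)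
  then show ?thesis
    unfolding eq_on_def using E(2) by blast
qed

text \<open>
  The analogue of \<open>local_family\<close> for possibly infinite families. Unlike \<open>local_family\<close>, it also holds
  for saturated families, that is, for the sections of the sheafification themselves.
\<close>

definition matching :: "'p set \<Rightarrow> ('p set \<times> 'r) set \<Rightarrow> bool" where
  "matching Z P \<longleftrightarrow> P \<subseteq> below Z \<and> (\<forall>p\<in>P. \<forall>q\<in>P. agree X F p q) \<and>
     (\<exists>Q\<subseteq>P. finite Q \<and> covers X Z (fst ` Q))"

lemma below_empty: "p \<in> below Z \<Longrightarrow> p \<in> below {}"
  by (auto simp: below_def)

lemma matching_C: "matching Z P \<Longrightarrow> Z \<in> C"
  using covers_C by (auto simp: matching_def)

lemma matching_below: "matching Z P \<Longrightarrow> p \<in> P \<Longrightarrow> p \<in> below Z"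
  by (auto simp: matching_def)

lemma matching_agreeD: "matching Z P \<Longrightarrow> p \<in> P \<Longrightarrow> q \<in> P \<Longrightarrow> agree X F p q"
  by (auto simp: matching_def)

lemma local_family_matching:
  assumes P: "local_family X F Z P" shows "matching Z P"
proof -
  have "P \<subseteq> below Z"
    using P by (auto simp: local_family_def covers_def below_def)
  then show ?thesis
    using P unfolding local_family_def matching_def by blast
qed

lemma agree_refl: "p \<in> below {} \<Longrightarrow> agree X F p p"
  unfolding agree_eq_on by (rule eq_onI) (auto simp: below_def)

text \<open>A substitute for transitivity of \<open>agree\<close>. By \<open>eq_on_glue\<close> it
  suffices to compare \<open>p\<close> and \<open>q\<close> after enlarging their overlap by
  \<open>fst r\<close>, for \<open>r\<close> in a finite covering part of \<open>P\<close>; there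
  both agree with \<open>r\<close>.\<close>

lemma matching_agree:
  assumes P: "matching Z P" and p: "p \<in> below Z" "\<And>r. r \<in> P \<Longrightarrow> agree X F r p"
    and q: "q \<in> below Z" "\<And>r. r \<in> P \<Longrightarrow> agree X F r q"
  shows "agree X F p q"
proof -
  obtain Q where Q: "Q \<subseteq> P" "finite Q" "covers X Z (fst ` Q)"
    using P by (auto simp: matching_def)
  show ?thesis
    unfolding agree_eq_on
  proof (rule eq_on_glue[of "fst ` Q"])
    show "finite (fst ` Q)" "fst ` Q \<noteq> {}" using Q by (auto simp: covers_def)
    show "\<Inter>(fst ` Q) \<subseteq> fst p \<union> fst q" using Q p(1) by (auto simp: covers_def below_def)
    fix T assume "T \<in> fst ` Q"
    then obtain r where r: "r \<in> P" "T = fst r" using Q(1) by auto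
    have b: "p \<in> below {}" "q \<in> below {}" "r \<in> below {}"
      using below_empty[OF p(1)] below_empty[OF q(1)] below_empty[OF matching_below[OF P r(1)]]
      by blast+
    then have U: "fst p \<union> fst q \<union> T \<in> C" unfolding below_def r(2) by simp
    have "eq_on (fst p \<union> fst q \<union> T) p r"
      by (rule eq_on_mono[OF agree_sym[OF p(2)[OF r(1)], unfolded agree_eq_on] b(1,3) _ _ _ U])
        (auto simp: r)
    moreover have "eq_on (fst p \<union> fst q \<union> T) r q"
      by (rule eq_on_mono[OF q(2)[OF r(1), unfolded agree_eq_on] b(3,2) _ _ _ U]) (auto simp: r)
    ultimately show "eq_on (fst p \<union> fst q \<union> T) p q"
      by (rule eq_on_trans) (use b r in auto)
  qed
qed

lemma saturate_eq: "saturate X F Z P = {p \<in> below Z. \<forall>r\<in>P. agree X F r p}"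
  by (auto simp: saturate_def below_def)

lemma matching_subset_saturate: "matching Z P \<Longrightarrow> P \<subseteq> saturate X F Z P"
  by (auto simp: saturate_eq matching_def)

lemma matching_saturate:
  assumes P: "matching Z P" shows "matching Z (saturate X F Z P)"
proof -
  have "agree X F p q" if "p \<in> saturate X F Z P" "q \<in> saturate X F Z P" for p q
    by (rule matching_agree[OF P]) (use that in \<open>auto simp: saturate_eq\<close>)
  moreover have "saturate X F Z P \<subseteq> below Z" by (auto simp: saturate_eq)
  ultimately show ?thesis
    using P matching_subset_saturate[OF P] unfolding matching_def by (meson order_trans)
qed

text \<open>A section that agrees with all of \<open>Q\<close> agrees with each member of
  \<open>P\<close> by \<open>matching_agree\<close>. Hence a section of the sheafification may be
  computed from any matching subfamily over the same base, even from a singleton.\<close>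

lemma saturate_subset:
  assumes Q: "matching Z Q" and "Q \<subseteq> P" and P: "matching Z P"
  shows "saturate X F Z Q = saturate X F Z P"
proof
  show "saturate X F Z P \<subseteq> saturate X F Z Q" using assms(2) by (auto simp: saturate_eq)
  show "saturate X F Z Q \<subseteq> saturate X F Z P"
  proof
    fix p assume p: "p \<in> saturate X F Z Q"
    have "agree X F r p" if r: "r \<in> P" for r
      by (rule matching_agree[OF Q]) (use p r P assms(2) in \<open>auto simp: saturate_eq matching_def\<close>)
    then show "p \<in> saturate X F Z P" using p by (simp add: saturate_eq)
  qed
qed

lemma matching_finite:
  assumes P: "matching Z P"
  obtains Q where "Q \<subseteq> P" "finite Q" "covers X Z (fst ` Q)" "matching Z Q"
proof -
  obtain Q where Q: "Q \<subseteq> P" "finite Q" "covers X Z (fst ` Q)" using P by (auto simp: matching_def)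
  moreover from this have "matching Z Q" using P unfolding matching_def by blast
  ultimately show ?thesis by (rule that)
qed

text \<open>An intrinsic description, without a chosen generating family: saturating twice changes
  nothing, and conversely a finite covering part of a saturated family is a
  \<open>local_family\<close> that generates it.\<close>

lemma sheafify_carrier:
  "S \<in> carrier (sheafify_sec X F Z) \<longleftrightarrow> matching Z S \<and> saturate X F Z S = S"
proof
  assume "S \<in> carrier (sheafify_sec X F Z)"
  then obtain P where P: "matching Z P" "S = saturate X F Z P"
    using local_family_matching by (auto simp: sheafify_sec_def)
  then show "matching Z S \<and> saturate X F Z S = S"
    using matching_saturate[OF P(1)] saturate_subset[OF P(1) matching_subset_saturate[OF P(1)]]
    by simp
next
  assume S: "matching Z S \<and> saturate X F Z S = S"
  then obtain Q where Q: "Q \<subseteq> S" "finite Q" "covers X Z (fst ` Q)" "matching Z Q"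
    using matching_finite by blast
  then have "local_family X F Z Q"
    by (auto simp: local_family_def matching_def below_def)
  moreover have "saturate X F Z Q = S"
    using saturate_subset[OF Q(4,1)] S by simp
  ultimately show "S \<in> carrier (sheafify_sec X F Z)" by (auto simp: sheafify_sec_def)
qed

lemma saturate_carrier: "matching Z P \<Longrightarrow> saturate X F Z P \<in> carrier (sheafify_sec X F Z)"
  using saturate_subset[OF _ matching_subset_saturate matching_saturate]
  by (simp add: sheafify_carrier matching_saturate)

lemma sheafify_memD:
  "S \<in> carrier (sheafify_sec X F Z) \<Longrightarrow> (W, s) \<in> S \<Longrightarrow> W \<in> C \<and> Z \<subseteq> W \<and> s \<in> carrier (sec F W)"
  using matching_below[of Z S "(W, s)"] by (simp add: sheafify_carrier below_def)

text \<open>Isolates what addition and multiplication have in common, closure and compatibility with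
  restriction, so that both are transported to the sheafification by one argument.\<close>

definition section_op :: "('p set \<Rightarrow> 'r \<Rightarrow> 'r \<Rightarrow> 'r) \<Rightarrow> bool" where
  "section_op f \<longleftrightarrow>
     (\<forall>Z\<in>C. \<forall>x\<in>carrier (sec F Z). \<forall>y\<in>carrier (sec F Z). f Z x y \<in> carrier (sec F Z) \<and>
        (\<forall>W\<in>C. Z \<subseteq> W \<longrightarrow> res F Z W (f Z x y) = f W (res F Z W x) (res F Z W y)))"

definition op_family ::
  "('p set \<Rightarrow> 'r \<Rightarrow> 'r \<Rightarrow> 'r) \<Rightarrow> ('p set \<times> 'r) set \<Rightarrow> ('p set \<times> 'r) set \<Rightarrow> ('p set \<times> 'r) set" where
  "op_family f P Q =
     {(V \<union> W, f (V \<union> W) (res F V (V \<union> W) s) (res F W (V \<union> W) t)) | V W s t. (V, s) \<in> P \<and> (W, t) \<in> Q}"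

lemma section_op_mult: "section_op (\<lambda>Z. (\<otimes>\<^bsub>sec F Z\<^esub>))"
  unfolding section_op_def
  by (auto intro: pirng_closed(3)[OF presheafD(1)[OF psh]] semiring_homD(3)[OF presheafD(2)[OF psh]])

lemma section_op_add: "section_op (\<lambda>Z. (\<oplus>\<^bsub>sec F Z\<^esub>))"
  unfolding section_op_def
  by (auto intro: pirng_closed(4)[OF presheafD(1)[OF psh]] semiring_homD(4)[OF presheafD(2)[OF psh]])

lemma sheafify_ops:
  "S \<otimes>\<^bsub>sheafify_sec X F Z\<^esub> T = saturate X F Z (op_family (\<lambda>Z. (\<otimes>\<^bsub>sec F Z\<^esub>)) S T)"
  "S \<oplus>\<^bsub>sheafify_sec X F Z\<^esub> T = saturate X F Z (op_family (\<lambda>Z. (\<oplus>\<^bsub>sec F Z\<^esub>)) S T)"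
  by (simp_all add: sheafify_sec_def op_family_def)

lemma res_section_op:
  assumes f: "section_op f" and "V \<in> C" "W \<in> C" "s \<in> carrier (sec F V)" "t \<in> carrier (sec F W)"
    and T: "T \<in> C" "V \<union> W \<subseteq> T"
  shows "res F (V \<union> W) T (f (V \<union> W) (res F V (V \<union> W) s) (res F W (V \<union> W) t)) =
    f T (res F V T s) (res F W T t)"
proof -
  have "res F (V \<union> W) T (f (V \<union> W) (res F V (V \<union> W) s) (res F W (V \<union> W) t)) =
    f T (res F (V \<union> W) T (res F V (V \<union> W) s)) (res F (V \<union> W) T (res F W (V \<union> W) t))"
    using assms res_closed[of V "V \<union> W" s] res_closed[of W "V \<union> W" t]
    unfolding section_op_def by simp
  then show ?thesis using assms by (simp add: res_comp)
qed

text \<open>By \<open>eq_on2\<close> the first arguments and the second arguments agree on one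
  common cover; \<open>f\<close> commutes with restriction, so the results agree there as well.
  Covering subfamilies of \<open>P\<close> and \<open>Q\<close> combine by
  \<open>covers_refine\<close>.\<close>

lemma matching_op_family:
  assumes f: "section_op f" and P: "matching Z P" and Q: "matching Z Q"
  shows "matching Z (op_family f P Q)"
proof -
  have "op_family f P Q \<subseteq> below Z"
  proof
    fix p assume "p \<in> op_family f P Q"
    then obtain V W s t where *: "p = (V \<union> W, f (V \<union> W) (res F V (V \<union> W) s) (res F W (V \<union> W) t))"
      "(V, s) \<in> P" "(W, t) \<in> Q" by (auto simp: op_family_def)
    then have "V \<in> C" "W \<in> C" "Z \<subseteq> V" "s \<in> carrier (sec F V)" "t \<in> carrier (sec F W)"
      using matching_below[OF P *(2)] matching_below[OF Q *(3)] by (simp_all add: below_def)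
    then show "p \<in> below Z"
      using f res_closed[of V "V \<union> W" s] res_closed[of W "V \<union> W" t]
      by (auto simp: below_def section_op_def *(1))
  qed
  moreover have "agree X F p q" if pq: "p \<in> op_family f P Q" "q \<in> op_family f P Q" for p q
  proof -
    obtain V W s t where p: "p = (V \<union> W, f (V \<union> W) (res F V (V \<union> W) s) (res F W (V \<union> W) t))"
      "(V, s) \<in> P" "(W, t) \<in> Q" using pq by (auto simp: op_family_def)
    obtain V' W' s' t' where q: "q = (V' \<union> W', f (V' \<union> W') (res F V' (V' \<union> W') s') (res F W' (V' \<union> W') t'))"
      "(V', s') \<in> P" "(W', t') \<in> Q" using pq by (auto simp: op_family_def)
    have b: "(V, s) \<in> below {}" "(V', s') \<in> below {}" "(W, t) \<in> below {}" "(W', t') \<in> below {}"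
      using matching_below[OF P p(2)] matching_below[OF P q(2)]
        matching_below[OF Q p(3)] matching_below[OF Q q(3)] by (simp_all add: below_def)
    then have C: "V \<in> C" "V' \<in> C" "W \<in> C" "W' \<in> C" "s \<in> carrier (sec F V)" "s' \<in> carrier (sec F V')"
      "t \<in> carrier (sec F W)" "t' \<in> carrier (sec F W')"
      by (auto simp: below_def)
    have "eq_on (V \<union> V') (V, s) (V', s')" "eq_on (W \<union> W') (W, t) (W', t')"
      using matching_agreeD[OF P p(2) q(2)] matching_agreeD[OF Q p(3) q(3)]
      by (simp_all add: agree_eq_on)
    from eq_on2[OF this(1) b(1,2) _ _ this(2) b(3,4)]
    obtain D where D: "covers X (V \<union> V' \<union> (W \<union> W')) D"
      "\<And>T. T \<in> D \<Longrightarrow> res F V T s = res F V' T s'" "\<And>T. T \<in> D \<Longrightarrow> res F W T t = res F W' T t'"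
      by auto
    have "res F (fst p) T (snd p) = res F (fst q) T (snd q)" if T: "T \<in> D" for T
    proof -
      have "T \<in> C" "V \<union> W \<subseteq> T" "V' \<union> W' \<subseteq> T" using T D(1) by (auto simp: covers_def)
      then show ?thesis
        using res_section_op[OF f C(1,3,5,7)] res_section_op[OF f C(2,4,6,8)] D(2,3)[OF T]
        by (simp add: p(1) q(1))
    qed
    moreover have "V \<union> V' \<union> (W \<union> W') = fst p \<union> fst q" by (auto simp: p(1) q(1))
    ultimately show ?thesis
      unfolding agree_eq_on eq_on_def using D(1) by auto
  qed
  moreover have "\<exists>R\<subseteq>op_family f P Q. finite R \<and> covers X Z (fst ` R)"
  proof -
    obtain P' where P': "P' \<subseteq> P" "finite P'" "covers X Z (fst ` P')" using P by (auto simp: matching_def)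
    obtain Q' where Q': "Q' \<subseteq> Q" "finite Q'" "covers X Z (fst ` Q')" using Q by (auto simp: matching_def)
    let ?g = "\<lambda>((V, s), (W, t)). (V \<union> W, f (V \<union> W) (res F V (V \<union> W) s) (res F W (V \<union> W) t))"
    have "fst ` ?g ` (P' \<times> Q') = (\<lambda>(T, T'). T \<union> T') ` (fst ` P' \<times> fst ` Q')"
      by (force simp: image_iff)
    then have "covers X Z (fst ` ?g ` (P' \<times> Q'))"
      using covers_refine[OF P'(3) Q'(3)] by simp
    moreover have "?g ` (P' \<times> Q') \<subseteq> op_family f P Q"
      using P'(1) Q'(1) by (fastforce simp: op_family_def)
    ultimately show ?thesis using P'(2) Q'(2) by (meson finite_SigmaI finite_imageI)
  qed
  ultimately show ?thesis by (auto simp: matching_def)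
qed

section \<open>The unit of the sheafification, and restriction of its sections\<close>

lemma matching_single: "Z \<in> C \<Longrightarrow> s \<in> carrier (sec F Z) \<Longrightarrow> matching Z {(Z, s)}"
  using agree_refl[of "(Z, s)"] unfolding matching_def
  by (intro conjI exI[of _ "{(Z, s)}"]) (simp_all add: below_def covers_def)

lemma sheafify_unit_eq:
  "Z \<in> C \<Longrightarrow> s \<in> carrier (sec F Z) \<Longrightarrow> sheafify_unit X F Z s = saturate X F Z {(Z, s)}"
  by (simp add: sheafify_unit_def)

lemma sheafify_unit_carrier:
  "Z \<in> C \<Longrightarrow> s \<in> carrier (sec F Z) \<Longrightarrow> sheafify_unit X F Z s \<in> carrier (sheafify_sec X F Z)"
  by (simp add: sheafify_unit_eq saturate_carrier matching_single)

lemma sheafify_unit_mem: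
  "Z \<in> C \<Longrightarrow> s \<in> carrier (sec F Z) \<Longrightarrow> (Z, s) \<in> sheafify_unit X F Z s"
  using matching_subset_saturate[OF matching_single, of Z s] by (simp add: sheafify_unit_eq)

text \<open>The combined family contains the pair \<open>(Z, f Z s t)\<close>, which is a matching
  family over \<open>Z\<close> on its own and therefore generates the same section.\<close>

lemma sheafify_unit_op:
  assumes f: "section_op f" and Z: "Z \<in> C" and st: "s \<in> carrier (sec F Z)" "t \<in> carrier (sec F Z)"
  shows "saturate X F Z (op_family f (sheafify_unit X F Z s) (sheafify_unit X F Z t)) =
    sheafify_unit X F Z (f Z s t)"
proof -
  have *: "matching Z (op_family f (sheafify_unit X F Z s) (sheafify_unit X F Z t))"
    using f sheafify_unit_carrier[OF Z st(1)] sheafify_unit_carrier[OF Z st(2)]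
    by (simp add: sheafify_carrier matching_op_family)
  have fst: "f Z s t \<in> carrier (sec F Z)"
    using f Z st by (auto simp: section_op_def)
  have "(Z, f Z s t) \<in> op_family f (sheafify_unit X F Z s) (sheafify_unit X F Z t)"
    unfolding op_family_def mem_Collect_eq
    using sheafify_unit_mem[OF Z st(1)] sheafify_unit_mem[OF Z st(2)] st Z
    by (intro exI[of _ Z] exI[of _ s] exI[of _ t]) (simp add: res_id)
  then show ?thesis
    using saturate_subset[OF matching_single[OF Z fst] _ *] by (simp add: sheafify_unit_eq[OF Z fst])
qed

lemma sheafify_unit_hom:
  assumes Z: "Z \<in> C"
  shows "sheafify_unit X F Z \<in> semiring_hom (sec F Z) (sheafify_sec X F Z)"
proof (rule semiring_homI)
  have p: "\<one>\<^bsub>sec F Z\<^esub> \<in> carrier (sec F Z)" "\<zero>\<^bsub>sec F Z\<^esub> \<in> carrier (sec F Z)"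
    using pirng_closed[OF presheafD(1)[OF psh Z]] by auto
  show "sheafify_unit X F Z \<one>\<^bsub>sec F Z\<^esub> = \<one>\<^bsub>sheafify_sec X F Z\<^esub>"
    "sheafify_unit X F Z \<zero>\<^bsub>sec F Z\<^esub> = \<zero>\<^bsub>sheafify_sec X F Z\<^esub>"
    using p Z by (simp_all add: sheafify_unit_eq sheafify_sec_def)
  show "sheafify_unit X F Z \<in> extensional (carrier (sec F Z))"
    using Z by (simp add: sheafify_unit_def)
qed (use Z in \<open>simp_all add: sheafify_unit_carrier sheafify_ops sheafify_unit_op
      section_op_mult section_op_add\<close>)

text \<open>The restriction agrees with \<open>s\<close> over \<open>W\<close>, and \<open>s\<close>
  agrees with every \<open>r\<close> in \<open>S\<close>; chaining the two on
  \<open>fst r \<union> W\<close> shows that the restriction belongs to the saturation, which is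
  \<open>S\<close>.\<close>

lemma res_mem:
  assumes S: "S \<in> carrier (sheafify_sec X F Z)" and s: "(V, s) \<in> S" and W: "W \<in> C" "V \<subseteq> W"
  shows "(W, res F V W s) \<in> S"
proof -
  have V: "V \<in> C" "Z \<subseteq> V" "s \<in> carrier (sec F V)" using sheafify_memD[OF S s] by auto
  then have b: "(W, res F V W s) \<in> below Z" "(V, s) \<in> below Z"
    using W res_closed by (auto simp: below_def)
  have "agree X F r (W, res F V W s)" if r: "r \<in> S" for r
  proof -
    have m: "matching Z S" using S by (simp add: sheafify_carrier)
    have r': "r \<in> below {}" by (rule below_empty[OF matching_below[OF m r]])
    have "agree X F r (V, s)" by (rule matching_agreeD[OF m r s])
    moreover have "agree X F (V, s) (W, res F V W s)"
      using V W by (auto simp: agree_eq_on intro!: eq_onI simp: res_comp Un_absorb1 res_id res_closed)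
    ultimately have 1: "eq_on (fst r \<union> V) r (V, s)" "eq_on W (V, s) (W, res F V W s)"
      using W(2) by (simp_all add: agree_eq_on Un_absorb1)
    have U: "fst r \<union> W \<in> C" using r' W(1) by (simp add: below_def)
    have "eq_on (fst r \<union> W) r (V, s)"
      by (rule eq_on_mono[OF 1(1) r' below_empty[OF b(2)] _ _ _ U]) (use W in auto)
    moreover have "eq_on (fst r \<union> W) (V, s) (W, res F V W s)"
      by (rule eq_on_mono[OF 1(2) b(2,1)[THEN below_empty] _ _ _ U]) (use W in auto)
    ultimately have "eq_on (fst r \<union> W) r (W, res F V W s)"
      by (rule eq_on_trans) (use r' b[THEN below_empty] W in auto)
    then show ?thesis by (simp add: agree_eq_on)
  qed
  then have "(W, res F V W s) \<in> saturate X F Z S"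
    using b by (simp add: saturate_eq)
  then show ?thesis using S by (simp add: sheafify_carrier)
qed

lemma sheafify_res:
  assumes "S \<in> carrier (sheafify_sec X F Z)"
  shows "res (sheafify X F) Z W S = {(V, s) \<in> S. W \<subseteq> V}"
  using assms by (simp add: sheafify_def)

lemma sheafify_res_carrier:
  assumes S: "S \<in> carrier (sheafify_sec X F Z)" and W: "W \<in> C" "Z \<subseteq> W"
  shows "res (sheafify X F) Z W S \<in> carrier (sheafify_sec X F W)"
proof -
  let ?R = "{(V, s) \<in> S. W \<subseteq> V}"
  have m: "matching Z S" "saturate X F Z S = S" using S by (auto simp: sheafify_carrier)
  obtain Q where Q: "Q \<subseteq> S" "finite Q" "covers X Z (fst ` Q)" using m by (auto simp: matching_def)
  \<comment> \<open>Restricting a finite covering part of \<open>S\<close> to the sets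
    \<open>V \<union> W\<close> gives members of \<open>?R\<close> that cover
    \<open>W\<close>.\<close>
  let ?Q = "(\<lambda>(V, s). (V \<union> W, res F V (V \<union> W) s)) ` Q"
  have sub: "?Q \<subseteq> ?R"
    using Q(1) W sheafify_memD[OF S] by (auto intro!: res_mem[OF S])
  have "covers X W (fst ` ?Q)"
  proof -
    have "fst ` ?Q = (\<lambda>(T, T'). T \<union> T') ` (fst ` Q \<times> {W})" by (force simp: image_iff)
    moreover have "covers X W {W}" using W by (simp add: covers_def)
    ultimately show ?thesis
      using covers_refine[OF Q(3), of W "{W}"] W(2) by (simp add: Un_absorb1)
  qed
  then have R: "matching W ?R"
    using m(1) sub Q(2) unfolding matching_def
    by (intro conjI exI[of _ ?Q]) (auto simp: below_def)
  \<comment> \<open>Saturation: any \<open>r\<close> in \<open>S\<close> can be replaced by its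
    restriction to \<open>V \<union> W\<close>, which lies in \<open>?R\<close> and has the same
    overlap with \<open>p\<close>, because \<open>W\<close> is contained in
    \<open>fst p\<close>.\<close>
  have "p \<in> ?R" if p: "p \<in> saturate X F W ?R" for p
  proof -
    have pW: "p \<in> below W" using p by (simp add: saturate_eq)
    have "agree X F r p" if r: "r \<in> S" for r
    proof -
      obtain V s where r': "r = (V, s)" "V \<in> C" "s \<in> carrier (sec F V)"
        using sheafify_memD[OF S] r by (cases r) auto
      have C: "V \<union> W \<in> C" "fst p \<in> C" using r' W pW by (auto simp: below_def)
      let ?r = "(V \<union> W, res F V (V \<union> W) s)"
      have "?r \<in> ?R" using res_mem[OF S] r r' C by auto
      then have "agree X F ?r p" using p by (simp add: saturate_eq)
      moreover have "V \<union> W \<union> fst p = V \<union> fst p" using pW by (auto simp: below_def)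
      ultimately have 1: "eq_on (V \<union> fst p) ?r p" by (simp add: agree_eq_on)
      have 2: "eq_on (V \<union> fst p) r ?r"
        using C r' W pW by (intro eq_onI) (auto simp: res_comp below_def le_supI2)
      have "eq_on (V \<union> fst p) r p"
        by (rule eq_on_trans[OF 2 1]) (use C r' W pW res_closed in \<open>auto simp: below_def\<close>)
      then show ?thesis by (simp add: agree_eq_on r')
    qed
    then have "p \<in> saturate X F Z S"
      using pW W by (auto simp: saturate_eq below_def)
    then show ?thesis using m(2) pW by (auto simp: below_def)
  qed
  then have "saturate X F W ?R = ?R"
    using matching_subset_saturate[OF R] by blast
  then show ?thesis
    using R sheafify_res[OF S] by (simp add: sheafify_carrier)
qed

text \<open>Over \<open>W\<close> the restricted family contains \<open>(W, s)\<close>, and this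
  single pair is already matching over \<open>W\<close>. So each section is, on the sets of its own
  family, in the image of the unit.\<close>

lemma sheafify_res_mem:
  assumes S: "S \<in> carrier (sheafify_sec X F Z)" and s: "(W, s) \<in> S"
  shows "res (sheafify X F) Z W S = sheafify_unit X F W s"
proof -
  have W: "W \<in> C" "Z \<subseteq> W" "s \<in> carrier (sec F W)" using sheafify_memD[OF S s] by auto
  have "(W, s) \<in> res (sheafify X F) Z W S" using sheafify_res[OF S] s by simp
  moreover have "matching W (res (sheafify X F) Z W S)"
    "saturate X F W (res (sheafify X F) Z W S) = res (sheafify X F) Z W S"
    using sheafify_res_carrier[OF S W(1,2)] by (auto simp: sheafify_carrier)
  ultimately show ?thesis
    using saturate_subset[OF matching_single[OF W(1,3)]] W by (simp add: sheafify_unit_eq)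
qed

lemma sheafify_res_unit:
  assumes "Z \<in> C" "W \<in> C" "Z \<subseteq> W" "s \<in> carrier (sec F Z)"
  shows "res (sheafify X F) Z W (sheafify_unit X F Z s) = sheafify_unit X F W (res F Z W s)"
  by (rule sheafify_res_mem)
    (use assms in \<open>auto intro: sheafify_unit_carrier res_mem sheafify_unit_mem\<close>)

end

text \<open>Only the restriction of \<open>\<phi>\<close> to the carrier is assumed to be a
  morphism, because \<open>alpha1_mor\<close> hands a family defined on all sets, hence not
  extensional, to \<open>sheafify_map\<close>.\<close>

locale presheaf_map = qc_map X Y f + presheaf_space X G + Y: presheaf_space Y F
  for X :: "'p topology" and G :: "('p, 'r) presheaf"
    and Y :: "'q topology" and F :: "('q, 's) presheaf" and f +
  fixes \<phi> :: "'q set \<Rightarrow> 's \<Rightarrow> 'r"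
  assumes \<phi>: "restrict \<phi> (carrier (Ccpt Y)) \<in> presheaf_mor Y F (pushforward X f G)"
begin

definition image_family :: "('q set \<times> 's) set \<Rightarrow> ('p set \<times> 'r) set" where
  "image_family S = {(pre W, \<phi> W s) | W s. (W, s) \<in> S}"

lemma image_family_image: "image_family S = (\<lambda>(W, s). (pre W, \<phi> W s)) ` S"
  by (force simp: image_family_def)

lemma \<phi>_hom: "Z \<in> Y.C \<Longrightarrow> \<phi> Z \<in> semiring_hom (sec F Z) (sec G (pre Z))"
  using \<phi> by (simp add: presheaf_mor_def pushforward_def)

lemma \<phi>_res:
  "Z \<in> Y.C \<Longrightarrow> W \<in> Y.C \<Longrightarrow> Z \<subseteq> W \<Longrightarrow> s \<in> carrier (sec F Z) \<Longrightarrow>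
    \<phi> W (res F Z W s) = res G (pre Z) (pre W) (\<phi> Z s)"
  using \<phi> by (simp add: presheaf_mor_def pushforward_def)

text \<open>A cover witnessing agreement on \<open>Y\<close> pulls back to a cover on
  \<open>X\<close>, and \<open>\<phi>\<close> commutes with restriction, so the images agree on the
  pulled-back cover.\<close>

lemma matching_image:
  assumes P: "Y.matching Z P" shows "matching (pre Z) (image_family P)"
proof -
  have mem: "W \<in> Y.C \<and> Z \<subseteq> W \<and> s \<in> carrier (sec F W)" if "(W, s) \<in> P" for W s
    using Y.matching_below[OF P that] by (simp add: Y.below_def)
  have "image_family P \<subseteq> below (pre Z)"
  proof
    fix p assume "p \<in> image_family P"
    then obtain W s where p: "p = (pre W, \<phi> W s)" "(W, s) \<in> P" by (auto simp: image_family_def)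
    then show "p \<in> below (pre Z)"
      using mem[OF p(2)] preim_Ccpt[OF f, of W] preim_simps(5)[OF f, of Z W]
        semiring_homD(2)[OF \<phi>_hom, of W s]
      by (simp add: below_def)
  qed
  moreover have "agree X G p q" if pq: "p \<in> image_family P" "q \<in> image_family P" for p q
  proof -
    obtain V s where p: "p = (pre V, \<phi> V s)" "(V, s) \<in> P" using pq by (auto simp: image_family_def)
    obtain W t where q: "q = (pre W, \<phi> W t)" "(W, t) \<in> P" using pq by (auto simp: image_family_def)
    have "agree Y F (V, s) (W, t)" by (rule Y.matching_agreeD[OF P p(2) q(2)])
    then obtain D where D: "covers Y (V \<union> W) D" "\<And>T. T \<in> D \<Longrightarrow> res F V T s = res F W T t"
      by (auto simp: Y.agree_eq_on Y.eq_on_def)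
    have "res G (pre V) (pre T) (\<phi> V s) = res G (pre W) (pre T) (\<phi> W t)" if T: "T \<in> D" for T
    proof -
      have "T \<in> Y.C" "V \<subseteq> T" "W \<subseteq> T" using T D by (auto simp: covers_def)
      then show ?thesis
        using D(2)[OF T] \<phi>_res[of V T s] \<phi>_res[of W T t] mem[OF p(2)] mem[OF q(2)] by simp
    qed
    then show ?thesis
      using preim_covers[OF f D(1)]
      by (auto simp: agree_eq_on eq_on_def p(1) q(1) preim_simps(1)[OF f] intro!: exI[of _ "pre ` D"])
  qed
  moreover have "\<exists>R\<subseteq>image_family P. finite R \<and> covers X (pre Z) (fst ` R)"
  proof -
    obtain Q where Q: "Q \<subseteq> P" "finite Q" "covers Y Z (fst ` Q)" using P by (auto simp: Y.matching_def)
    let ?R = "(\<lambda>(W, s). (pre W, \<phi> W s)) ` Q"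
    have "fst ` ?R = pre ` fst ` Q" by (force simp: image_iff)
    then have "covers X (pre Z) (fst ` ?R)" using preim_covers[OF f Q(3)] by simp
    moreover have "?R \<subseteq> image_family P" using Q(1) by (auto simp: image_family_def)
    ultimately show ?thesis using Q(2) by (meson finite_imageI)
  qed
  ultimately show ?thesis by (auto simp: matching_def)
qed

text \<open>The definition uses all of \<open>S\<close>; by \<open>saturate_subset\<close> any
  matching \<open>Q\<close> inside it gives the same value. The unit and composites are computed in
  this way.\<close>

lemma sheafify_map_eq:
  assumes S: "S \<in> carrier (sheafify_sec Y F Z)" and Q: "Y.matching Z Q" "Q \<subseteq> S"
  shows "sheafify_map X Y f F G \<phi> Z S = saturate X G (pre Z) (image_family Q)"
proof -
  have m: "Y.matching Z S" using S by (simp add: Y.sheafify_carrier)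
  have "sheafify_map X Y f F G \<phi> Z S = saturate X G (pre Z) (image_family S)"
    using S Y.matching_C[OF m] by (simp add: sheafify_map_def image_family_def)
  moreover have "image_family Q \<subseteq> image_family S" using Q by (auto simp: image_family_def)
  ultimately show ?thesis
    using saturate_subset[OF matching_image[OF Q(1)] _ matching_image[OF m]] by simp
qed

lemma sheafify_map_carrier:
  "S \<in> carrier (sheafify_sec Y F Z) \<Longrightarrow> sheafify_map X Y f F G \<phi> Z S \<in> carrier (sheafify_sec X G (pre Z))"
  using sheafify_map_eq[of S Z S] by (simp add: Y.sheafify_carrier saturate_carrier matching_image)

lemma sheafify_map_unit:
  assumes "Z \<in> Y.C" "s \<in> carrier (sec F Z)"
  shows "sheafify_map X Y f F G \<phi> Z (sheafify_unit Y F Z s) = sheafify_unit X G (pre Z) (\<phi> Z s)"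
proof -
  have "image_family {(Z, s)} = {(pre Z, \<phi> Z s)}" by (auto simp: image_family_def)
  then show ?thesis
    using sheafify_map_eq[OF Y.sheafify_unit_carrier[OF assms] Y.matching_single[OF assms]]
      Y.sheafify_unit_mem[OF assms] preim_Ccpt[OF f assms(1)]
      semiring_homD(2)[OF \<phi>_hom[OF assms(1)] assms(2)]
    by (simp add: sheafify_unit_eq)
qed

end

lemma (in presheaf_space) sheafify_map_id:
  assumes "f \<in> qc_maps X X" and "\<And>x. x \<in> topspace X \<Longrightarrow> f x = x"
    and "\<And>Z s. Z \<in> C \<Longrightarrow> s \<in> carrier (sec F Z) \<Longrightarrow> \<phi> Z s = s"
    and S: "S \<in> carrier (sheafify_sec X F Z)"
  shows "sheafify_map X X f F F \<phi> Z S = S"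
proof -
  have pre: "preim X f W = W" if "W \<in> C" for W
    using that assms(2) Ccpt_topspace[OF that] by (auto simp: preim_def)
  have m: "matching Z S" "saturate X F Z S = S" using S by (auto simp: sheafify_carrier)
  have "\<And>W s. (W, s) \<in> S \<Longrightarrow> preim X f W = W \<and> \<phi> W s = s"
    using sheafify_memD[OF S] pre assms(3) by blast
  then have "{(preim X f W, \<phi> W s) | W s. (W, s) \<in> S} = S" by force
  then show ?thesis
    using S m matching_C[OF m(1)] pre by (simp add: sheafify_map_def)
qed

lemma sheafify_map_comp:
  assumes fm: "presheaf_map X H Y G f \<phi>" and gm: "presheaf_map Y G T F g \<psi>"
    and hm: "presheaf_map X H T F h \<chi>"
    and pre: "\<And>W. W \<in> carrier (Ccpt T) \<Longrightarrow> preim X h W = preim X f (preim Y g W)"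
    and chi: "\<And>W s. W \<in> carrier (Ccpt T) \<Longrightarrow> s \<in> carrier (sec F W) \<Longrightarrow> \<chi> W s = \<phi> (preim Y g W) (\<psi> W s)"
    and S: "S \<in> carrier (sheafify_sec T F Z)"
  shows "sheafify_map X T h F H \<chi> Z S =
    sheafify_map X Y f G H \<phi> (preim Y g Z) (sheafify_map Y T g F G \<psi> Z S)"
proof -
  interpret f: presheaf_map X H Y G f \<phi> by fact
  interpret g: presheaf_map Y G T F g \<psi> by fact
  interpret h: presheaf_map X H T F h \<chi> by fact
  have m: "g.Y.matching Z S" using S by (simp add: g.Y.sheafify_carrier)
  have Z: "Z \<in> carrier (Ccpt T)" by (rule g.Y.matching_C[OF m])
  have gS: "sheafify_map Y T g F G \<psi> Z S = saturate Y G (preim Y g Z) (g.image_family S)"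
    by (rule g.sheafify_map_eq[OF S m]) simp
  \<comment> \<open>The section produced by \<open>g\<close> is saturated and so may have members
    outside this explicit image; since the image is matching, \<open>f\<close> can be evaluated on
    it alone.\<close>
  have "g.image_family S \<subseteq> sheafify_map Y T g F G \<psi> Z S"
    by (subst gS) (rule f.Y.matching_subset_saturate[OF g.matching_image[OF m]])
  then have "sheafify_map X Y f G H \<phi> (preim Y g Z) (sheafify_map Y T g F G \<psi> Z S) =
    saturate X H (preim X f (preim Y g Z)) (f.image_family (g.image_family S))"
    by (rule f.sheafify_map_eq[OF g.sheafify_map_carrier[OF S] g.matching_image[OF m]])
  moreover have "f.image_family (g.image_family S) = h.image_family S"
    unfolding f.image_family_image g.image_family_image h.image_family_image image_image
    using g.Y.sheafify_memD[OF S] pre chi by (intro image_cong) auto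
  ultimately show ?thesis
    using h.sheafify_map_eq[OF S m] pre[OF Z] by simp
qed

text \<open>The assumption restricts \<open>\<phi>\<close> in both arguments, since the function
  extended in \<open>tau_ident\<close> is an unrestricted abstraction.\<close>

locale presheaf_to_tau = presheaf_space +
  fixes \<phi>
  assumes \<phi>: "(\<lambda>Z\<in>carrier (Ccpt X). restrict (\<phi> Z) (carrier (sec F Z))) \<in> presheaf_mor X F (tau X)"
begin

lemma \<phi>_hom: "Z \<in> C \<Longrightarrow> restrict (\<phi> Z) (carrier (sec F Z)) \<in> semiring_hom (sec F Z) (sec (tau X) Z)"
  using presheaf_morD(2)[OF \<phi>, of Z] by simp

lemma \<phi>_closed: "Z \<in> C \<Longrightarrow> s \<in> carrier (sec F Z) \<Longrightarrow> \<phi> Z s \<in> carrier (sec (tau X) Z)"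
  using semiring_homD(2)[OF \<phi>_hom[of Z], of s] by simp

lemma \<phi>_res:
  assumes "Z \<in> C" "W \<in> C" "Z \<subseteq> W" "s \<in> carrier (sec F Z)"
  shows "\<phi> W (res F Z W s) = res (tau X) Z W (\<phi> Z s)"
  using presheaf_morD(3)[OF \<phi> assms] assms res_closed[OF assms(1-4)] by simp

text \<open>Local agreement in \<open>F\<close> becomes equality in \<open>tau\<close> on the whole
  overlap, because \<open>tau\<close> is separated.\<close>

lemma agree_tau:
  assumes "agree X F (V, s) (W, t)" and V: "V \<in> C" "s \<in> carrier (sec F V)"
    and W: "W \<in> C" "t \<in> carrier (sec F W)"
  shows "res (tau X) V (V \<union> W) (\<phi> V s) = res (tau X) W (V \<union> W) (\<phi> W t)"
proof -
  obtain D where D: "covers X (V \<union> W) D" "\<And>T. T \<in> D \<Longrightarrow> res F V T s = res F W T t"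
    using assms(1) by (auto simp: agree_eq_on eq_on_def)
  note c = presheafD(4)[OF is_presheaf_tau]
  note h = semiring_homD(2)[OF tau_res_hom]
  show ?thesis
  proof (rule tau_separated[OF D(1)])
    show "res (tau X) V (V \<union> W) (\<phi> V s) \<in> carrier (sec (tau X) (V \<union> W))"
      "res (tau X) W (V \<union> W) (\<phi> W t) \<in> carrier (sec (tau X) (V \<union> W))"
      using V W by (auto intro!: h \<phi>_closed)
    fix T assume "T \<in> D"
    then have T: "T \<in> C" "V \<union> W \<subseteq> T" "res F V T s = res F W T t"
      using D by (auto simp: covers_def)
    then have "res (tau X) V T (\<phi> V s) = res (tau X) W T (\<phi> W t)"
      using \<phi>_res[of V T s] \<phi>_res[of W T t] V W by simp
    then show "res (tau X) (V \<union> W) T (res (tau X) V (V \<union> W) (\<phi> V s)) =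
      res (tau X) (V \<union> W) T (res (tau X) W (V \<union> W) (\<phi> W t))"
      using V W T by (simp add: c \<phi>_closed)
  qed
qed

lemma separated_on:
  assumes "matching Z Q" "t \<in> carrier (sec (tau X) Z)" "t' \<in> carrier (sec (tau X) Z)"
    and eq: "\<And>W s. (W, s) \<in> Q \<Longrightarrow> res (tau X) Z W t = res (tau X) Z W t'"
  shows "t = t'"
proof -
  obtain R where R: "R \<subseteq> Q" "covers X Z (fst ` R)" using assms(1) by (auto simp: matching_def)
  show ?thesis
    by (rule tau_separated[OF R(2) assms(2,3)]) (use R(1) eq in auto)
qed

text \<open>This justifies the definite description in \<open>sheafify_ext\<close>.\<close>

lemma glue_ex1:
  assumes S: "S \<in> carrier (sheafify_sec X F Z)"
  shows "\<exists>!t. t \<in> carrier (sec (tau X) Z) \<and> (\<forall>(W, s)\<in>S. res (tau X) Z W t = \<phi> W s)"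
proof -
  have m: "matching Z S" using S by (simp add: sheafify_carrier)
  have Z: "Z \<in> C" by (rule matching_C[OF m])
  obtain Q where Q: "Q \<subseteq> S" "finite Q" "covers X Z (fst ` Q)" "matching Z Q"
    using matching_finite[OF m] by blast
  \<comment> \<open>\<open>tau_glue\<close> takes finite families, so the section is glued from a
    finite covering part \<open>Q\<close> and compared with the other members of \<open>S\<close>
    afterwards.\<close>
  let ?P = "(\<lambda>(W, s). (W, \<phi> W s)) ` Q"
  have mem: "W \<in> C \<and> Z \<subseteq> W \<and> s \<in> carrier (sec F W)" if "(W, s) \<in> S" for W s
    using sheafify_memD[OF S that] .
  have ag: "agree X F (V, s) (W, t)" if "(V, s) \<in> S" "(W, t) \<in> S" for V s W t
    by (rule matching_agreeD[OF m that])
  have "\<exists>t\<in>carrier (sec (tau X) Z). \<forall>(W, x)\<in>?P. res (tau X) Z W t = x"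
  proof (rule tau_glue)
    have "fst ` ?P = fst ` Q" by (force simp: image_iff)
    then show "covers X Z (fst ` ?P)" using Q by simp
    show "finite ?P" using Q by simp
    show "x \<in> carrier (sec (tau X) W)" if "(W, x) \<in> ?P" for W x
      using that Q(1) mem by (auto intro!: \<phi>_closed)
    fix V x W y assume "(V, x) \<in> ?P" "(W, y) \<in> ?P"
    then obtain s t where st: "(V, s) \<in> S" "x = \<phi> V s" "(W, t) \<in> S" "y = \<phi> W t" using Q(1) by auto
    show "res (tau X) V (V \<union> W) x = res (tau X) W (V \<union> W) y"
      unfolding st(2,4) using mem[OF st(1)] mem[OF st(3)] by (intro agree_tau ag st) auto
  qed
  then obtain t where t: "t \<in> carrier (sec (tau X) Z)" "\<And>W s. (W, s) \<in> Q \<Longrightarrow> res (tau X) Z W t = \<phi> W s"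
    by fastforce
  have "res (tau X) Z V t = \<phi> V s" if s: "(V, s) \<in> S" for V s
  proof -
    have V: "V \<in> C" "Z \<subseteq> V" "s \<in> carrier (sec F V)" using mem[OF s] by auto
    note c = presheafD(4)[OF is_presheaf_tau]
    \<comment> \<open>The sets \<open>V \<union> W\<close> with \<open>W\<close> from
      \<open>Q\<close> cover \<open>V\<close>. On each of them \<open>t\<close> restricts to the
      value of \<open>\<phi>\<close> at the member over \<open>W\<close>, which
      \<open>agree_tau\<close> identifies with the restriction of \<open>\<phi> V s\<close>.\<close>
    have "covers X V ((\<lambda>(T, T'). T \<union> T') ` (fst ` Q \<times> {V}))"
      using covers_refine[OF Q(3), of V "{V}"] V by (simp add: covers_def Un_absorb1)
    then show ?thesis
    proof (rule tau_separated)
      show "res (tau X) Z V t \<in> carrier (sec (tau X) V)"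
        by (rule semiring_homD(2)[OF tau_res_hom[OF Z V(1,2)] t(1)])
      show "\<phi> V s \<in> carrier (sec (tau X) V)" by (rule \<phi>_closed[OF V(1,3)])
      fix T assume "T \<in> (\<lambda>(T, T'). T \<union> T') ` (fst ` Q \<times> {V})"
      then obtain p where "T = V \<union> fst p" "p \<in> Q" by auto
      then obtain W r where T: "T = V \<union> W" "(W, r) \<in> Q" by (cases p) simp
      have W: "(W, r) \<in> S" "W \<in> C" "Z \<subseteq> W" "r \<in> carrier (sec F W)" using T(2) Q(1) mem by auto
      have "res (tau X) V T (res (tau X) Z V t) = res (tau X) W T (res (tau X) Z W t)"
        using V W T(1) t(1) Z by (simp add: c)
      also have "\<dots> = res (tau X) V T (\<phi> V s)"
        using agree_tau[OF ag[OF s W(1)]] V W t(2)[OF T(2)] T(1) by simp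
      finally show "res (tau X) V T (res (tau X) Z V t) = res (tau X) V T (\<phi> V s)" .
    qed
  qed
  with t(1) have ex: "t \<in> carrier (sec (tau X) Z) \<and> (\<forall>(W, s)\<in>S. res (tau X) Z W t = \<phi> W s)" by auto
  show ?thesis
  proof (rule ex1I[of _ t])
    fix u assume u: "u \<in> carrier (sec (tau X) Z) \<and> (\<forall>(W, s)\<in>S. res (tau X) Z W u = \<phi> W s)"
    have "res (tau X) Z W u = res (tau X) Z W t" if "(W, s) \<in> S" for W s
      using bspec[OF conjunct2[OF u] that] bspec[OF conjunct2[OF ex] that] by simp
    then show "u = t" by (rule separated_on[OF m conjunct1[OF u] t(1)])
  qed (rule ex)
qed

abbreviation ext where "ext \<equiv> sheafify_ext X F (tau X) \<phi>"

lemma ext_props: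
  assumes S: "S \<in> carrier (sheafify_sec X F Z)"
  shows "ext Z S \<in> carrier (sec (tau X) Z)"
    and "(W, s) \<in> S \<Longrightarrow> res (tau X) Z W (ext Z S) = \<phi> W s"
proof -
  have "Z \<in> C" using S matching_C by (auto simp: sheafify_carrier)
  then have "ext Z S = (THE t. t \<in> carrier (sec (tau X) Z) \<and> (\<forall>(W, s)\<in>S. res (tau X) Z W t = \<phi> W s))"
    using S by (simp add: sheafify_ext_def)
  then have *: "ext Z S \<in> carrier (sec (tau X) Z) \<and> (\<forall>(W, s)\<in>S. res (tau X) Z W (ext Z S) = \<phi> W s)"
    using theI'[OF glue_ex1[OF S]] by simp
  then show "ext Z S \<in> carrier (sec (tau X) Z)" by simp
  show "res (tau X) Z W (ext Z S) = \<phi> W s" if "(W, s) \<in> S"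
    using bspec[OF conjunct2[OF *] that] by simp
qed

text \<open>By separatedness the value of \<open>ext\<close> has to be tested on a matching
  subfamily of \<open>S\<close> only.\<close>

lemma ext_eqI:
  assumes S: "S \<in> carrier (sheafify_sec X F Z)" and Q: "matching Z Q" "Q \<subseteq> S"
    and t: "t \<in> carrier (sec (tau X) Z)" "\<And>W s. (W, s) \<in> Q \<Longrightarrow> res (tau X) Z W t = \<phi> W s"
  shows "ext Z S = t"
proof (rule separated_on[OF Q(1) ext_props(1)[OF S] t(1)])
  show "res (tau X) Z W (ext Z S) = res (tau X) Z W t" if "(W, s) \<in> Q" for W s
    using ext_props(2)[OF S subsetD[OF Q(2) that]] t(2)[OF that] by simp
qed

lemma ext_unit:
  assumes "Z \<in> C" "s \<in> carrier (sec F Z)"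
  shows "ext Z (sheafify_unit X F Z s) = \<phi> Z s"
  using assms presheafD(3)[OF is_presheaf_tau assms(1)] \<phi>_closed[OF assms]
  by (intro ext_eqI[where Q = "{(Z, s)}"] sheafify_unit_carrier matching_single)
    (auto intro: sheafify_unit_mem)

text \<open>Stated for a pair of corresponding operations \<open>f\<close> and \<open>g\<close>, to
  serve both addition and multiplication. By \<open>ext_eqI\<close> it is tested on
  \<open>op_family f S T\<close>; the restricted arguments occurring there belong to
  \<open>S\<close> and \<open>T\<close> by \<open>res_mem\<close>, so \<open>ext\<close> is known on
  them.\<close>

lemma ext_op:
  assumes S: "S \<in> carrier (sheafify_sec X F Z)" and T: "T \<in> carrier (sheafify_sec X F Z)"
    and f: "section_op f"
    and g: "\<And>x y. x \<in> carrier (sec (tau X) Z) \<Longrightarrow> y \<in> carrier (sec (tau X) Z) \<Longrightarrow>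
      g Z x y \<in> carrier (sec (tau X) Z)"
    and gr: "\<And>x y W. x \<in> carrier (sec (tau X) Z) \<Longrightarrow> y \<in> carrier (sec (tau X) Z) \<Longrightarrow> W \<in> C \<Longrightarrow> Z \<subseteq> W \<Longrightarrow>
      res (tau X) Z W (g Z x y) = g W (res (tau X) Z W x) (res (tau X) Z W y)"
    and fg: "\<And>W x y. W \<in> C \<Longrightarrow> x \<in> carrier (sec F W) \<Longrightarrow> y \<in> carrier (sec F W) \<Longrightarrow>
      \<phi> W (f W x y) = g W (\<phi> W x) (\<phi> W y)"
  shows "ext Z (saturate X F Z (op_family f S T)) = g Z (ext Z S) (ext Z T)"
proof -
  have m: "matching Z (op_family f S T)"
    using S T f by (simp add: sheafify_carrier matching_op_family)
  have Z: "Z \<in> C" by (rule matching_C[OF m])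
  show ?thesis
  proof (rule ext_eqI[OF saturate_carrier[OF m] m matching_subset_saturate[OF m]])
    show "g Z (ext Z S) (ext Z T) \<in> carrier (sec (tau X) Z)"
      using g ext_props[OF S] ext_props[OF T] by simp
    fix U r assume "(U, r) \<in> op_family f S T"
    then obtain V W s t where *: "U = V \<union> W" "r = f U (res F V U s) (res F W U t)"
      "(V, s) \<in> S" "(W, t) \<in> T" by (auto simp: op_family_def)
    have V: "V \<in> C" "Z \<subseteq> V" "s \<in> carrier (sec F V)" "W \<in> C" "Z \<subseteq> W" "t \<in> carrier (sec F W)"
      using sheafify_memD[OF S *(3)] sheafify_memD[OF T *(4)] by auto
    then have U: "U \<in> C" "V \<subseteq> U" "W \<subseteq> U" "Z \<subseteq> U" using *(1) by auto
    have "res (tau X) Z U (g Z (ext Z S) (ext Z T)) =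
      g U (res (tau X) Z U (ext Z S)) (res (tau X) Z U (ext Z T))"
      using gr ext_props(1)[OF S] ext_props(1)[OF T] U by simp
    also have "res (tau X) Z U (ext Z S) = \<phi> U (res F V U s)"
      by (rule ext_props(2)[OF S res_mem[OF S *(3) U(1,2)]])
    also have "res (tau X) Z U (ext Z T) = \<phi> U (res F W U t)"
      by (rule ext_props(2)[OF T res_mem[OF T *(4) U(1,3)]])
    also have "g U (\<phi> U (res F V U s)) (\<phi> U (res F W U t)) = \<phi> U r"
      using fg[OF U(1)] V U res_closed *(2) by simp
    finally show "res (tau X) Z U (g Z (ext Z S) (ext Z T)) = \<phi> U r" .
  qed
qed

lemma ext_mor: "ext \<in> presheaf_mor X (sheafify X F) (tau X)"
proof -
  have "ext Z \<in> semiring_hom (sheafify_sec X F Z) (sec (tau X) Z)" if Z: "Z \<in> C" for Z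
  proof (rule semiring_homI)
    note p = pirng_closed[OF presheafD(1)[OF psh Z]]
    note h = semiring_homD[OF \<phi>_hom]
    note r = semiring_homD[OF tau_res_hom[OF Z]]
    show "ext Z \<in> extensional (carrier (sheafify_sec X F Z))" using Z by (simp add: sheafify_ext_def)
    show "ext Z S \<in> carrier (sec (tau X) Z)" if "S \<in> carrier (sheafify_sec X F Z)" for S
      by (rule ext_props(1)[OF that])
    have "ext Z (sheafify_unit X F Z \<one>\<^bsub>sec F Z\<^esub>) = \<phi> Z \<one>\<^bsub>sec F Z\<^esub>"
      "ext Z (sheafify_unit X F Z \<zero>\<^bsub>sec F Z\<^esub>) = \<phi> Z \<zero>\<^bsub>sec F Z\<^esub>"
      using Z p by (simp_all add: ext_unit)
    then show "ext Z \<one>\<^bsub>sheafify_sec X F Z\<^esub> = \<one>\<^bsub>sec (tau X) Z\<^esub>"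
      "ext Z \<zero>\<^bsub>sheafify_sec X F Z\<^esub> = \<zero>\<^bsub>sec (tau X) Z\<^esub>"
      using semiring_homD(5,6)[OF sheafify_unit_hom[OF Z]] h(5,6)[OF Z] p by simp_all
    fix S T assume ST: "S \<in> carrier (sheafify_sec X F Z)" "T \<in> carrier (sheafify_sec X F Z)"
    have fm: "\<phi> W (x \<otimes>\<^bsub>sec F W\<^esub> y) = \<phi> W x \<otimes>\<^bsub>sec (tau X) W\<^esub> \<phi> W y"
      "\<phi> W (x \<oplus>\<^bsub>sec F W\<^esub> y) = \<phi> W x \<oplus>\<^bsub>sec (tau X) W\<^esub> \<phi> W y"
      if "W \<in> C" "x \<in> carrier (sec F W)" "y \<in> carrier (sec F W)" for W x y
      using h(3,4)[OF that] that pirng_closed(3,4)[OF presheafD(1)[OF psh that(1)] that(2,3)] by simp_all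
    show "ext Z (S \<otimes>\<^bsub>sheafify_sec X F Z\<^esub> T) = ext Z S \<otimes>\<^bsub>sec (tau X) Z\<^esub> ext Z T"
      unfolding sheafify_ops
      by (rule ext_op[OF ST section_op_mult, where g = "\<lambda>Z. (\<otimes>\<^bsub>sec (tau X) Z\<^esub>)"])
        (use pirng_closed[OF pirng_tau[OF Z]] r(3) fm(1) in auto)
    show "ext Z (S \<oplus>\<^bsub>sheafify_sec X F Z\<^esub> T) = ext Z S \<oplus>\<^bsub>sec (tau X) Z\<^esub> ext Z T"
      unfolding sheafify_ops
      by (rule ext_op[OF ST section_op_add, where g = "\<lambda>Z. (\<oplus>\<^bsub>sec (tau X) Z\<^esub>)"])
        (use pirng_closed[OF pirng_tau[OF Z]] r(4) fm(2) in auto)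
  qed
  moreover have "ext W (res (sheafify X F) Z W S) = res (tau X) Z W (ext Z S)"
    if Z: "Z \<in> C" "W \<in> C" "Z \<subseteq> W" and S: "S \<in> carrier (sheafify_sec X F Z)" for Z W S
  proof -
    have R: "res (sheafify X F) Z W S \<in> carrier (sheafify_sec X F W)"
      by (rule sheafify_res_carrier[OF S Z(2,3)])
    then have m: "matching W (res (sheafify X F) Z W S)" by (simp add: sheafify_carrier)
    show ?thesis
    proof (rule ext_eqI[OF R m])
      show "res (tau X) Z W (ext Z S) \<in> carrier (sec (tau X) W)"
        by (rule semiring_homD(2)[OF tau_res_hom[OF Z] ext_props(1)[OF S]])
      fix V s assume V: "(V, s) \<in> res (sheafify X F) Z W S"
      then have V': "(V, s) \<in> S" "W \<subseteq> V" using sheafify_res[OF S] by auto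
      then have "V \<in> C" using sheafify_memD[OF S] by blast
      then show "res (tau X) W V (res (tau X) Z W (ext Z S)) = \<phi> V s"
        using presheafD(4)[OF is_presheaf_tau Z(1,2) _ Z(3) V'(2)] ext_props[OF S] V'(1) by simp
    qed simp
  qed
  ultimately show ?thesis
    by (simp add: presheaf_mor_def) (simp add: sheafify_def sheafify_ext_def)
qed

end

section \<open>The sheaf \<open>\<alpha>\<^sub>1 F\<close>\<close>

lemma alpha1_presheaf_simps [simp]:
  "sec (alpha1_presheaf F) Z = alpha1 (sec F Z)"
  "res (alpha1_presheaf F) Z W = alpha1_map (sec F Z) (sec F W) (res F Z W)"
  by (simp_all add: alpha1_presheaf_def)

lemma is_presheaf_alpha1:
  assumes F: "is_presheaf X F"
  shows "is_presheaf X (alpha1_presheaf F)"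
  unfolding is_presheaf_def
proof (intro conjI ballI impI)
  note p = presheafD[OF F]
  fix Z assume Z: "Z \<in> carrier (Ccpt X)"
  show "pirng (sec (alpha1_presheaf F) Z)" using p(1)[OF Z] by (simp add: pirng_alpha1)
  show "res (alpha1_presheaf F) Z Z s = s" if s: "s \<in> carrier (sec (alpha1_presheaf F) Z)" for s
  proof -
    obtain a where a: "a \<in> carrier (sec F Z)" "s = alpha2 (sec F Z) a" using s by (auto simp: alpha1_carrier)
    then show ?thesis
      using p(1)[OF Z] p(2)[OF Z Z] p(3)[OF Z] by (simp add: alpha1_map_alpha2)
  qed
  fix W assume W: "W \<in> carrier (Ccpt X)"
  show "res (alpha1_presheaf F) Z W \<in> semiring_hom (sec (alpha1_presheaf F) Z) (sec (alpha1_presheaf F) W)"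
    if "ile (Ccpt X) W Z"
    using that p(1)[OF Z] p(1)[OF W] p(2)[OF Z W] by (simp add: alpha1_map_hom)
  fix V s assume V: "V \<in> carrier (Ccpt X)" "ile (Ccpt X) W Z \<and> ile (Ccpt X) V W"
    and s: "s \<in> carrier (sec (alpha1_presheaf F) Z)"
  then obtain a where a: "a \<in> carrier (sec F Z)" "s = alpha2 (sec F Z) a" by (auto simp: alpha1_carrier)
  have "Z \<subseteq> W" "W \<subseteq> V" "Z \<subseteq> V" using V by auto
  then show "res (alpha1_presheaf F) W V (res (alpha1_presheaf F) Z W s) = res (alpha1_presheaf F) Z V s"
    using a p(1)[OF Z] p(1)[OF W] p(1)[OF V(1)] p(2)[OF Z W] p(2)[OF W V(1)] p(2)[OF Z V(1)]
      p(4)[OF Z W V(1)] semiring_homD(2)[OF p(2)[OF Z W]]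
    by (simp add: alpha1_map_alpha2)
qed

locale semiring_presheaf = presheaf_space
begin

sublocale alpha1: presheaf_space X "alpha1_presheaf F"
  by unfold_locales (rule is_presheaf_alpha1[OF psh])

lemma alpha1_sec: "sec (alpha1_sheaf X F) = sheafify_sec X (alpha1_presheaf F)"
  by (simp add: alpha1_sheaf_def sheafify_def)

lemma alpha2_sheaf_carrier:
  "Z \<in> C \<Longrightarrow> a \<in> carrier (sec F Z) \<Longrightarrow> alpha2_sheaf X F Z a \<in> carrier (sec (alpha1_sheaf X F) Z)"
  unfolding alpha2_sheaf_def alpha1_sec
  by (rule alpha1.sheafify_unit_carrier) (auto simp: alpha1_carrier)

lemma alpha2_sheaf_hom:
  assumes Z: "Z \<in> C"
  shows "restrict (alpha2_sheaf X F Z) (carrier (sec F Z)) \<in> semiring_hom (sec F Z) (sec (alpha1_sheaf X F) Z)"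
proof -
  have "compose (carrier (sec F Z)) (sheafify_unit X (alpha1_presheaf F) Z) (alpha2 (sec F Z))
    \<in> semiring_hom (sec F Z) (sec (alpha1_sheaf X F) Z)"
    using compose_semiring_hom[OF presheafD(1)[OF psh Z] alpha2_hom[OF presheafD(1)[OF psh Z]]]
      alpha1.sheafify_unit_hom[OF Z] by (simp add: alpha1_sec)
  moreover have "restrict (alpha2_sheaf X F Z) (carrier (sec F Z)) =
    compose (carrier (sec F Z)) (sheafify_unit X (alpha1_presheaf F) Z) (alpha2 (sec F Z))"
    unfolding compose_def by (rule restrict_ext) (simp add: alpha2_sheaf_def)
  ultimately show ?thesis by simp
qed

lemma alpha2_sheaf_res:
  assumes Z: "Z \<in> C" "W \<in> C" "Z \<subseteq> W" and a: "a \<in> carrier (sec F Z)"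
  shows "res (alpha1_sheaf X F) Z W (alpha2_sheaf X F Z a) = alpha2_sheaf X F W (res F Z W a)"
proof -
  have "alpha2 (sec F Z) a \<in> carrier (sec (alpha1_presheaf F) Z)" using a by (auto simp: alpha1_carrier)
  then show ?thesis
    using alpha1.sheafify_res_unit[OF Z] presheafD(1)[OF psh Z(1)] presheafD(1)[OF psh Z(2)]
      presheafD(2)[OF psh Z] a
    by (simp add: alpha2_sheaf_def alpha1_sheaf_def alpha1_map_alpha2)
qed

text \<open>Combines \<open>sheafify_res_mem\<close> with the fact that every element of
  \<open>alpha1\<close> is a value of \<open>alpha2\<close>.\<close>

lemma alpha1_sheaf_locally_alpha2:
  assumes S: "S \<in> carrier (sec (alpha1_sheaf X F) Z)" and s: "(W, s) \<in> S"
  obtains a where "W \<in> C" "Z \<subseteq> W" "a \<in> carrier (sec F W)" "s = alpha2 (sec F W) a"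
    "res (alpha1_sheaf X F) Z W S = alpha2_sheaf X F W a"
proof -
  have S': "S \<in> carrier (sheafify_sec X (alpha1_presheaf F) Z)" using S by (simp add: alpha1_sec)
  have W: "W \<in> C" "Z \<subseteq> W" "s \<in> carrier (alpha1 (sec F W))" using alpha1.sheafify_memD[OF S' s] by auto
  then obtain a where a: "a \<in> carrier (sec F W)" "s = alpha2 (sec F W) a" by (auto simp: alpha1_carrier)
  show ?thesis
    using that[OF W(1,2) a] alpha1.sheafify_res_mem[OF S' s] a(2)
    by (simp add: alpha2_sheaf_def alpha1_sheaf_def)
qed

end

lemma alpha1_presheaf_map:
  assumes "presheaf_map X G Y F f \<phi>"
  shows "presheaf_map X (alpha1_presheaf G) Y (alpha1_presheaf F) f
    (\<lambda>Z. alpha1_map (sec F Z) (sec G (preim X f Z)) (\<phi> Z))"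
proof -
  interpret presheaf_map X G Y F f \<phi> by fact
  note pF = presheafD[OF Y.psh] and pG = presheafD[OF psh]
  note preC = preim_Ccpt[OF f]
  show ?thesis
  proof unfold_locales
    show "is_presheaf X (alpha1_presheaf G)" "is_presheaf Y (alpha1_presheaf F)"
      by (rule is_presheaf_alpha1, fact psh Y.psh)+
    show "(\<lambda>Z\<in>Y.C. alpha1_map (sec F Z) (sec G (pre Z)) (\<phi> Z))
      \<in> presheaf_mor Y (alpha1_presheaf F) (pushforward X f (alpha1_presheaf G))"
    proof (rule presheaf_morI)
      fix Z assume Z: "Z \<in> Y.C"
      show "(\<lambda>Z\<in>Y.C. alpha1_map (sec F Z) (sec G (pre Z)) (\<phi> Z)) Z
        \<in> semiring_hom (sec (alpha1_presheaf F) Z) (sec (pushforward X f (alpha1_presheaf G)) Z)"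
        using Z \<phi>_hom[OF Z] pF(1)[OF Z] pG(1)[OF preC[OF Z]] by (simp add: alpha1_map_hom)
      fix W s assume W: "W \<in> Y.C" "Z \<subseteq> W" and s: "s \<in> carrier (sec (alpha1_presheaf F) Z)"
      obtain a where a: "a \<in> carrier (sec F Z)" "s = alpha2 (sec F Z) a" using s by (auto simp: alpha1_carrier)
      note pZ = preC[OF Z] and pW = preC[OF W(1)] and ZW = preim_simps(5)[OF f W(2)]
      show "(\<lambda>Z\<in>Y.C. alpha1_map (sec F Z) (sec G (pre Z)) (\<phi> Z)) W (res (alpha1_presheaf F) Z W s) =
        res (pushforward X f (alpha1_presheaf G)) Z W ((\<lambda>Z\<in>Y.C. alpha1_map (sec F Z) (sec G (pre Z)) (\<phi> Z)) Z s)"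
        using Z W a pF(1)[OF Z] pF(1)[OF W(1)] pF(2)[OF Z W] pG(1)[OF pZ] pG(1)[OF pW] pG(2)[OF pZ pW ZW]
          \<phi>_hom[OF Z] \<phi>_hom[OF W(1)] \<phi>_res[OF Z W a(1)] semiring_homD(2)[OF \<phi>_hom[OF Z] a(1)]
          semiring_homD(2)[OF pF(2)[OF Z W] a(1)]
        by (simp add: alpha1_map_alpha2)
    qed simp
  qed
qed

locale semiring_presheaf_map = presheaf_map
begin

sublocale alpha1: presheaf_map X "alpha1_presheaf G" Y "alpha1_presheaf F" f
  "\<lambda>Z. alpha1_map (sec F Z) (sec G (preim X f Z)) (\<phi> Z)"
  by (rule alpha1_presheaf_map) unfold_locales

text \<open>Naturality of \<open>alpha2\<close>; it makes the compatibility condition of a scheme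
  morphism computable at sections that come from the structure sheaf.\<close>

lemma alpha1_mor_alpha2:
  assumes Z: "Z \<in> Y.C" and a: "a \<in> carrier (sec F Z)"
  shows "alpha1_mor X Y f F G \<phi> Z (alpha2_sheaf Y F Z a) = alpha2_sheaf X G (pre Z) (\<phi> Z a)"
proof -
  have "alpha2 (sec F Z) a \<in> carrier (sec (alpha1_presheaf F) Z)" using a by (auto simp: alpha1_carrier)
  then show ?thesis
    using alpha1.sheafify_map_unit[OF Z] \<phi>_hom[OF Z] a presheafD(1)[OF Y.psh Z]
      presheafD(1)[OF psh preim_Ccpt[OF f Z]]
    by (simp add: alpha1_mor_def alpha2_sheaf_def alpha1_map_alpha2)
qed

lemma alpha1_mor_carrier:
  "S \<in> carrier (sec (alpha1_sheaf Y F) Z) \<Longrightarrow>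
    alpha1_mor X Y f F G \<phi> Z S \<in> carrier (sec (alpha1_sheaf X G) (pre Z))"
  using alpha1.sheafify_map_carrier[of S Z]
  by (simp add: alpha1_mor_def alpha1_sheaf_def sheafify_def)

end

section \<open>The category of algebraic idealic schemes\<close>

locale scheme =
  fixes A :: "('p, 'r) isch"
  assumes isch: "is_isch A"
begin

sublocale semiring_presheaf "space A" "struct A"
  using isch by unfold_locales (auto simp: is_isch_def is_sheaf_def)

lemma beta_mor: "beta A \<in> presheaf_mor (space A) (alpha1_sheaf (space A) (struct A)) (tau (space A))"
  using isch by (simp add: is_isch_def)

end

lemma isch_homD:
  assumes "(f, \<phi>) \<in> isch_hom A B"
  shows "f \<in> qc_maps (space A) (space B)"
    and "\<phi> \<in> presheaf_mor (space B) (struct B) (pushforward (space A) f (struct A))"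
    and "Z \<in> carrier (Ccpt (space B)) \<Longrightarrow> S \<in> carrier (sec (alpha1_sheaf (space B) (struct B)) Z) \<Longrightarrow>
      beta A (preim (space A) f Z) (alpha1_mor (space A) (space B) f (struct B) (struct A) \<phi> Z S) =
      tau_map (space A) (space B) f Z (beta B Z S)"
  using assms by (simp_all add: isch_hom_def)

locale scheme_map = A: scheme A + B: scheme B for A B :: "('p, 'r) isch" +
  fixes f \<phi>
  assumes fp: "(f, \<phi>) \<in> isch_hom A B"
begin

sublocale semiring_presheaf_map "space A" "struct A" "space B" "struct B" f \<phi>
  by unfold_locales (intro isch_homD[OF fp] presheaf_mor_restrict)+

lemma \<phi>_mem: "Z \<in> B.C \<Longrightarrow> s \<in> carrier (sec (struct B) Z) \<Longrightarrow> \<phi> Z s \<in> carrier (sec (struct A) (preim (space A) f Z))"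
  by (rule semiring_homD(2)[OF \<phi>_hom])

end

lemma isch_id_hom:
  assumes "is_isch A"
  shows "isch_id A \<in> isch_hom A A"
proof -
  interpret scheme A by unfold_locales fact
  let ?X = "space A" and ?F = "struct A"
  let ?i = "\<lambda>x\<in>topspace ?X. x"
  let ?\<phi> = "\<lambda>Z\<in>C. \<lambda>s\<in>carrier (sec ?F Z). s"
  have mor: "?\<phi> \<in> presheaf_mor ?X ?F (pushforward ?X ?i ?F)"
    using presheafD[OF psh] res_closed
    by (intro presheaf_morI semiring_homI) (auto simp: preim_ident pirng_closed)
  interpret m: presheaf_map ?X ?F ?X ?F ?i ?\<phi>
    by unfold_locales (intro ident_qc_maps presheaf_mor_restrict mor)+
  have "alpha1_mor ?X ?X ?i ?F ?F ?\<phi> Z S = S"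
    if Z: "Z \<in> C" and S: "S \<in> carrier (sec (alpha1_sheaf ?X ?F) Z)" for Z S
    unfolding alpha1_mor_def
  proof (rule alpha1.sheafify_map_id[OF ident_qc_maps])
    show "S \<in> carrier (sheafify_sec ?X (alpha1_presheaf ?F) Z)" using S by (simp add: alpha1_sec)
    fix W s assume W: "W \<in> C" and "s \<in> carrier (sec (alpha1_presheaf ?F) W)"
    then obtain a where a: "a \<in> carrier (sec ?F W)" "s = alpha2 (sec ?F W) a" by (auto simp: alpha1_carrier)
    then show "alpha1_map (sec ?F W) (sec ?F (preim ?X ?i W)) (?\<phi> W) s = s"
      using W m.\<phi>_hom[OF W] presheafD(1)[OF psh W] by (simp add: preim_ident alpha1_map_alpha2)
  qed simp
  then show ?thesis
    using mor ident_qc_maps semiring_homD(2)[OF presheaf_morD(2)[OF beta_mor]]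
    by (simp add: isch_id_def isch_hom_def preim_ident tau_map_ident)
qed

text \<open>The compatibility squares of \<open>f\<close> and \<open>g\<close> are pasted. This
  rests on the functoriality of \<open>alpha1_mor\<close>, supplied by
  \<open>sheafify_map_comp\<close> and checked on elements \<open>alpha2 a\<close>, and on
  \<open>tau_map_compose\<close>.\<close>

lemma isch_comp_hom:
  assumes A: "is_isch A" and B: "is_isch B" and D: "is_isch D"
    and f: "f \<in> isch_hom A B" and g: "g \<in> isch_hom B D"
  shows "isch_comp A B D g f \<in> isch_hom A D"
proof -
  obtain f0 \<phi> where f': "f = (f0, \<phi>)" by fastforce
  obtain g0 \<psi> where g': "g = (g0, \<psi>)" by fastforce
  interpret f: scheme_map A B f0 \<phi> by unfold_locales (use A B f f' in auto)
  interpret g: scheme_map B D g0 \<psi> by unfold_locales (use B D g g' in auto)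
  let ?h = "compose (topspace (space A)) g0 f0"
  let ?\<chi> = "\<lambda>Z\<in>g.B.C. compose (carrier (sec (struct D) Z)) (\<phi> (preim (space B) g0 Z)) (\<psi> Z)"
  note pc = preim_compose[OF f.f]
  have h: "?h \<in> qc_maps (space A) (space D)" by (rule compose_qc_maps[OF f.f g.f])
  have mor: "?\<chi> \<in> presheaf_mor (space D) (struct D) (pushforward (space A) ?h (struct A))"
  proof (rule presheaf_morI)
    fix Z assume Z: "Z \<in> g.B.C"
    show "?\<chi> Z \<in> semiring_hom (sec (struct D) Z) (sec (pushforward (space A) ?h (struct A)) Z)"
      using Z compose_semiring_hom[OF presheafD(1)[OF g.B.psh Z] g.\<phi>_hom[OF Z] f.\<phi>_hom[OF g.pre_C[OF Z]]]
      by (simp add: pc)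
    fix W s assume W: "W \<in> g.B.C" "Z \<subseteq> W" and s: "s \<in> carrier (sec (struct D) Z)"
    show "?\<chi> W (res (struct D) Z W s) = res (pushforward (space A) ?h (struct A)) Z W (?\<chi> Z s)"
      using Z W s g.B.res_closed[OF Z W s] g.\<phi>_res[OF Z W s] g.\<phi>_mem[OF Z s]
        f.\<phi>_res[OF g.pre_C[OF Z] g.pre_C[OF W(1)] preim_simps(5)[OF g.f W(2)] g.\<phi>_mem[OF Z s]]
      by (simp add: pc compose_eq)
  qed simp
  interpret h: semiring_presheaf_map "space A" "struct A" "space D" "struct D" ?h ?\<chi>
    by unfold_locales (intro h presheaf_mor_restrict mor)+
  have "beta A (preim (space A) ?h Z) (alpha1_mor (space A) (space D) ?h (struct D) (struct A) ?\<chi> Z S) =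
    tau_map (space A) (space D) ?h Z (beta D Z S)"
    if Z: "Z \<in> g.B.C" and S: "S \<in> carrier (sec (alpha1_sheaf (space D) (struct D)) Z)" for Z S
  proof -
    let ?T = "alpha1_mor (space B) (space D) g0 (struct D) (struct B) \<psi> Z S"
    have "alpha1_mor (space A) (space D) ?h (struct D) (struct A) ?\<chi> Z S =
      alpha1_mor (space A) (space B) f0 (struct B) (struct A) \<phi> (preim (space B) g0 Z) ?T"
      unfolding alpha1_mor_def
    proof (rule sheafify_map_comp[OF f.alpha1.presheaf_map_axioms g.alpha1.presheaf_map_axioms
          h.alpha1.presheaf_map_axioms pc])
      show "S \<in> carrier (sheafify_sec (space D) (alpha1_presheaf (struct D)) Z)"
        using S by (simp add: g.B.alpha1_sec)
      fix W s assume W: "W \<in> g.B.C" and "s \<in> carrier (sec (alpha1_presheaf (struct D)) W)"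
      then obtain a where a: "a \<in> carrier (sec (struct D) W)" "s = alpha2 (sec (struct D) W) a"
        by (auto simp: alpha1_carrier)
      note p = presheafD(1)[OF g.B.psh W] presheafD(1)[OF f.B.psh g.pre_C[OF W]]
        presheafD(1)[OF f.A.psh f.pre_C[OF g.pre_C[OF W]]]
      note hm = g.\<phi>_hom[OF W] f.\<phi>_hom[OF g.pre_C[OF W]] h.\<phi>_hom[OF W, unfolded pc]
      show "alpha1_map (sec (struct D) W) (sec (struct A) (preim (space A) ?h W)) (?\<chi> W) s =
        alpha1_map (sec (struct B) (preim (space B) g0 W))
          (sec (struct A) (preim (space A) f0 (preim (space B) g0 W))) (\<phi> (preim (space B) g0 W))
          (alpha1_map (sec (struct D) W) (sec (struct B) (preim (space B) g0 W)) (\<psi> W) s)"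
        unfolding a(2) pc alpha1_map_alpha2[OF p(1,3) hm(3) a(1)] alpha1_map_alpha2[OF p(1,2) hm(1) a(1)]
          alpha1_map_alpha2[OF p(2,3) hm(2) semiring_homD(2)[OF hm(1) a(1)]]
        using W a(1) by (simp add: compose_eq)
    qed
    moreover have T: "?T \<in> carrier (sec (alpha1_sheaf (space B) (struct B)) (preim (space B) g0 Z))"
      by (rule g.alpha1_mor_carrier[OF S])
    moreover have "beta D Z S \<in> carrier (sec (tau (space D)) Z)"
      by (rule semiring_homD(2)[OF presheaf_morD(2)[OF g.B.beta_mor Z] S])
    ultimately show ?thesis
      using isch_homD(3)[OF f.fp g.pre_C[OF Z] T] isch_homD(3)[OF g.fp Z S]
        tau_map_compose[OF f.qc_map_axioms g.qc_map_axioms Z]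
      by (simp add: pc)
  qed
  then show ?thesis
    using h mor by (simp add: f' g' isch_comp_def isch_hom_def)
qed

section \<open>The category laws for spaces and for schemes\<close>

lemma compose_ident_left: "f \<in> qc_maps X Y \<Longrightarrow> compose (topspace X) (\<lambda>x\<in>topspace Y. x) f = f"
  using qc_maps_mem[of f X Y] by (intro Id_compose) (auto simp: qc_maps_def)

lemma compose_ident_right: "f \<in> qc_maps X Y \<Longrightarrow> compose (topspace X) f (\<lambda>x\<in>topspace X. x) = f"
  using qc_maps_mem[of f X Y] by (intro compose_Id) (auto simp: qc_maps_def)

lemma compose_qc_assoc:
  assumes "f \<in> qc_maps X Y"
  shows "compose (topspace X) (compose (topspace Y) h g) f = compose (topspace X) h (compose (topspace X) g f)"
  using qc_maps_mem[OF assms] by (auto simp: compose_def fun_eq_iff)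

lemma is_category_alg_Sob: "is_category alg_Sob"
  by (simp add: is_category_def alg_Sob_def ident_qc_maps compose_qc_maps compose_ident_left
      compose_ident_right compose_qc_assoc)

lemma isch_comp_id:
  assumes A: "is_isch A" and B: "is_isch B" and f: "f \<in> isch_hom A B"
  shows "isch_comp A A B f (isch_id A) = f" and "isch_comp A B B (isch_id B) f = f"
proof -
  obtain f0 \<phi> where f': "f = (f0, \<phi>)" by fastforce
  interpret f: scheme_map A B f0 \<phi> by unfold_locales (use A B f f' in auto)
  note ext = presheaf_morD(1)[OF isch_homD(2)[OF f.fp]]
  have "(\<lambda>Z\<in>f.B.C. compose (carrier (sec (struct B) Z))
      ((\<lambda>Z\<in>f.A.C. \<lambda>s\<in>carrier (sec (struct A) Z). s) (preim (space A) f0 Z)) (\<phi> Z)) = \<phi>"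
  proof (rule extensionalityI[OF _ ext])
    fix Z assume Z: "Z \<in> f.B.C"
    have "compose (carrier (sec (struct B) Z)) (\<lambda>s\<in>carrier (sec (struct A) (preim (space A) f0 Z)). s) (\<phi> Z) = \<phi> Z"
      using semiring_homD(1,2)[OF f.\<phi>_hom[OF Z]] by (intro Id_compose) auto
    then show "(\<lambda>Z\<in>f.B.C. compose (carrier (sec (struct B) Z))
      ((\<lambda>Z\<in>f.A.C. \<lambda>s\<in>carrier (sec (struct A) Z). s) (preim (space A) f0 Z)) (\<phi> Z)) Z = \<phi> Z"
      using Z f.pre_C[OF Z] by simp
  qed simp
  then show "isch_comp A A B f (isch_id A) = f"
    using compose_ident_right[OF f.f] by (simp add: f' isch_comp_def isch_id_def)
  have "(\<lambda>Z\<in>f.B.C. compose (carrier (sec (struct B) Z)) (\<phi> (preim (space B) (\<lambda>x\<in>topspace (space B). x) Z))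
      ((\<lambda>Z\<in>f.B.C. \<lambda>s\<in>carrier (sec (struct B) Z). s) Z)) = \<phi>"
  proof (rule extensionalityI[OF _ ext])
    fix Z assume Z: "Z \<in> f.B.C"
    have "compose (carrier (sec (struct B) Z)) (\<phi> Z) (\<lambda>s\<in>carrier (sec (struct B) Z). s) = \<phi> Z"
      using semiring_homD(1,2)[OF f.\<phi>_hom[OF Z]] by (intro compose_Id) auto
    then show "(\<lambda>Z\<in>f.B.C. compose (carrier (sec (struct B) Z)) (\<phi> (preim (space B) (\<lambda>x\<in>topspace (space B). x) Z))
      ((\<lambda>Z\<in>f.B.C. \<lambda>s\<in>carrier (sec (struct B) Z). s) Z)) Z = \<phi> Z"
      using Z by (simp add: preim_ident)
  qed simp
  then show "isch_comp A B B (isch_id B) f = f"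
    using compose_ident_left[OF f.f] by (simp add: f' isch_comp_def isch_id_def)
qed

lemma isch_comp_assoc:
  assumes A: "is_isch A" and B: "is_isch B" and D: "is_isch D"
    and f: "f \<in> isch_hom A B" and g: "g \<in> isch_hom B D" and E: "is_isch E" and h: "h \<in> isch_hom D E"
  shows "isch_comp A B E (isch_comp B D E h g) f = isch_comp A D E h (isch_comp A B D g f)"
proof -
  obtain f0 \<phi> where f': "f = (f0, \<phi>)" by fastforce
  obtain g0 \<psi> where g': "g = (g0, \<psi>)" by fastforce
  obtain h0 \<chi> where h': "h = (h0, \<chi>)" by fastforce
  interpret g: scheme_map B D g0 \<psi> by unfold_locales (use B D g g' in auto)
  interpret h: scheme_map D E h0 \<chi> by unfold_locales (use D E h h' in auto)
  have "compose (carrier (sec (struct E) Z)) (\<phi> (preim (space B) (compose (topspace (space B)) h0 g0) Z))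
      (compose (carrier (sec (struct E) Z)) (\<psi> (preim (space D) h0 Z)) (\<chi> Z)) =
    compose (carrier (sec (struct E) Z))
      (compose (carrier (sec (struct D) (preim (space D) h0 Z)))
        (\<phi> (preim (space B) g0 (preim (space D) h0 Z))) (\<psi> (preim (space D) h0 Z))) (\<chi> Z)"
    if Z: "Z \<in> h.B.C" for Z
    using h.\<phi>_mem[OF Z] unfolding preim_compose[OF g.f] by (auto simp: fun_eq_iff compose_def)
  moreover have "f0 \<in> qc_maps (space A) (space B)" using f f' isch_homD(1) by fast
  ultimately show ?thesis
    using h.pre_C by (auto simp: f' g' h' isch_comp_def compose_qc_assoc intro!: restrict_ext)
qed

lemma is_category_alg_ISch: "is_category alg_ISch"
  by (simp add: is_category_def alg_ISch_def isch_id_hom isch_comp_hom isch_comp_id)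
    (blast intro: isch_comp_assoc)

section \<open>The functor \<open>C\<^sup>+\<^sup>+\<close>\<close>

lemma tau_copy_simps [simp]:
  "sec (tau_copy e X) Z = copy_ring e (sec (tau X) Z)"
  "res (tau_copy e X) Z W = copy_map e (sec (tau X) Z) (res (tau X) Z W)"
  by (simp_all add: tau_copy_def)

lemma carrier_copy [simp]: "carrier (copy_ring e R) = e ` carrier R"
  by (simp add: copy_ring_def)

lemma copy_map_copy: "inj e \<Longrightarrow> x \<in> carrier R \<Longrightarrow> copy_map e R h (e x) = e (h x)"
  by (simp add: copy_map_def)

locale copied_tau = alg_space X for X :: "'p topology" +
  fixes e :: "'p set set \<Rightarrow> 'r"
  assumes inj: "inj e"
begin

lemma inv_e [simp]: "inv_into UNIV e (e x) = x"
  by (rule inv_f_f[OF inj])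

lemma piirng_tau_copy: "Z \<in> C \<Longrightarrow> piirng (copy_ring e (sec (tau X) Z))"
  by (rule piirng_copy[OF inj piirng_tau])

lemma tau_res_closed:
  "Z \<in> C \<Longrightarrow> W \<in> C \<Longrightarrow> Z \<subseteq> W \<Longrightarrow> x \<in> carrier (sec (tau X) Z) \<Longrightarrow> res (tau X) Z W x \<in> carrier (sec (tau X) W)"
  by (rule semiring_homD(2)[OF tau_res_hom])

lemma is_presheaf_tau_copy: "is_presheaf X (tau_copy e X)"
proof -
  note p = presheafD[OF is_presheaf_tau]
  have "pirng (copy_ring e (sec (tau X) Z))" if "Z \<in> C" for Z
    using piirng_tau_copy[OF that] by (simp add: piirng_def)
  then show ?thesis
    unfolding is_presheaf_def
    by (auto simp: copy_map_hom inj p(1,2,3) copy_map_copy tau_res_closed)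
      (metis p(4))
qed

text \<open>The bijection for \<open>tau\<close> is conjugated by the injections \<open>e\<close>
  and \<open>map_prod e e\<close>.\<close>

lemma is_sheaf_tau_copy: "is_sheaf X (tau_copy e X)"
  unfolding is_sheaf_def Ccpt_simps
proof (intro conjI ballI is_presheaf_tau_copy)
  fix Z1 Z2 assume Z: "Z1 \<in> C" "Z2 \<in> C"
  let ?r = "\<lambda>s. (res (tau X) (Z1 \<inter> Z2) Z1 s, res (tau X) (Z1 \<inter> Z2) Z2 s)"
  let ?A = "carrier (sec (tau X) (Z1 \<inter> Z2))"
  let ?B = "{(s1, s2). s1 \<in> carrier (sec (tau X) Z1) \<and> s2 \<in> carrier (sec (tau X) Z2) \<and>
    res (tau X) Z1 (Z1 \<union> Z2) s1 = res (tau X) Z2 (Z1 \<union> Z2) s2}"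
  let ?r' = "\<lambda>s. (res (tau_copy e X) (Z1 \<inter> Z2) Z1 s, res (tau_copy e X) (Z1 \<inter> Z2) Z2 s)"
  let ?B' = "{(s1, s2). s1 \<in> carrier (sec (tau_copy e X) Z1) \<and> s2 \<in> carrier (sec (tau_copy e X) Z2) \<and>
    res (tau_copy e X) Z1 (Z1 \<union> Z2) s1 = res (tau_copy e X) Z2 (Z1 \<union> Z2) s2}"
  have bij: "bij_betw ?r ?A ?B"
    using is_sheaf_tau Z unfolding is_sheaf_def Ccpt_simps by blast
  have r': "?r' (e x) = map_prod e e (?r x)" if "x \<in> ?A" for x
    using that by (simp add: copy_map_copy[OF inj])
  show "bij_betw ?r' (carrier (sec (tau_copy e X) (Z1 \<inter> Z2))) ?B'"
  proof (rule bij_betw_imageI)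
    show "inj_on ?r' (carrier (sec (tau_copy e X) (Z1 \<inter> Z2)))"
    proof (rule inj_onI, unfold tau_copy_simps(1) carrier_copy, elim imageE, hypsubst)
      fix x y assume xy: "x \<in> ?A" "y \<in> ?A" and "?r' (e x) = ?r' (e y)"
      then have "map_prod e e (?r x) = map_prod e e (?r y)" using r' by metis
      then have "?r x = ?r y" using injD[OF prod.inj_map[OF inj inj]] by blast
      then have "x = y" by (rule inj_onD[OF bij_betw_imp_inj_on[OF bij] _ xy])
      then show "e x = e y" by simp
    qed
    have "?r' ` carrier (sec (tau_copy e X) (Z1 \<inter> Z2)) = map_prod e e ` ?r ` ?A"
      unfolding tau_copy_simps(1) carrier_copy image_image by (intro image_cong refl r')
    also have "\<dots> = map_prod e e ` ?B"
      using bij by (simp only: bij_betw_def)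
    also have "\<dots> = ?B'"
    proof
      show "map_prod e e ` ?B \<subseteq> ?B'" by (auto simp: copy_map_copy[OF inj])
      show "?B' \<subseteq> map_prod e e ` ?B"
      proof clarify
        fix s1 s2 assume "s1 \<in> carrier (sec (tau_copy e X) Z1)" "s2 \<in> carrier (sec (tau_copy e X) Z2)"
          and eq: "res (tau_copy e X) Z1 (Z1 \<union> Z2) s1 = res (tau_copy e X) Z2 (Z1 \<union> Z2) s2"
        then obtain x y where xy: "x \<in> carrier (sec (tau X) Z1)" "y \<in> carrier (sec (tau X) Z2)"
          "s1 = e x" "s2 = e y" by auto
        then have "res (tau X) Z1 (Z1 \<union> Z2) x = res (tau X) Z2 (Z1 \<union> Z2) y"
          using eq by (simp add: copy_map_copy[OF inj] inj_eq[OF inj])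
        then show "(s1, s2) \<in> map_prod e e ` ?B"
          using xy by (intro image_eqI[of _ _ "(x, y)"]) simp_all
      qed
    qed
    finally show "?r' ` carrier (sec (tau_copy e X) (Z1 \<inter> Z2)) = ?B'" .
  qed
qed

sublocale copy: semiring_presheaf X "tau_copy e X"
  by unfold_locales (rule is_presheaf_tau_copy)

lemma alpha2_copy: "Z \<in> C \<Longrightarrow> x \<in> carrier (sec (tau X) Z) \<Longrightarrow> alpha2 (copy_ring e (sec (tau X) Z)) (e x) = {e x}"
  by (rule piirng_alpha2[OF piirng_tau_copy]) auto

lemma alpha1_copy_carrier:
  "Z \<in> C \<Longrightarrow> A \<in> carrier (alpha1 (copy_ring e (sec (tau X) Z))) \<longleftrightarrow> (\<exists>x\<in>carrier (sec (tau X) Z). A = {e x})"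
  by (auto simp: alpha1_carrier alpha2_copy)

text \<open>The map coincides with the one that \<open>alpha1_universal\<close> attaches to the
  inverse of \<open>e\<close>, since all classes are singletons; so it inherits the homomorphism
  laws.\<close>

lemma alpha1_copy_hom:
  assumes Z: "Z \<in> C"
  shows "(\<lambda>A\<in>carrier (alpha1 (copy_ring e (sec (tau X) Z))). inv_into UNIV e (the_elem A))
    \<in> semiring_hom (alpha1 (copy_ring e (sec (tau X) Z))) (sec (tau X) Z)"
proof -
  let ?R = "sec (tau X) Z"
  note p = pirng_tau[OF Z]
  have pc: "pirng (copy_ring e ?R)" using piirng_tau_copy[OF Z] by (simp add: piirng_def)
  obtain k where k: "k \<in> semiring_hom (alpha1 (copy_ring e ?R)) ?R"
    "\<And>a. a \<in> carrier (copy_ring e ?R) \<Longrightarrow> k (alpha2 (copy_ring e ?R) a) = restrict (inv_into UNIV e) (e ` carrier ?R) a"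
    using alpha1_universal[OF pc piirng_tau[OF Z] copy_ring_hom(2)[OF inj p]] by blast
  have "(\<lambda>A\<in>carrier (alpha1 (copy_ring e ?R)). inv_into UNIV e (the_elem A)) = k"
    using semiring_homD(1)[OF k(1)]
  proof (rule extensionalityI[rotated])
    fix A assume A: "A \<in> carrier (alpha1 (copy_ring e ?R))"
    then obtain x where x: "x \<in> carrier ?R" "A = {e x}" using Z by (auto simp: alpha1_copy_carrier)
    then show "(\<lambda>A\<in>carrier (alpha1 (copy_ring e ?R)). inv_into UNIV e (the_elem A)) A = k A"
      using A k(2)[of "e x"] by (simp add: alpha2_copy[OF Z])
  qed simp
  then show ?thesis using k(1) by simp
qed

sublocale ident: presheaf_to_tau X "alpha1_presheaf (tau_copy e X)" "\<lambda>Z A. inv_into UNIV e (the_elem A)"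
proof unfold_locales
  show "(\<lambda>Z\<in>C. \<lambda>A\<in>carrier (sec (alpha1_presheaf (tau_copy e X)) Z). inv_into UNIV e (the_elem A))
    \<in> presheaf_mor X (alpha1_presheaf (tau_copy e X)) (tau X)" (is "?\<phi> \<in> _")
  proof (rule presheaf_morI)
    fix Z assume Z: "Z \<in> C"
    then show "?\<phi> Z \<in> semiring_hom (sec (alpha1_presheaf (tau_copy e X)) Z) (sec (tau X) Z)"
      by (simp add: alpha1_copy_hom)
    fix W A assume W: "W \<in> C" "Z \<subseteq> W" and A: "A \<in> carrier (sec (alpha1_presheaf (tau_copy e X)) Z)"
    then obtain x where x: "x \<in> carrier (sec (tau X) Z)" "A = {e x}" using Z by (auto simp: alpha1_copy_carrier)
    have "alpha1_map (sec (tau_copy e X) Z) (sec (tau_copy e X) W) (res (tau_copy e X) Z W)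
        (alpha2 (sec (tau_copy e X) Z) (e x)) = alpha2 (sec (tau_copy e X) W) (res (tau_copy e X) Z W (e x))"
      using presheafD[OF is_presheaf_tau_copy] Z W x(1) by (intro alpha1_map_alpha2) auto
    then have "res (alpha1_presheaf (tau_copy e X)) Z W A = {e (res (tau X) Z W x)}"
      using Z W x tau_res_closed[OF Z W] by (simp add: copy_map_copy[OF inj] alpha2_copy)
    moreover have "{e (res (tau X) Z W x)} \<in> carrier (sec (alpha1_presheaf (tau_copy e X)) W)"
      using W tau_res_closed[OF Z W x(1)] by (auto simp: alpha1_copy_carrier)
    ultimately show "?\<phi> W (res (alpha1_presheaf (tau_copy e X)) Z W A) = res (tau X) Z W (?\<phi> Z A)"
      using Z W A x by simp
  qed simp
qed

lemma tau_ident_ext: "tau_ident e X = ident.ext"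
  by (simp add: tau_ident_def)

text \<open>This is the precise sense in which the structure morphism of \<open>Cpp_obj e X\<close>
  is the identity.\<close>

lemma tau_ident_alpha2:
  assumes Z: "Z \<in> C" and x: "x \<in> carrier (sec (tau X) Z)"
  shows "tau_ident e X Z (alpha2_sheaf X (tau_copy e X) Z (e x)) = x"
proof -
  have "{e x} \<in> carrier (sec (alpha1_presheaf (tau_copy e X)) Z)"
    using Z x by (auto simp: alpha1_copy_carrier)
  then show ?thesis
    using ident.ext_unit[OF Z, of "{e x}"] Z x by (simp add: tau_ident_ext alpha2_sheaf_def alpha2_copy)
qed

text \<open>If \<open>x\<close> is the class of \<open>A\<close>, the inequality says
  \<open>A \<union> Z = (W \<inter> A) \<union> Z\<close>. With \<open>Z \<subseteq> W\<close> this
  forces \<open>A \<subseteq> W\<close>, so over \<open>W\<close> the set \<open>A\<close> is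
  identified with the empty set, the unit of \<open>Ccpt X\<close>.\<close>

lemma tau_res_loc_one:
  assumes Z: "Z \<in> C" "W \<in> C" "Z \<subseteq> W" and x: "x \<in> carrier (sec (tau X) Z)"
    and le: "ile (sec (tau X) Z) (cl Z W) x"
  shows "res (tau X) Z W x = \<one>\<^bsub>sec (tau X) W\<^esub>"
proof -
  obtain A where A: "A \<in> C" "x = cl Z A" using x by (auto simp only: tau_carrier)
  then have "cl Z (W \<inter> A) = cl Z A" using le Z by (simp add: ile_def tau_ops)
  then have "A \<union> Z = (W \<inter> A) \<union> Z" using Z A by (simp add: cl_eq)
  then have "A \<union> W = W" using Z by blast
  then show ?thesis using Z A by (simp add: tau_res tau_consts cl_eq)
qed

lemma is_isch_Cpp: "is_isch (Cpp_obj e X)"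
proof -
  have "factors_through_loc (sec (tau_copy e X) Z) (sec (tau_copy e X) W) a (res (tau_copy e X) Z W)"
    if Z: "Z \<in> C" "W \<in> C" "Z \<subseteq> W" and a: "a \<in> carrier (sec (tau_copy e X) Z)"
      and le: "ile (sec (tau X) Z) (cl Z W) (tau_ident e X Z (alpha2_sheaf X (tau_copy e X) Z a))" for Z W a
  proof -
    obtain x where x: "x \<in> carrier (sec (tau X) Z)" "a = e x" using a by auto
    \<comment> \<open>\<open>tau_ident_alpha2\<close> turns the hypothesis on \<open>a\<close> into
      an inequality for \<open>x\<close> itself; then \<open>a\<close> restricts to 1 over
      \<open>W\<close>, as \<open>loc_factor\<close> requires.\<close>
    have "res (tau X) Z W x = \<one>\<^bsub>sec (tau X) W\<^esub>"
      using le tau_ident_alpha2[OF Z(1) x(1)] by (intro tau_res_loc_one[OF Z x(1)]) (simp add: x(2))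
    then have "res (tau_copy e X) Z W a = \<one>\<^bsub>sec (tau_copy e X) W\<^esub>"
      using x by (simp add: copy_map_copy[OF inj]) (simp add: copy_ring_def)
    then show ?thesis
      using presheafD[OF is_presheaf_tau_copy] Z a by (intro loc_factor) auto
  qed
  then show ?thesis
    using alg is_sheaf_tau_copy ident.ext_mor
    by (simp add: is_isch_def Cpp_obj_def alpha1_sheaf_def tau_ident_ext)
qed

end

text \<open>
  The only candidate for \<open>f\<^sup>#\<close> is \<open>C(f) \<circ> \<beta> \<circ> \<alpha>\<^sub>2\<close>, since \<open>\<beta>\<close> of \<open>C\<^sup>+\<^sup>+\<close> is the identity.
\<close>

definition lift :: "('p set set \<Rightarrow> 'r) \<Rightarrow> 'p topology \<Rightarrow> ('p, 'r) isch \<Rightarrow> ('p \<Rightarrow> 'p) \<Rightarrow> ('p, 'r) isch_mor" where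
  "lift e X A f =
     (f, \<lambda>Z\<in>carrier (Ccpt (space A)). \<lambda>a\<in>carrier (sec (struct A) Z).
        e (tau_map X (space A) f Z (beta A Z (alpha2_sheaf (space A) (struct A) Z a))))"

lemma Cpp_obj_simps [simp]:
  "space (Cpp_obj e X) = X" "struct (Cpp_obj e X) = tau_copy e X" "beta (Cpp_obj e X) = tau_ident e X"
  by (simp_all add: Cpp_obj_def)

section \<open>Existence and uniqueness of morphisms out of \<open>Cpp_obj e X\<close> over a given
  map\<close>

locale lifting = copied_tau X e + A: scheme A + qc_map X "space A" f
  for X :: "'p topology" and e :: "'p set set \<Rightarrow> 'r" and A :: "('p, 'r) isch" and f
begin

abbreviation Y where "Y \<equiv> space A"
abbreviation \<O> where "\<O> \<equiv> struct A"

lemma beta_hom: "Z \<in> A.C \<Longrightarrow> beta A Z \<in> semiring_hom (sec (alpha1_sheaf Y \<O>) Z) (sec (tau Y) Z)"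
  by (rule presheaf_morD(2)[OF A.beta_mor])

lemma beta_closed:
  "Z \<in> A.C \<Longrightarrow> S \<in> carrier (sec (alpha1_sheaf Y \<O>) Z) \<Longrightarrow> beta A Z S \<in> carrier (sec (tau Y) Z)"
  by (rule semiring_homD(2)[OF beta_hom])

lemma tau_map_closed:
  "Z \<in> A.C \<Longrightarrow> x \<in> carrier (sec (tau Y) Z) \<Longrightarrow> tau_map X Y f Z x \<in> carrier (sec (tau X) (pre Z))"
  by (rule semiring_homD(2)[OF tau_map_hom])

lemma lift_mor: "snd (lift e X A f) \<in> presheaf_mor Y \<O> (pushforward X f (tau_copy e X))"
proof (rule presheaf_morI)
  show "snd (lift e X A f) \<in> extensional A.C" by (simp add: lift_def)
  fix Z assume Z: "Z \<in> A.C"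
  let ?c = "compose (carrier (sec \<O> Z))"
  \<comment> \<open>As a composite of four homomorphisms the candidate satisfies the semiring laws
    without further computation.\<close>
  have "?c (restrict e (carrier (sec (tau X) (pre Z)))) (?c (tau_map X Y f Z)
      (?c (beta A Z) (restrict (alpha2_sheaf Y \<O> Z) (carrier (sec \<O> Z)))))
    \<in> semiring_hom (sec \<O> Z) (sec (tau_copy e X) (pre Z))"
    unfolding tau_copy_simps
    using presheafD(1)[OF A.psh Z]
      A.alpha2_sheaf_hom[OF Z] beta_hom[OF Z] tau_map_hom[OF Z] copy_ring_hom(1)[OF inj pirng_tau[OF pre_C[OF Z]]]
    by (intro compose_semiring_hom)
  moreover have "snd (lift e X A f) Z = ?c (restrict e (carrier (sec (tau X) (pre Z)))) (?c (tau_map X Y f Z)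
      (?c (beta A Z) (restrict (alpha2_sheaf Y \<O> Z) (carrier (sec \<O> Z)))))"
    using Z A.alpha2_sheaf_carrier[OF Z] beta_closed[OF Z] tau_map_closed[OF Z]
    by (auto simp: lift_def compose_def fun_eq_iff)
  ultimately show "snd (lift e X A f) Z \<in> semiring_hom (sec \<O> Z) (sec (pushforward X f (tau_copy e X)) Z)"
    by simp
  fix W a assume W: "W \<in> A.C" "Z \<subseteq> W" and a: "a \<in> carrier (sec \<O> Z)"
  note S = A.alpha2_sheaf_carrier[OF Z a]
  have "tau_map X Y f W (beta A W (alpha2_sheaf Y \<O> W (res \<O> Z W a))) =
    res (tau X) (pre Z) (pre W) (tau_map X Y f Z (beta A Z (alpha2_sheaf Y \<O> Z a)))"
    using A.alpha2_sheaf_res[OF Z W a] presheaf_morD(3)[OF A.beta_mor Z W S] tau_map_res[OF Z W beta_closed[OF Z S]]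
    by simp
  then show "snd (lift e X A f) W (res \<O> Z W a) =
    res (pushforward X f (tau_copy e X)) Z W (snd (lift e X A f) Z a)"
    using Z W a A.res_closed[OF Z W a] tau_map_closed[OF Z beta_closed[OF Z S]]
    by (simp add: lift_def copy_map_copy[OF inj])
qed

lemma lift_hom: "lift e X A f \<in> isch_hom (Cpp_obj e X) A"
proof -
  let ?\<phi> = "snd (lift e X A f)"
  interpret m: semiring_presheaf_map X "tau_copy e X" Y \<O> f ?\<phi>
    by unfold_locales (intro presheaf_mor_restrict lift_mor)
  have "tau_ident e X (pre Z) (alpha1_mor X Y f \<O> (tau_copy e X) ?\<phi> Z S) = tau_map X Y f Z (beta A Z S)"
    if Z: "Z \<in> A.C" and S: "S \<in> carrier (sec (alpha1_sheaf Y \<O>) Z)" for Z S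
  proof -
    have S': "S \<in> carrier (sheafify_sec Y (alpha1_presheaf \<O>) Z)" using S by (simp add: A.alpha1_sec)
    have mS: "A.alpha1.matching Z S" using S' by (simp add: A.alpha1.sheafify_carrier)
    note mI = m.alpha1.matching_image[OF mS]
    \<comment> \<open>The family is kept in its form before saturation: its members come from local
      sections \<open>alpha2 a\<close>, whereas the members added by saturation have no prescribed
      form. \<open>ext_eqI\<close> allows testing on these alone.\<close>
    have eq: "alpha1_mor X Y f \<O> (tau_copy e X) ?\<phi> Z S =
      saturate X (alpha1_presheaf (tau_copy e X)) (pre Z) (m.alpha1.image_family S)"
      unfolding alpha1_mor_def by (rule m.alpha1.sheafify_map_eq[OF S' mS order.refl])
    show ?thesis
      unfolding tau_ident_ext eq
    proof (rule ident.ext_eqI[OF copy.alpha1.saturate_carrier[OF mI] mI copy.alpha1.matching_subset_saturate[OF mI]])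
      show "tau_map X Y f Z (beta A Z S) \<in> carrier (sec (tau X) (pre Z))"
        by (rule tau_map_closed[OF Z beta_closed[OF Z S]])
      fix V t assume "(V, t) \<in> m.alpha1.image_family S"
      then obtain W s where W: "V = pre W" "(W, s) \<in> S"
        "t = alpha1_map (sec \<O> W) (sec (tau_copy e X) (pre W)) (?\<phi> W) s"
        unfolding m.alpha1.image_family_def by blast
      obtain a where a: "W \<in> A.C" "Z \<subseteq> W" "a \<in> carrier (sec \<O> W)" "s = alpha2 (sec \<O> W) a"
        "res (alpha1_sheaf Y \<O>) Z W S = alpha2_sheaf Y \<O> W a"
        by (rule A.alpha1_sheaf_locally_alpha2[OF S W(2)])
      let ?x = "tau_map X Y f W (beta A W (alpha2_sheaf Y \<O> W a))"
      have x: "?x \<in> carrier (sec (tau X) (pre W))"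
        by (rule tau_map_closed[OF a(1) beta_closed[OF a(1) A.alpha2_sheaf_carrier[OF a(1,3)]]])
      \<comment> \<open>On \<open>alpha2 a\<close> the map is known, and its value is a singleton
        class from which \<open>the_elem\<close> and the inverse of \<open>e\<close> recover
        \<open>?x\<close>.\<close>
      have "t = alpha2 (sec (tau_copy e X) (pre W)) (?\<phi> W a)"
        unfolding W(3) a(4)
        by (rule alpha1_map_alpha2[OF presheafD(1)[OF A.psh a(1)] presheafD(1)[OF is_presheaf_tau_copy pre_C[OF a(1)]]
              m.\<phi>_hom[OF a(1)] a(3)])
      also have "\<dots> = {e ?x}"
        using a(1,3) alpha2_copy[OF pre_C[OF a(1)] x] by (simp add: lift_def)
      finally have "inv_into UNIV e (the_elem t) = ?x" by simp
      then show "res (tau X) (pre Z) V (tau_map X Y f Z (beta A Z S)) = inv_into UNIV e (the_elem t)"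
        using tau_map_res[OF Z a(1,2) beta_closed[OF Z S]] presheaf_morD(3)[OF A.beta_mor Z a(1,2) S] a(5) W(1)
        by simp
    qed
  qed
  then show ?thesis
    using f lift_mor by (simp add: isch_hom_def lift_def)
qed

lemma lift_unique:
  assumes "(f, \<phi>) \<in> isch_hom (Cpp_obj e X) A"
  shows "(f, \<phi>) = lift e X A f"
proof -
  note h = isch_homD[OF assms, unfolded Cpp_obj_simps]
  interpret m: semiring_presheaf_map X "tau_copy e X" Y \<O> f \<phi>
    by unfold_locales (intro presheaf_mor_restrict h)
  have "\<phi> Z a = snd (lift e X A f) Z a" if Z: "Z \<in> A.C" and a: "a \<in> carrier (sec \<O> Z)" for Z a
  proof -
    obtain x where x: "x \<in> carrier (sec (tau X) (pre Z))" "\<phi> Z a = e x"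
      using semiring_homD(2)[OF m.\<phi>_hom[OF Z] a] by auto
    have "x = tau_ident e X (pre Z) (alpha2_sheaf X (tau_copy e X) (pre Z) (\<phi> Z a))"
      using tau_ident_alpha2[OF pre_C[OF Z] x(1)] x(2) by simp
    also have "\<dots> = tau_map X Y f Z (beta A Z (alpha2_sheaf Y \<O> Z a))"
      using h(3)[OF Z A.alpha2_sheaf_carrier[OF Z a]] m.alpha1_mor_alpha2[OF Z a] by simp
    finally show ?thesis using x(2) Z a by (simp add: lift_def)
  qed
  then have "\<phi> Z = snd (lift e X A f) Z" if Z: "Z \<in> A.C" for Z
    using semiring_homD(1)[OF presheaf_morD(2)[OF h(2) Z]] semiring_homD(1)[OF presheaf_morD(2)[OF lift_mor Z]] Z
    by (intro extensionalityI[of _ "carrier (sec \<O> Z)"])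
  then have "\<phi> = snd (lift e X A f)"
    by (rule extensionalityI[OF presheaf_morD(1)[OF h(2)] presheaf_morD(1)[OF lift_mor]])
  then show ?thesis by (simp add: lift_def)
qed

end

lemma bij_betw_fst_isch_hom:
  assumes "inj e" "algebraic_sober X" "is_isch A"
  shows "bij_betw fst (isch_hom (Cpp_obj e X) A) (qc_maps X (space A))"
proof (rule bij_betwI[of _ _ _ "lift e X A"])
  have l: "lifting X e A f" if "f \<in> qc_maps X (space A)" for f
    using assms that unfolding lifting_def copied_tau_def scheme_def qc_map_def alg_space_def
      copied_tau_axioms_def qc_map_axioms_def by (auto simp: is_isch_def)
  show "lift e X A \<in> qc_maps X (space A) \<rightarrow> isch_hom (Cpp_obj e X) A"
    using lifting.lift_hom[OF l] by blast
  show "fst \<in> isch_hom (Cpp_obj e X) A \<rightarrow> qc_maps X (space A)"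
    by (auto simp: isch_hom_def)
  show "fst (lift e X A f) = f" for f by (simp add: lift_def)
  fix g assume g: "g \<in> isch_hom (Cpp_obj e X) A"
  then have "(fst g, snd g) \<in> isch_hom (Cpp_obj e X) A" by simp
  moreover from this have "fst g \<in> qc_maps X (space A)" using isch_homD(1) by fastforce
  ultimately show "lift e X A (fst g) = g"
    using lifting.lift_unique[OF l] by (metis prod.collapse)
qed

text \<open>For the target \<open>Cpp_obj e Y\<close> the composite of \<open>beta\<close> with
  \<open>alpha2\<close> cancels the copying by \<open>e\<close>, leaving \<open>tau_map\<close>. So
  \<open>lift_hom\<close> also shows that \<open>Cpp_hom\<close> yields morphisms.\<close>

lemma Cpp_hom_eq_lift:
  assumes "inj e" "algebraic_sober Y"
  shows "Cpp_hom e X Y f = lift e X (Cpp_obj e Y) f"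
proof -
  interpret copied_tau Y e by unfold_locales (fact assms)+
  show ?thesis
    by (auto simp: Cpp_hom_def lift_def tau_ident_alpha2 intro!: restrict_ext)
qed

lemma is_isch_Cpp_obj: "inj e \<Longrightarrow> algebraic_sober X \<Longrightarrow> is_isch (Cpp_obj e X)"
  by (rule copied_tau.is_isch_Cpp) (simp add: copied_tau_def copied_tau_axioms_def alg_space_def)

lemma Cpp_hom_in_isch_hom:
  assumes "inj e" "algebraic_sober X" "algebraic_sober Y" "f \<in> qc_maps X Y"
  shows "Cpp_hom e X Y f \<in> isch_hom (Cpp_obj e X) (Cpp_obj e Y)"
proof -
  interpret lifting X e "Cpp_obj e Y" f
    using assms is_isch_Cpp_obj[OF assms(1,3)] by unfold_locales simp_all
  show ?thesis using lift_hom Cpp_hom_eq_lift[OF assms(1,3)] by simp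
qed

lemma is_functor_Cpp:
  assumes e: "inj e"
  shows "is_functor alg_Sob alg_ISch (Cpp e)"
proof -
  \<comment> \<open>Both functor laws reduce to equality of first components, which is immediate
    from the definitions.\<close>
  have inj: "g = h" if "algebraic_sober X" "algebraic_sober Y" "g \<in> isch_hom (Cpp_obj e X) (Cpp_obj e Y)"
    "h \<in> isch_hom (Cpp_obj e X) (Cpp_obj e Y)" "fst g = fst h" for X Y g h
    using bij_betw_imp_inj_on[OF bij_betw_fst_isch_hom[OF e that(1) is_isch_Cpp_obj[OF e that(2)]]] that(3-5)
    by (auto dest: inj_onD)
  have fst: "fst (Cpp_hom e X Y f) = f" for X Y f by (simp add: Cpp_hom_def)
  have "Cpp_hom e X X (\<lambda>x\<in>topspace X. x) = isch_id (Cpp_obj e X)" if X: "algebraic_sober X" for X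
    by (rule inj[OF X X])
      (simp_all add: e X Cpp_hom_in_isch_hom ident_qc_maps isch_id_hom is_isch_Cpp_obj fst, simp add: isch_id_def)
  moreover have "Cpp_hom e X T (compose (topspace X) g f) =
      isch_comp (Cpp_obj e X) (Cpp_obj e Y) (Cpp_obj e T) (Cpp_hom e Y T g) (Cpp_hom e X Y f)"
    if X: "algebraic_sober X" "algebraic_sober Y" "algebraic_sober T" and f: "f \<in> qc_maps X Y" "g \<in> qc_maps Y T"
    for X Y T f g
  proof (rule inj[OF X(1,3)])
    show "isch_comp (Cpp_obj e X) (Cpp_obj e Y) (Cpp_obj e T) (Cpp_hom e Y T g) (Cpp_hom e X Y f)
      \<in> isch_hom (Cpp_obj e X) (Cpp_obj e T)"
      using X f by (intro isch_comp_hom) (simp_all add: e is_isch_Cpp_obj Cpp_hom_in_isch_hom)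
    show "Cpp_hom e X T (compose (topspace X) g f) \<in> isch_hom (Cpp_obj e X) (Cpp_obj e T)"
      using X compose_qc_maps[OF f] by (simp add: e Cpp_hom_in_isch_hom)
  qed (simp add: isch_comp_def Cpp_hom_def)
  ultimately show ?thesis
    by (simp add: is_functor_def is_category_alg_Sob is_category_alg_ISch)
      (simp add: alg_Sob_def alg_ISch_def Cpp_def e is_isch_Cpp_obj Cpp_hom_in_isch_hom)
qed

lemma is_functor_underlying: "is_functor alg_ISch alg_Sob underlying"
  unfolding is_functor_def
  by (intro conjI is_category_alg_Sob is_category_alg_ISch)
    (auto simp: alg_Sob_def alg_ISch_def underlying_def is_isch_def isch_id_def isch_comp_def
      dest: isch_homD(1) split: prod.split)

theorem proposition5p3p11:
  fixes e :: "'p set set \<Rightarrow> 'r"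
  assumes "inj e"
  shows "adjunction (alg_Sob :: ('p topology, 'p \<Rightarrow> 'p) category)
    (alg_ISch :: (('p, 'r) isch, ('p, 'r) isch_mor) category) (Cpp e) underlying"
  unfolding adjunction_def
\<comment> \<open>The bijection is \<open>fst\<close> for every pair of objects. Naturality holds by
  unfolding, since composition of scheme morphisms composes the underlying maps.\<close>
proof (intro conjI is_functor_Cpp[OF assms] is_functor_underlying exI[of _ "\<lambda>_ _. fst"] ballI)
  fix X :: "'p topology" and A :: "('p, 'r) isch"
  assume "X \<in> Obj alg_Sob" "A \<in> Obj alg_ISch"
  then show "bij_betw fst (Hom alg_ISch (onObj (Cpp e) X) A) (Hom alg_Sob X (onObj underlying A))"
    using bij_betw_fst_isch_hom[OF assms] by (simp add: alg_Sob_def alg_ISch_def Cpp_def underlying_def)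
qed (simp add: alg_Sob_def alg_ISch_def Cpp_def underlying_def isch_comp_def Cpp_hom_def split: prod.split)

end
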